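(* Let $(X,\rho)$ be a proper locally compact metric space. Assume that $(\mathscr G,\mathscr H)$ is a compact Friedrichs $X$-module and that $\mathscr K$ is a Hilbert $X$-module. Let $\mathrm d,\lambda,\Lambda$ be operators satisfying the following conditions: (i) $\mathrm d$ is a closed first order operator from $\mathscr H$ to $\mathscr K$ with $\mathcal D(\mathrm d)=\mathscr G$; (ii) $\lambda$ is a bounded self-adjoint operator on $\mathscr H$ with $\inf\lambda>0$ and such that $\lambda-1\in\mathcal K(\mathscr G,\mathscr H)$ (e.g. $\lambda-1\in\mathcal B_0(\mathscr H)$); (iii) $\Lambda$ is a bounded self-adjoint operator on $\mathscr K$ with $\inf\Lambda>0$ and such that $\Lambda-1\in\mathcal B_0(\mathscr K)$. Let $\Delta=\mathrm d^*\mathrm d$ be the positive self-adjoint operator on $\mathscr H$ associated to the closed quadratic form $\|\mathrm du\|_{\mathscr K}^2$ with domain $\mathscr G$, and let $\widetilde\Delta$ be the positive self-adjoint operator on $\widetilde{\mathscr H}$ associated to the closed quadratic form $\|\mathrm du\|_{\widetilde{\mathscr K}}^2$ with domain $\mathscr G$, where $\widetilde{\mathscr H}=\mathscr H$ and $\widetilde{\mathscr K}=\mathscr K$ as vector spaces, with scalar products $\langle u|v\rangle_{\widetilde{\mathscr H}}=\langle u|\lambda v\rangle_{\mathscr H}$ and $\langle u|v\rangle_{\widetilde{\mathscr K}}=\langle u|\Lambda v\rangle_{\mathscr K}$. Then the self-adjoint operators $\Delta$ and $\widetilde\Delta$ have the same essential spectrum.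
   Context: A locally compact metric space is proper if it is not compact but its closed balls are compact. A Hilbert $X$-module is a Hilbert space $\mathscr H$ with a $*$-morphism $Q:C_0(X)\to\mathcal B(\mathscr H)$, written $\varphi(Q)$, such that the linear span of the vectors $\varphi(Q)u$ is dense; its multiplier algebra is $\mathcal M(\mathscr H)=\{\varphi(Q):\varphi\in C_0(X)\}$. The morphism $Q$ extends canonically to the bounded continuous functions (indeed to the bounded Borel functions), with $\varphi_n(Q)\to\varphi(Q)$ strongly if $\varphi_n$ is bounded and converges pointwise to $\varphi$. A Friedrichs $X$-module $(\mathscr G,\mathscr H)$ consists of a Hilbert $X$-module $\mathscr H$ and a Hilbert space $\mathscr G\subset\mathscr H$ embedded continuously and densely; it is compact if $\varphi(Q)$, restricted to $\mathscr G$, is a compact operator $\mathscr G\to\mathscr H$ for each $\varphi\in C_0(X)$. $\mathcal K(\mathscr G,\mathscr H)$ denotes compact operators. A closed densely defined operator $\mathrm d:\mathcal D(\mathrm d)\subset\mathscr H\to\mathscr K$ is a first order operator if there is $C\in\mathbb R$ such that for each bounded Lipschitz function $\varphi$ on $X$ $$|\langle\mathrm d^*u,\varphi(Q)v\rangle_{\mathscr H}-\langle u,\varphi(Q)\mathrm dv\rangle_{\mathscr K}|\le C\,\mathrm{Lip}\,\varphi\,\|u\|_{\mathscr K}\|v\|_{\mathscr H}$$ for all $u\in\mathcal D(\mathrm d^* )$, $v\in\mathcal D(\mathrm d)$, where $\mathrm{Lip}\,\varphi=\sup_{x\ne y}|\varphi(x)-\varphi(y)|\rho(x,y)^{-1}$.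 $\mathcal B_0(\mathscr K)$ is the set of operators belonging both to the norm-closed linear span of $\{MT\}$ and to that of $\{TM\}$, with $M\in\mathcal M(\mathscr K)$, $T\in\mathcal B(\mathscr K)$; similarly $\mathcal B_0(\mathscr H)$. The essential spectrum of $A$ is the set of $\lambda\in\mathbb C$ such that $A-\lambda$ is not Fredholm. *)

theory Defs
  imports "HOL-Analysis.Analysis"
begin

section \<open>Complex Hilbert spaces\<close>

class complex_vector = real_vector +
  fixes scaleC :: "complex \<Rightarrow> 'a \<Rightarrow> 'a" (infixr \<open>*\<^sub>C\<close> 75)
  assumes scaleC_add_right: "c *\<^sub>C (x + y) = c *\<^sub>C x + c *\<^sub>C y"
    and scaleC_add_left: "(b + c) *\<^sub>C x = b *\<^sub>C x + c *\<^sub>C x"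
    and scaleC_scaleC: "b *\<^sub>C c *\<^sub>C x = (b * c) *\<^sub>C x"
    and scaleC_one: "1 *\<^sub>C x = x"
    and scaleR_scaleC: "r *\<^sub>R x = complex_of_real r *\<^sub>C x"

global_interpretation complex_vector: vector_space "scaleC :: complex \<Rightarrow> 'a \<Rightarrow> 'a::complex_vector"
  by unfold_locales (simp_all add: scaleC_add_right scaleC_add_left scaleC_scaleC scaleC_one)

text \<open>Scalar products are linear in the second variable, antilinear in the first one.\<close>

class complex_inner = complex_vector + real_normed_vector +
  fixes cinner :: "'a \<Rightarrow> 'a \<Rightarrow> complex"
  assumes cinner_commute: "cinner x y = cnj (cinner y x)"
    and cinner_add_right: "cinner x (y + z) = cinner x y + cinner x z"
    and cinner_scaleC_right: "cinner x (c *\<^sub>C y) = c * cinner x y"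
    and cinner_self: "cinner x x = complex_of_real ((norm x)\<^sup>2)"

class complex_hilbert = complex_inner + banach

lemma norm_scaleC: "norm (c *\<^sub>C x) = cmod c * norm (x :: 'a::complex_inner)"
proof -
  have "cinner (c *\<^sub>C x) (c *\<^sub>C x) = c * cnj (c * cinner x x)"
    by (metis cinner_commute cinner_scaleC_right)
  also have "\<dots> = complex_of_real ((cmod c * norm x)\<^sup>2)"
    by (simp add: cinner_self complex_norm_square[symmetric] power_mult_distrib mult.assoc[symmetric])
  finally have "(norm (c *\<^sub>C x))\<^sup>2 = (cmod c * norm x)\<^sup>2"
    unfolding cinner_self of_real_eq_iff .
  then show ?thesis
    by (simp add: power2_eq_iff_nonneg)
qed

text \<open>
  The Banach space of bounded real-linear maps is a complex vector space when the target is one.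
  The bounded operators in the sense of Hilbert space theory are the elements of \<open>bounded_ops\<close>.
\<close>

instantiation blinfun :: (real_normed_vector, complex_inner) complex_vector
begin

lift_definition scaleC_blinfun :: "complex \<Rightarrow> 'a \<Rightarrow>\<^sub>L 'b \<Rightarrow> 'a \<Rightarrow>\<^sub>L 'b"
  is "\<lambda>c f x. c *\<^sub>C f x"
proof -
  fix c :: complex and f :: "'a \<Rightarrow> 'b"
  assume f: "bounded_linear f"
  have "bounded_linear (\<lambda>y::'b. c *\<^sub>C y)"
  proof (rule bounded_linear_intro)
    show "c *\<^sub>C (x + y) = c *\<^sub>C x + c *\<^sub>C y" for x y :: 'b
      by (rule scaleC_add_right)
    show "c *\<^sub>C (r *\<^sub>R x) = r *\<^sub>R (c *\<^sub>C x)" for r and x :: 'b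
      by (simp add: scaleR_scaleC scaleC_scaleC mult.commute)
    show "norm (c *\<^sub>C x) \<le> norm x * cmod c" for x :: 'b
      by (simp add: norm_scaleC mult.commute)
  qed
  from bounded_linear_compose[OF this f] show "bounded_linear (\<lambda>x. c *\<^sub>C f x)" .
qed

instance
  by standard (transfer; simp add: fun_eq_iff scaleC_add_right scaleC_add_left scaleC_scaleC
      scaleC_one scaleR_scaleC)+

end

definition bounded_ops :: "('a::complex_inner \<Rightarrow>\<^sub>L 'b::complex_inner) set" where
  "bounded_ops = {T. \<forall>c u. blinfun_apply T (c *\<^sub>C u) = c *\<^sub>C blinfun_apply T u}"

definition selfadjoint_bounded :: "('a::complex_inner \<Rightarrow>\<^sub>L 'a) \<Rightarrow> bool" where
  "selfadjoint_bounded T \<longleftrightarrow> T \<in> bounded_ops \<and> (\<forall>u v. cinner (T u) v = cinner u (T v))"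

text \<open>
  The lower bound of a self-adjoint operator, with value \<open>\<infinity>\<close> on the zero space.
\<close>

definition op_inf :: "('a::complex_inner \<Rightarrow>\<^sub>L 'a) \<Rightarrow> ereal" where
  "op_inf T = (INF u\<in>{u. norm u = 1}. ereal (Re (cinner u (T u))))"


section \<open>Hilbert space structures given by a scalar product\<close>

text \<open>
  Subspaces with their own Hilbert structure (such as the form domain) and changes of the scalar
  product on a fixed vector space are described by a carrier and an explicit scalar product.
\<close>

definition sdist :: "('a::complex_vector \<Rightarrow> 'a \<Rightarrow> complex) \<Rightarrow> 'a \<Rightarrow> 'a \<Rightarrow> real" where
  "sdist s u v = sqrt (Re (s (u - v) (u - v)))"

definition scalar_product_on :: "'a::complex_vector set \<Rightarrow> ('a \<Rightarrow> 'a \<Rightarrow> complex) \<Rightarrow> bool" where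
  "scalar_product_on V s \<longleftrightarrow>
     (\<forall>u\<in>V. \<forall>v\<in>V. \<forall>w\<in>V. s u (v + w) = s u v + s u w) \<and>
     (\<forall>u\<in>V. \<forall>v\<in>V. \<forall>c. s u (c *\<^sub>C v) = c * s u v) \<and>
     (\<forall>u\<in>V. \<forall>v\<in>V. s u v = cnj (s v u)) \<and>
     (\<forall>u\<in>V. u \<noteq> 0 \<longrightarrow> 0 < Re (s u u))"

definition hilbert_on :: "'a::complex_vector set \<Rightarrow> ('a \<Rightarrow> 'a \<Rightarrow> complex) \<Rightarrow> bool" where
  "hilbert_on V s \<longleftrightarrow>
     complex_vector.subspace V \<and> scalar_product_on V s \<and>
     (\<forall>f. (\<forall>n::nat. f n \<in> V) \<and> (\<forall>e>0. \<exists>N. \<forall>m\<ge>N. \<forall>n\<ge>N. sdist s (f m) (f n) < e) \<longrightarrow>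
        (\<exists>u\<in>V. (\<lambda>n. sdist s (f n) u) \<longlonglongrightarrow> 0))"

definition weighted :: "('a::complex_inner \<Rightarrow>\<^sub>L 'a) \<Rightarrow> 'a \<Rightarrow> 'a \<Rightarrow> complex" where
  "weighted T u v = cinner u (T v)"

text \<open>The restriction of \<open>T\<close> to the Hilbert space \<open>(G, s)\<close> is a compact operator.\<close>

definition compact_restriction ::
  "'a::complex_inner set \<Rightarrow> ('a \<Rightarrow> 'a \<Rightarrow> complex) \<Rightarrow> ('a \<Rightarrow>\<^sub>L 'b::complex_inner) \<Rightarrow> bool" where
  "compact_restriction G s T \<longleftrightarrow>
     T \<in> bounded_ops \<and> compact (closure (blinfun_apply T ` {u\<in>G. sdist s u 0 \<le> 1}))"


section \<open>Hilbert modules over a metric space\<close>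

definition C0 :: "('x::metric_space \<Rightarrow> complex) set" where
  "C0 = {\<phi>. continuous_on UNIV \<phi> \<and> (\<forall>e>0. \<exists>K. compact K \<and> (\<forall>x. x \<notin> K \<longrightarrow> cmod (\<phi> x) < e))}"

text \<open>Only the values of \<open>Q\<close> on \<^const>\<open>C0\<close> are meaningful; \<open>\<phi>(Q)\<close> is written \<open>Q \<phi>\<close>.\<close>

definition hilbert_module ::
  "(('x::metric_space \<Rightarrow> complex) \<Rightarrow> ('h::complex_hilbert \<Rightarrow>\<^sub>L 'h)) \<Rightarrow> bool" where
  "hilbert_module Q \<longleftrightarrow>
     (\<forall>\<phi>\<in>C0. Q \<phi> \<in> bounded_ops) \<and>
     (\<forall>\<phi>\<in>C0. \<forall>\<psi>\<in>C0. Q (\<lambda>x. \<phi> x + \<psi> x) = Q \<phi> + Q \<psi>) \<and>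
     (\<forall>\<phi>\<in>C0. \<forall>c. Q (\<lambda>x. c * \<phi> x) = c *\<^sub>C Q \<phi>) \<and>
     (\<forall>\<phi>\<in>C0. \<forall>\<psi>\<in>C0. Q (\<lambda>x. \<phi> x * \<psi> x) = Q \<phi> o\<^sub>L Q \<psi>) \<and>
     (\<forall>\<phi>\<in>C0. \<forall>u v. cinner (Q (\<lambda>x. cnj (\<phi> x)) u) v = cinner u (Q \<phi> v)) \<and>
     closure (complex_vector.span {Q \<phi> u |\<phi> u. \<phi> \<in> C0}) = UNIV"

text \<open>
  The canonical extension of the morphism to bounded continuous functions: since the vectors
  \<open>\<psi>(Q)u\<close> are total, \<open>\<phi>(Q)\<close> is the unique bounded operator with
  \<open>\<phi>(Q) \<psi>(Q) = (\<phi>\<psi>)(Q)\<close> for all \<open>\<psi>\<close> in \<^const>\<open>C0\<close>.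
\<close>

definition extend ::
  "(('x::metric_space \<Rightarrow> complex) \<Rightarrow> ('h::complex_hilbert \<Rightarrow>\<^sub>L 'h)) \<Rightarrow>
     ('x \<Rightarrow> complex) \<Rightarrow> ('h \<Rightarrow>\<^sub>L 'h)" where
  "extend Q \<phi> = (THE T. T \<in> bounded_ops \<and> (\<forall>\<psi>\<in>C0. T o\<^sub>L Q \<psi> = Q (\<lambda>x. \<phi> x * \<psi> x)))"

definition multiplier_algebra ::
  "(('x::metric_space \<Rightarrow> complex) \<Rightarrow> ('h::complex_hilbert \<Rightarrow>\<^sub>L 'h)) \<Rightarrow> ('h \<Rightarrow>\<^sub>L 'h) set" where
  "multiplier_algebra Q = Q ` C0"

text \<open>\<open>closure\<close> is taken in the operator norm, which is the norm of the type \<open>\<Rightarrow>\<^sub>L\<close>.\<close>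

definition B0 ::
  "(('x::metric_space \<Rightarrow> complex) \<Rightarrow> ('h::complex_hilbert \<Rightarrow>\<^sub>L 'h)) \<Rightarrow> ('h \<Rightarrow>\<^sub>L 'h) set" where
  "B0 Q =
     closure (complex_vector.span {M o\<^sub>L T |M T. M \<in> multiplier_algebra Q \<and> T \<in> bounded_ops}) \<inter>
     closure (complex_vector.span {T o\<^sub>L M |M T. M \<in> multiplier_algebra Q \<and> T \<in> bounded_ops})"

definition friedrichs_module ::
  "'h::complex_hilbert set \<Rightarrow> ('h \<Rightarrow> 'h \<Rightarrow> complex) \<Rightarrow>
     (('x::metric_space \<Rightarrow> complex) \<Rightarrow> ('h \<Rightarrow>\<^sub>L 'h)) \<Rightarrow> bool" where
  "friedrichs_module G s Q \<longleftrightarrow>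
     hilbert_module Q \<and> hilbert_on G s \<and>
     (\<exists>c. \<forall>u\<in>G. norm u \<le> c * sdist s u 0) \<and> closure G = UNIV"

definition compact_friedrichs_module ::
  "'h::complex_hilbert set \<Rightarrow> ('h \<Rightarrow> 'h \<Rightarrow> complex) \<Rightarrow>
     (('x::metric_space \<Rightarrow> complex) \<Rightarrow> ('h \<Rightarrow>\<^sub>L 'h)) \<Rightarrow> bool" where
  "compact_friedrichs_module G s Q \<longleftrightarrow>
     friedrichs_module G s Q \<and> (\<forall>\<phi>\<in>C0. compact_restriction G s (Q \<phi>))"


section \<open>Unbounded operators\<close>

text \<open>
  An operator with domain \<open>D\<close> is given by \<open>D\<close> and a function of which only the values on \<open>D\<close>
  matter, or by its graph.
\<close>

definition op_graph :: "'a set \<Rightarrow> ('a \<Rightarrow> 'b) \<Rightarrow> ('a \<times> 'b) set" where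
  "op_graph D d = (\<lambda>u. (u, d u)) ` D"

definition closed_densely_defined ::
  "'h::complex_hilbert set \<Rightarrow> ('h \<Rightarrow> 'k::complex_hilbert) \<Rightarrow> bool" where
  "closed_densely_defined D d \<longleftrightarrow>
     complex_vector.subspace D \<and>
     (\<forall>u\<in>D. \<forall>v\<in>D. d (u + v) = d u + d v) \<and>
     (\<forall>u\<in>D. \<forall>c. d (c *\<^sub>C u) = c *\<^sub>C d u) \<and>
     closure D = UNIV \<and> closed (op_graph D d)"

definition op_adjoint :: "('h::complex_inner \<times> 'k::complex_inner) set \<Rightarrow> ('k \<times> 'h) set" where
  "op_adjoint T = {(u, w). \<forall>(v, z)\<in>T. cinner w v = cinner u z}"

definition lip :: "('x::metric_space \<Rightarrow> complex) \<Rightarrow> real" where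
  "lip \<phi> = (SUP (x, y)\<in>{(x, y). x \<noteq> y}. cmod (\<phi> x - \<phi> y) / dist x y)"

definition first_order_operator ::
  "(('x::metric_space \<Rightarrow> complex) \<Rightarrow> ('h::complex_hilbert \<Rightarrow>\<^sub>L 'h)) \<Rightarrow>
   (('x \<Rightarrow> complex) \<Rightarrow> ('k::complex_hilbert \<Rightarrow>\<^sub>L 'k)) \<Rightarrow> 'h set \<Rightarrow> ('h \<Rightarrow> 'k) \<Rightarrow> bool" where
  "first_order_operator QH QK D d \<longleftrightarrow>
     closed_densely_defined D d \<and>
     (\<exists>C::real. \<forall>\<phi>. bounded (range \<phi>) \<and> (\<exists>L. L-lipschitz_on UNIV \<phi>) \<longrightarrow>
        (\<forall>(u, w)\<in>op_adjoint (op_graph D d). \<forall>v\<in>D.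
           cmod (cinner w (extend QH \<phi> v) - cinner u (extend QK \<phi> (d v)))
             \<le> C * lip \<phi> * norm u * norm v))"

text \<open>
  The graph of the operator \<open>A\<close> associated, in the Hilbert space with scalar product \<open>s\<close>, to the
  sesquilinear form \<open>q\<close> with domain \<open>D\<close> (the quadratic form being \<open>q u u\<close>): \<open>u\<close> is in the domain
  of \<open>A\<close> and \<open>A u = f\<close> iff \<open>u \<in> D\<close> and \<open>q v u = s v f\<close> for all \<open>v \<in> D\<close>.
\<close>

definition form_operator ::
  "('h \<Rightarrow> 'h \<Rightarrow> complex) \<Rightarrow> 'h set \<Rightarrow> ('h \<Rightarrow> 'h \<Rightarrow> complex) \<Rightarrow> ('h \<times> 'h) set" where
  "form_operator s D q = {(u, f). u \<in> D \<and> (\<forall>v\<in>D. q v u = s v f)}"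

lemma form_operator_eq_adjoint_comp:
  "form_operator cinner D (\<lambda>v u. cinner (d v) (d u)) = op_graph D d O op_adjoint (op_graph D d)"
proof -
  have "cinner (d v) (d u) = cinner v f \<longleftrightarrow> cinner f v = cinner (d u) (d v)" for u v f
    by (metis cinner_commute)
  then show ?thesis
    by (auto simp: form_operator_def op_graph_def op_adjoint_def)
qed

text \<open>
  Fredholm property and essential spectrum of a closed operator, given by its graph, in the
  Hilbert space with scalar product \<open>s\<close> on the whole type.
\<close>

definition fredholm :: "('h::complex_vector \<Rightarrow> 'h \<Rightarrow> complex) \<Rightarrow> ('h \<times> 'h) set \<Rightarrow> bool" where
  "fredholm s A \<longleftrightarrow>
     (\<exists>B. finite B \<and> {u. (u, 0) \<in> A} \<subseteq> complex_vector.span B) \<and>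
     closedin (Metric_space.mtopology UNIV (sdist s)) (Range A) \<and>
     (\<exists>B. finite B \<and> complex_vector.span (Range A \<union> B) = UNIV)"

definition essential_spectrum ::
  "('h::complex_vector \<Rightarrow> 'h \<Rightarrow> complex) \<Rightarrow> ('h \<times> 'h) set \<Rightarrow> complex set" where
  "essential_spectrum s A = {z. \<not> fredholm s ((\<lambda>(u, f). (u, f - z *\<^sub>C u)) ` A)}"

end

theory Submission
  imports Defs
begin

text \<open>
  For a closed operator \<open>T\<close> with \<open>T\<^sup>* = T\<close>, being Fredholm means that every bounded sequence
  \<open>u\<^sub>n\<close> with \<open>T u\<^sub>n\<close> convergent has a convergent subsequence. Multiplication by \<open>lam\<close> turns the
  second operator minus \<open>z\<close> into \<open>d\<^sup>* Lam d - z lam\<close> on the original Hilbert space, so that two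
  operators of this kind have to be compared. Given \<open>u\<^sub>n\<close> for one of them, let \<open>v\<^sub>n\<close> solve
  \<open>(d\<^sup>* Lam d + lam) v\<^sub>n = (z + 1) lam u\<^sub>n\<close> with the coefficients of the other one. Along a
  subsequence \<open>v\<^sub>n - u\<^sub>n\<close> converges, by coercivity, as soon as \<open>(lam - 1) u\<^sub>n\<close> and
  \<open>(Lam - 1) d y\<^sub>n\<close> do, where \<open>y\<^sub>n\<close> is whichever of \<open>u\<^sub>n\<close>, \<open>v\<^sub>n\<close> is bounded in the domain of
  \<open>d\<^sup>* d\<close>. For the latter, the first order condition for slowly varying functions \<open>\<chi>\<close> compares
  \<open>\<langle>d y, \<chi>(Q) d y\<rangle>\<close> with \<open>\<langle>d\<^sup>* d y, \<chi>(Q) y\<rangle>\<close>, and the module is compact.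
\<close>

section \<open>Hilbert spaces given by a scalar product\<close>

text \<open>The first order condition applies to \<open>d y\<close> only if \<open>d y\<close> lies
  in the domain of the adjoint of \<open>d\<close>. For a solution \<open>u\<close> of the perturbed
  equation only \<open>Lam (d u)\<close> is known to lie there, so \<open>(Lam - 1) d u\<close>
  cannot be treated directly. The way out is the identity
  \<open>Lam2 d v - Lam1 d u = L d (v - u) + (Lam2 - Lam1) d y\<close>, valid for
  \<open>y = u\<close> with \<open>L = Lam2\<close> and for \<open>y = v\<close> with
  \<open>L = Lam1\<close>. The perturbation can thus be evaluated at the solution of the unperturbed
  equation, and \<open>L\<close> is coercive in both cases. A fixed cutoff does not suffice, because
  the first order condition only bounds the commutator error. That bound is proportional to the
  Lipschitz constant, so the cutoff is stretched, while positivity keeps a fixed cutoff as a lower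
  bound. Symmetry, and with it the reduction of the Fredholm property to sequences, is available for
  real \<open>z\<close>; off the real axis coercivity of \<open>lam\<close> gives the compactness
  property outright. The given norm of the form domain need not be the graph norm of
  \<open>d\<close>, whence the comparison of two complete norms.\<close>

lemma cinner_add_left: "cinner (x + y) z = cinner x z + cinner y z"
  by (metis cinner_commute cinner_add_right complex_cnj_add)

lemma cinner_scaleC_left: "cinner (c *\<^sub>C x) y = cnj c * cinner x y"
  by (metis cinner_commute cinner_scaleC_right complex_cnj_mult)

lemma cinner_zero_right [simp]: "cinner x 0 = 0"
  by (metis add_cancel_right_right cinner_add_right)

lemma cinner_zero_left [simp]: "cinner 0 x = 0"
  by (metis add_cancel_right_right cinner_add_left)

lemma cinner_diff_right: "cinner x (y - z) = cinner x y - cinner x z"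
  by (metis cinner_add_right add_diff_cancel diff_add_cancel)

lemma cinner_diff_left: "cinner (x - y) z = cinner x z - cinner y z"
  by (metis cinner_add_left add_diff_cancel diff_add_cancel)

lemmas cinner_simps = cinner_add_left cinner_add_right cinner_diff_left cinner_diff_right
  cinner_scaleC_left cinner_scaleC_right

text \<open>Closed subspaces with the ambient product, the form domain with its energy product and
  the whole space with a changed product all occur, so the basic results are proved for a carrier
  and a product.\<close>

locale hilbert_space_on =
  fixes V :: "'a::complex_vector set" and s :: "'a \<Rightarrow> 'a \<Rightarrow> complex"
  assumes hilbert: "hilbert_on V s"
begin

definition N :: "'a \<Rightarrow> real" where "N u = sdist s u 0"

lemma N_eq_sqrt: "N u = sqrt (Re (s u u))"
  by (simp add: N_def sdist_def)

lemma sdist_eq_N: "sdist s u v = N (u - v)"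
  by (simp add: N_def sdist_def)

lemma subspace: "complex_vector.subspace V"
  using hilbert by (simp add: hilbert_on_def)

lemmas V_add = complex_vector.subspace_add[OF subspace]
  and V_scale = complex_vector.subspace_scale[OF subspace]
  and V_diff = complex_vector.subspace_diff[OF subspace]
  and V_zero = complex_vector.subspace_0[OF subspace]

lemma scalar_product: "scalar_product_on V s"
  using hilbert unfolding hilbert_on_def by blast

lemmas s_add_right = scalar_product[unfolded scalar_product_on_def, THEN conjunct1, rule_format]
  and s_scale_right =
    scalar_product[unfolded scalar_product_on_def, THEN conjunct2, THEN conjunct1, rule_format]
  and s_commute = scalar_product[unfolded scalar_product_on_def, THEN conjunct2, THEN conjunct2,
      THEN conjunct1, rule_format]
  and s_pos = scalar_product[unfolded scalar_product_on_def, THEN conjunct2, THEN conjunct2,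
      THEN conjunct2, rule_format]

lemma s_add_left: "u \<in> V \<Longrightarrow> v \<in> V \<Longrightarrow> w \<in> V \<Longrightarrow> s (u + v) w = s u w + s v w"
  by (metis V_add complex_cnj_add s_add_right s_commute)

lemma s_scale_left: "u \<in> V \<Longrightarrow> v \<in> V \<Longrightarrow> s (c *\<^sub>C u) v = cnj c * s u v"
  by (metis V_scale complex_cnj_mult s_scale_right s_commute)

lemma s_diff_right: "u \<in> V \<Longrightarrow> v \<in> V \<Longrightarrow> w \<in> V \<Longrightarrow> s u (v - w) = s u v - s u w"
  by (metis V_diff add_diff_cancel diff_add_cancel s_add_right)

lemma s_diff_left: "u \<in> V \<Longrightarrow> v \<in> V \<Longrightarrow> w \<in> V \<Longrightarrow> s (u - v) w = s u w - s v w"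
  by (metis V_diff add_diff_cancel diff_add_cancel s_add_left)

lemma s_zero_right [simp]: "u \<in> V \<Longrightarrow> s u 0 = 0"
  using s_diff_right[of u 0 0] V_zero by simp

lemma s_zero_left [simp]: "u \<in> V \<Longrightarrow> s 0 u = 0"
  using s_diff_left[of 0 0 u] V_zero by simp

lemmas s_simps = s_add_left s_add_right s_diff_left s_diff_right s_scale_left s_scale_right
  V_add V_diff V_scale V_zero

lemma N_zero [simp]: "N 0 = 0"
  by (simp add: N_eq_sqrt V_zero)

lemma N_nonneg: "u \<in> V \<Longrightarrow> 0 \<le> N u"
  using s_pos[of u] by (cases "u = 0") (auto simp: N_eq_sqrt V_zero)

lemma N_pos: "u \<in> V \<Longrightarrow> u \<noteq> 0 \<Longrightarrow> 0 < N u"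
  using s_pos[of u] by (simp add: N_eq_sqrt)

lemma s_self: assumes "u \<in> V" shows "s u u = complex_of_real ((N u)\<^sup>2)"
proof -
  have "Im (s u u) = 0"
    using s_commute[OF assms assms] by (metis cnj.simps(2) neg_equal_zero)
  moreover have "0 \<le> Re (s u u)"
    using s_pos[OF assms] assms by (cases "u = 0") (auto simp: V_zero)
  ultimately show ?thesis
    by (simp add: complex_eq_iff N_eq_sqrt)
qed

lemma N_scale: assumes "u \<in> V" shows "N (c *\<^sub>C u) = cmod c * N u"
proof -
  have "s (c *\<^sub>C u) (c *\<^sub>C u) = (c * cnj c) * s u u"
    by (simp add: s_scale_left s_scale_right V_scale assms)
  also have "\<dots> = complex_of_real ((cmod c * N u)\<^sup>2)"
    by (simp add: s_self assms power_mult_distrib complex_norm_square[symmetric])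
  finally have "s (c *\<^sub>C u) (c *\<^sub>C u) = complex_of_real ((cmod c * N u)\<^sup>2)" .
  then have "(N (c *\<^sub>C u))\<^sup>2 = (cmod c * N u)\<^sup>2"
    using s_self[of "c *\<^sub>C u"] assms V_scale by (metis of_real_eq_iff)
  then show ?thesis
    using N_nonneg assms V_scale by (simp add: power2_eq_iff_nonneg)
qed

lemma cauchy_schwarz:
  assumes "u \<in> V" "v \<in> V"
  shows "cmod (s u v) \<le> N u * N v"
proof (cases "v = 0")
  case True
  then show ?thesis using assms by simp
next
  case False
  define a where "a = s v u"
  \<comment> \<open>\<open>w\<close> is \<open>(N v)\<^sup>2\<close> times the component of
    \<open>u\<close> orthogonal to \<open>v\<close>; the scaling avoids a division.\<close>
  define w where "w = complex_of_real ((N v)\<^sup>2) *\<^sub>C u - a *\<^sub>C v"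
  have w: "w \<in> V" using assms by (simp add: w_def s_simps)
  have uv: "s u v = cnj a" unfolding a_def using assms s_commute by blast
  define n where "n = complex_of_real ((N v)\<^sup>2)"
  have n: "cnj n = n" by (simp add: n_def)
  have "s w w = n * (n * s u u) - n * (a * s u v) - cnj a * (n * s v u) + cnj a * (a * s v v)"
    unfolding w_def n_def[symmetric] using assms by (simp add: s_simps n algebra_simps)
  also have "\<dots> = n * (n * s u u - a * cnj a)"
    unfolding uv a_def[symmetric] s_self[OF assms(2)] n_def[symmetric] by (simp add: algebra_simps)
  also have "\<dots> = complex_of_real ((N v)\<^sup>2 * ((N v)\<^sup>2 * (N u)\<^sup>2 - (cmod a)\<^sup>2))"
    by (simp add: n_def s_self assms complex_norm_square[symmetric])
  finally have "s w w = complex_of_real ((N v)\<^sup>2 * ((N v)\<^sup>2 * (N u)\<^sup>2 - (cmod a)\<^sup>2))" .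
  then have "(N w)\<^sup>2 = (N v)\<^sup>2 * ((N v)\<^sup>2 * (N u)\<^sup>2 - (cmod a)\<^sup>2)"
    using s_self[OF w] by (metis of_real_eq_iff)
  then have "0 \<le> (N v)\<^sup>2 * ((N v)\<^sup>2 * (N u)\<^sup>2 - (cmod a)\<^sup>2)"
    by (metis zero_le_power2)
  moreover have "0 < (N v)\<^sup>2" using N_pos[OF assms(2) False] by simp
  ultimately have "(cmod a)\<^sup>2 \<le> (N u * N v)\<^sup>2"
    by (simp add: zero_le_mult_iff power_mult_distrib mult.commute)
  then have "cmod a \<le> N u * N v"
    by (rule power2_le_imp_le) (intro mult_nonneg_nonneg N_nonneg assms)
  then show ?thesis by (simp add: uv)
qed

lemma N_square_add:
  assumes "u \<in> V" "v \<in> V"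
  shows "(N (u + v))\<^sup>2 = (N u)\<^sup>2 + (N v)\<^sup>2 + 2 * Re (s v u)"
proof -
  have "s (u + v) (u + v) = s u u + s v v + (s v u + cnj (s v u))"
    using assms s_commute[of u v] by (simp add: s_simps)
  then have "Re (s (u + v) (u + v)) = Re (s u u) + Re (s v v) + 2 * Re (s v u)"
    by simp
  then show ?thesis using assms by (simp add: s_self V_add)
qed

lemma N_triangle:
  assumes "u \<in> V" "v \<in> V"
  shows "N (u + v) \<le> N u + N v"
proof (rule power2_le_imp_le)
  have "Re (s v u) \<le> N v * N u"
    using cauchy_schwarz[OF assms(2,1)] complex_Re_le_cmod order_trans by blast
  then show "(N (u + v))\<^sup>2 \<le> (N u + N v)\<^sup>2"
    using N_square_add[OF assms] by (simp add: power2_sum mult.commute)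
qed (intro add_nonneg_nonneg N_nonneg assms)

lemma N_minus_commute: "u \<in> V \<Longrightarrow> v \<in> V \<Longrightarrow> N (u - v) = N (v - u)"
  using N_scale[of "v - u" "-1"] by (simp add: V_diff complex_vector.scale_minus_left)

lemma complete:
  assumes "\<And>n. f n \<in> V"
    and "\<And>e. 0 < e \<Longrightarrow> \<exists>M. \<forall>m\<ge>M. \<forall>n\<ge>M. N (f m - f n) < e"
  shows "\<exists>u\<in>V. (\<lambda>n::nat. N (f n - u)) \<longlonglongrightarrow> 0"
proof -
  have "(\<forall>n. f n \<in> V) \<and> (\<forall>e>0. \<exists>M. \<forall>m\<ge>M. \<forall>n\<ge>M. N (f m - f n) < e) \<longrightarrow>
    (\<exists>u\<in>V. (\<lambda>n. N (f n - u)) \<longlonglongrightarrow> 0)"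
    using hilbert unfolding hilbert_on_def sdist_eq_N by blast
  with assms show ?thesis by blast
qed

lemma tendsto_s_right:
  assumes "v \<in> V" "u \<in> V" "\<And>n. y n \<in> V" "(\<lambda>n::nat. N (y n - u)) \<longlonglongrightarrow> 0"
  shows "(\<lambda>n. s v (y n)) \<longlonglongrightarrow> s v u"
proof -
  have "(\<lambda>n. N v * N (y n - u)) \<longlonglongrightarrow> 0"
    using tendsto_mult_left[OF assms(4), of "N v"] by simp
  moreover have "cmod (s v (y n) - s v u) \<le> N v * N (y n - u)" for n
    using cauchy_schwarz[OF assms(1), of "y n - u"] assms by (simp add: s_simps)
  ultimately have "(\<lambda>n. s v (y n) - s v u) \<longlonglongrightarrow> 0"
    by (rule_tac Lim_null_comparison) auto
  then show ?thesis by (simp add: LIM_zero_iff)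
qed

text \<open>
  A minimising sequence for \<open>\<parallel>v\<parallel>\<^sup>2 - 2 Re l v\<close> on \<open>W\<close> nearly satisfies the Euler equation
  \<open>s v y = l v\<close>, which makes it a Cauchy sequence. As \<open>W\<close> need not be closed, the same statement
  yields density results and orthogonal projections.
\<close>

theorem riesz_representation:
  fixes l :: "'a \<Rightarrow> complex"
  assumes W: "complex_vector.subspace W" "W \<subseteq> V"
    and l_add: "\<And>u v. u \<in> W \<Longrightarrow> v \<in> W \<Longrightarrow> l (u + v) = l u + l v"
    and l_scale: "\<And>c u. u \<in> W \<Longrightarrow> l (c *\<^sub>C u) = cnj c * l u"
    and l_bounded: "\<And>u. u \<in> W \<Longrightarrow> cmod (l u) \<le> M * N u"
  obtains w y where "w \<in> V" "\<And>n::nat. y n \<in> W" "(\<lambda>n. N (y n - w)) \<longlonglongrightarrow> 0"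
    "\<And>v. v \<in> W \<Longrightarrow> s v w = l v"
proof -
  define J where "J v = (N v)\<^sup>2 - 2 * Re (l v)" for v
  define m where "m = (INF v\<in>W. J v)"
  define e where "e n = inverse (real (Suc n))" for n
  have W0: "0 \<in> W" using W complex_vector.subspace_0 by blast
  have J_ge: "- M\<^sup>2 \<le> J v" if "v \<in> W" for v
  proof -
    have "Re (l v) \<le> M * N v"
      using l_bounded[OF that] complex_Re_le_cmod order_trans by blast
    moreover have "0 \<le> (N v - M)\<^sup>2" by simp
    ultimately show ?thesis by (simp add: J_def power2_diff mult.commute)
  qed
  have bdd: "bdd_below (J ` W)" using J_ge by (intro bdd_belowI2)
  have m_le: "m \<le> J v" if "v \<in> W" for v
    unfolding m_def using bdd that by (rule cINF_lower)
  have "\<exists>v\<in>W. J v < m + e n" for n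
  proof -
    have "Inf (J ` W) < m + e n" by (simp add: m_def e_def)
    then show ?thesis using cInf_lessD[of "J ` W" "m + e n"] W0 by auto
  qed
  then obtain y where y: "\<And>n. y n \<in> W" "\<And>n. J (y n) < m + e n" by metis
  have yV: "y n \<in> V" for n using y W by blast
  have Re_est: "\<bar>Re (s v (y n) - l v)\<bar> \<le> N v * sqrt (e n)" if v: "v \<in> W" for v n
  proof (cases "v = 0")
    case True
    moreover have "l 0 = 0" using l_add[OF W0 W0] by simp
    ultimately show ?thesis using yV by simp
  next
    case False
    have vV: "v \<in> V" using v W by blast
    have Nv: "0 < N v" using N_pos vV False by blast
    define b where "b = Re (s v (y n) - l v)"
    \<comment> \<open>This \<open>t\<close> minimises the quadratic polynomial
      \<open>J (y n + t v)\<close>. The gain \<open>b\<^sup>2 / (N v)\<^sup>2\<close> cannot exceed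
      \<open>e n\<close>, because \<open>J (y n)\<close> is within \<open>e n\<close> of the
      infimum.\<close>
    define t where "t = - b / (N v)\<^sup>2"
    have tW: "complex_of_real t *\<^sub>C v \<in> W" using v W complex_vector.subspace_scale by blast
    have "m \<le> J (y n + complex_of_real t *\<^sub>C v)"
      using m_le W y tW complex_vector.subspace_add by blast
    also have "\<dots> = J (y n) + t\<^sup>2 * (N v)\<^sup>2 + 2 * t * b"
      using N_square_add[OF yV V_scale[OF vV], of n "complex_of_real t"] l_add[OF y(1) tW]
        l_scale[OF v] yV vV
      by (simp add: J_def b_def s_simps N_scale power_mult_distrib algebra_simps)
    also have "\<dots> = J (y n) - b\<^sup>2 / (N v)\<^sup>2"
      using Nv by (simp add: t_def power_divide field_simps power2_eq_square)
    finally have "b\<^sup>2 / (N v)\<^sup>2 \<le> e n"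
      using y(2)[of n] by linarith
    then have "b\<^sup>2 \<le> e n * (N v)\<^sup>2" using Nv by (simp add: field_simps)
    then have "b\<^sup>2 \<le> (N v * sqrt (e n))\<^sup>2"
      by (simp add: power_mult_distrib e_def mult.commute)
    then show ?thesis unfolding b_def[symmetric]
      using Nv by (metis abs_le_square_iff abs_of_nonneg e_def inverse_nonnegative_iff_nonnegative
          less_imp_le mult_nonneg_nonneg of_nat_0_le_iff real_sqrt_ge_zero)
  qed
  have est: "cmod (s v (y n) - l v) \<le> N v * sqrt (e n)" if v: "v \<in> W" for v n
  proof -
    define z where "z = s v (y n) - l v"
    have vV: "v \<in> V" using v W by blast
    show ?thesis
    proof (cases "z = 0")
      case True
      then show ?thesis using N_nonneg[OF vV] by (simp add: z_def e_def)
    next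
      case False
      \<comment> \<open>Rotating \<open>v\<close> by the phase of \<open>z\<close> makes the defect
        real and nonnegative, so the bound on real parts becomes a bound on the modulus.\<close>
      have c1: "cmod (sgn z) = 1" using False by (simp add: norm_sgn)
      have cz: "cnj (sgn z) * z = complex_of_real (cmod z)"
        using False complex_norm_square[of z]
        by (simp add: sgn_div_norm scaleR_conv_of_real field_simps power2_eq_square)
      have "s (sgn z *\<^sub>C v) (y n) - l (sgn z *\<^sub>C v) = cnj (sgn z) * z"
        using v vV yV l_scale by (simp add: s_simps z_def algebra_simps)
      then show ?thesis
        using Re_est[of "sgn z *\<^sub>C v" n] complex_vector.subspace_scale[OF W(1) v] c1 vV
        by (simp add: cz N_scale z_def[symmetric])
    qed
  qed
  have e0: "(\<lambda>n. sqrt (e n)) \<longlonglongrightarrow> 0"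
    using tendsto_real_sqrt[OF LIMSEQ_inverse_real_of_nat] by (simp add: e_def)
  have cau: "N (y m - y n) \<le> sqrt (e m) + sqrt (e n)" for m n
  proof -
    \<comment> \<open>The difference lies in \<open>W\<close> and serves as test vector in the
      approximate Euler equations of both \<open>y m\<close> and \<open>y n\<close>.\<close>
    define v where "v = y m - y n"
    have vW: "v \<in> W" using y W complex_vector.subspace_diff v_def by blast
    then have vV: "v \<in> V" using W by blast
    have "complex_of_real ((N v)\<^sup>2) = (s v (y m) - l v) - (s v (y n) - l v)"
      using s_self[OF vV] s_diff_right[OF vV yV yV, of m n] by (simp add: v_def)
    then have "(N v)\<^sup>2 \<le> cmod (s v (y m) - l v) + cmod (s v (y n) - l v)"
      by (metis abs_power2 norm_of_real norm_triangle_ineq4)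
    also have "\<dots> \<le> N v * sqrt (e m) + N v * sqrt (e n)"
      using est vW add_mono by blast
    finally have "N v * N v \<le> N v * (sqrt (e m) + sqrt (e n))"
      by (simp add: power2_eq_square distrib_left)
    then show ?thesis unfolding v_def[symmetric]
      using N_nonneg[OF vV] by (cases "N v = 0") (auto simp: e_def)
  qed
  have "\<exists>M. \<forall>m\<ge>M. \<forall>n\<ge>M. N (y m - y n) < r" if "0 < r" for r
  proof -
    have "\<forall>\<^sub>F n in sequentially. sqrt (e n) < r / 2"
      by (rule order_tendstoD(2)[OF e0]) (use that in simp)
    then obtain M where M: "\<And>n. n \<ge> M \<Longrightarrow> sqrt (e n) < r / 2"
      by (auto simp: eventually_sequentially)
    have "N (y m - y n) < r" if "m \<ge> M" "n \<ge> M" for m n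
      using cau[of m n] M[OF that(1)] M[OF that(2)] by linarith
    then show ?thesis by blast
  qed
  from complete[OF yV this] obtain w where w: "w \<in> V" "(\<lambda>n. N (y n - w)) \<longlonglongrightarrow> 0"
    by blast
  have "s v w = l v" if v: "v \<in> W" for v
  proof -
    have vV: "v \<in> V" using v W by blast
    have "(\<lambda>n. s v (y n) - l v) \<longlonglongrightarrow> 0"
    proof (rule Lim_null_comparison)
      show "\<forall>\<^sub>F n in sequentially. cmod (s v (y n) - l v) \<le> N v * sqrt (e n)"
        using est[OF v] by (rule always_eventually[OF allI])
      show "(\<lambda>n. N v * sqrt (e n)) \<longlonglongrightarrow> 0"
        using tendsto_mult_left[OF e0, of "N v"] by simp
    qed
    then have "(\<lambda>n. s v (y n)) \<longlonglongrightarrow> l v" by (simp add: LIM_zero_iff)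
    with tendsto_s_right[OF vV w(1) yV w(2)] show ?thesis
      using LIMSEQ_unique by blast
  qed
  with w y that show thesis by blast
qed

text \<open>
  The gliding hump argument: steps of length \<open>3\<^sup>-\<^sup>n\<close> in the directions of vectors of norm at least
  \<open>4\<^sup>n\<close> lead to a vector on which the family is unbounded.
\<close>

theorem uniform_boundedness:
  assumes F: "F \<subseteq> V" and pw: "\<And>v. v \<in> V \<Longrightarrow> \<exists>M. \<forall>h\<in>F. cmod (s v h) \<le> M"
  obtains C where "\<And>h. h \<in> F \<Longrightarrow> N h \<le> C"
proof (rule ccontr)
  assume "\<not> thesis"
  with that have "\<exists>h\<in>F. C < N h" for C by (meson not_le)
  then have "\<exists>h\<in>F. 4 ^ n < N h" for n :: nat by blast
  then obtain h where h: "\<And>n::nat. h n \<in> F" "\<And>n. 4 ^ n < N (h n)" by metis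
  have hV: "h n \<in> V" for n using h F by blast
  have Nh: "0 < N (h n)" for n using h(2)[of n] by (smt (verit) zero_less_power)
  \<comment> \<open>The sign makes the step along \<open>h n\<close> reinforce the real part already
    present instead of cancelling it.\<close>
  define sg where "sg x n = (if 0 \<le> Re (s x (h n)) then 1 else - 1 :: real)" for x n
  define x where "x = rec_nat 0 (\<lambda>n x. x + complex_of_real (sg x n / (3 ^ n * N (h n))) *\<^sub>C h n)"
  have x_Suc: "x (Suc n) = x n + complex_of_real (sg (x n) n / (3 ^ n * N (h n))) *\<^sub>C h n" for n
    by (simp add: x_def)
  have xV: "x n \<in> V" for n
    by (induction n) (simp_all add: x_Suc V_add V_scale hV, simp add: x_def V_zero)
  have step: "N (x (Suc n) - x n) = 1 / 3 ^ n" for n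
    using hV[of n] Nh[of n] by (simp add: x_Suc N_scale norm_divide sg_def norm_mult norm_power)
  have dist: "N (x (n + k) - x n) \<le> 3 / 2 * (1 / 3 ^ n - 1 / 3 ^ (n + k))" for n k
  proof (induction k)
    case (Suc k)
    have "N (x (n + Suc k) - x n) \<le> N (x (Suc (n + k)) - x (n + k)) + N (x (n + k) - x n)"
      using N_triangle[of "x (Suc (n + k)) - x (n + k)" "x (n + k) - x n"] xV by (simp add: V_diff)
    with Suc step[of "n + k"] show ?case by simp
  qed simp
  have dist': "N (x m - x n) \<le> 3 / 2 * (1 / 3 ^ n)" if "n \<le> m" for m n
  proof -
    have "3 / 2 * (1 / 3 ^ n - 1 / 3 ^ m) \<le> 3 / 2 * (1 / 3 ^ n :: real)" by simp
    with dist[of n "m - n"] that show ?thesis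
      unfolding le_add_diff_inverse[OF that] by (rule_tac order_trans)
  qed
  have "\<exists>M. \<forall>m\<ge>M. \<forall>n\<ge>M. N (x m - x n) < r" if "0 < r" for r
  proof -
    have "(\<lambda>n. 3 / 2 * (1 / 3) ^ n) \<longlonglongrightarrow> (0::real)"
      using tendsto_mult_left[OF LIMSEQ_power_zero[of "1/3::real"], of "3/2"] by simp
    from order_tendstoD(2)[OF this that] obtain M where M: "3 / 2 * (1 / 3) ^ M < r"
      by (force simp: eventually_sequentially)
    have 1: "N (x m - x n) < r" if "M \<le> n" "n \<le> m" for m n
    proof -
      have "(1 / 3 :: real) ^ n \<le> (1 / 3) ^ M" using that by (intro power_decreasing) auto
      then show ?thesis using dist'[OF that(2)] M by (simp add: power_one_over)
    qed
    have "N (x m - x n) < r" if "M \<le> n" "M \<le> m" for m n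
      using 1[of n m] 1[of m n] N_minus_commute[OF xV xV, of m n] that by (cases "n \<le> m") auto
    then show ?thesis by blast
  qed
  from complete[OF xV this] obtain X where X: "X \<in> V" "(\<lambda>n. N (x n - X)) \<longlonglongrightarrow> 0"
    by blast
  have tail: "N (x n - X) \<le> 3 / 2 * (1 / 3 ^ n)" for n
  proof -
    have "N (x n - X) \<le> 3 / 2 * (1 / 3 ^ n) + N (x m - X)" if "n \<le> m" for m
      using N_triangle[of "x n - x m" "x m - X"] xV X(1) dist'[OF that]
        N_minus_commute[OF xV xV, of n m] by (simp add: V_diff)
    moreover have "(\<lambda>m. 3 / 2 * (1 / 3 ^ n) + N (x m - X)) \<longlonglongrightarrow> 3 / 2 * (1 / 3 ^ n) + 0"
      using X(2) by (intro tendsto_intros)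
    ultimately show ?thesis
      using tendsto_lowerbound[of _ "3 / 2 * (1 / 3 ^ n) + 0"]
      by (smt (verit) eventually_sequentiallyI sequentially_bot)
  qed
  have big: "N (h n) / 3 ^ n \<le> cmod (s (x (Suc n)) (h n))" for n
  proof -
    have "Re (s (x (Suc n)) (h n)) = Re (s (x n) (h n)) + sg (x n) n * (N (h n) / 3 ^ n)"
      using xV hV Nh[of n] by (simp add: x_Suc s_simps s_self field_simps power2_eq_square)
    then have "N (h n) / 3 ^ n \<le> \<bar>Re (s (x (Suc n)) (h n))\<bar>"
      using Nh[of n] by (auto simp: sg_def)
    then show ?thesis using abs_Re_le_cmod order_trans by blast
  qed
  \<comment> \<open>The step along \<open>h n\<close> contributes \<open>N (h n) / 3 ^ n\<close>.
    All later steps have total length at most half of \<open>1 / 3 ^ n\<close>, so they destroy at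
    most half of this contribution.\<close>
  have grow: "1 / 2 * (4 / 3) ^ n \<le> cmod (s X (h n))" for n
  proof -
    have "cmod (s (x (Suc n)) (h n) - s X (h n)) \<le> N (x (Suc n) - X) * N (h n)"
      using cauchy_schwarz[of "x (Suc n) - X" "h n"] xV X(1) hV by (simp add: s_simps)
    also have "\<dots> \<le> 3 / 2 * (1 / 3 ^ Suc n) * N (h n)"
      using tail[of "Suc n"] Nh[of n] by (intro mult_right_mono) auto
    also have "\<dots> = 1 / 2 * (N (h n) / 3 ^ n)" by simp
    finally have "1 / 2 * (N (h n) / 3 ^ n) \<le> cmod (s X (h n))"
      using big[of n] norm_triangle_ineq2[of "s (x (Suc n)) (h n)" "s X (h n)"] by linarith
    moreover have "(4 / 3) ^ n \<le> N (h n) / 3 ^ n"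
      using h(2)[of n] by (simp add: power_divide divide_right_mono)
    ultimately show ?thesis by linarith
  qed
  obtain M where M: "\<forall>h\<in>F. cmod (s X h) \<le> M" using pw X by blast
  obtain n where "2 * M < (4 / 3) ^ n" using real_arch_pow[of "4/3" "2 * M"] by auto
  moreover have "cmod (s X (h n)) \<le> M" using M h(1) by blast
  ultimately show False using grow[of n] by linarith
qed

end

section \<open>The ambient scalar product and the comparison of two complete norms\<close>

lemma sdist_cinner: "sdist cinner u v = norm (u - v)"
  by (simp add: sdist_def cinner_self)

lemma hilbert_on_cinner:
  fixes V :: "'a::complex_hilbert set"
  assumes "complex_vector.subspace V" "closed V"
  shows "hilbert_on V cinner"
  unfolding hilbert_on_def scalar_product_on_def sdist_cinner
proof (intro conjI ballI allI impI)
  show "cinner u v = cnj (cinner v u)" for u v :: 'a by (rule cinner_commute)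
  show "0 < Re (cinner u u)" if "u \<noteq> 0" for u :: 'a using that by (simp add: cinner_self)
  fix f :: "nat \<Rightarrow> 'a"
  assume f: "(\<forall>n. f n \<in> V) \<and> (\<forall>e>0. \<exists>N. \<forall>m\<ge>N. \<forall>n\<ge>N. norm (f m - f n) < e)"
  then have "Cauchy f" unfolding Cauchy_def dist_norm by blast
  then obtain u where u: "f \<longlonglongrightarrow> u" using Cauchy_convergent convergent_def by blast
  then have "u \<in> V" using assms(2) f closed_sequentially by blast
  moreover have "(\<lambda>n. norm (f n - u)) \<longlonglongrightarrow> 0" using u by (simp add: LIM_zero tendsto_norm_zero)
  ultimately show "\<exists>u\<in>V. (\<lambda>n. norm (f n - u)) \<longlonglongrightarrow> 0" by blast
qed (use assms in \<open>simp_all add: cinner_simps\<close>)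

interpretation cinner: hilbert_space_on "UNIV :: 'a::complex_hilbert set" cinner
  rewrites "cinner.N = norm"
proof -
  show "hilbert_space_on (UNIV :: 'a set) cinner"
    by unfold_locales (rule hilbert_on_cinner, simp_all)
  then show "hilbert_space_on.N cinner = (norm :: 'a \<Rightarrow> real)"
    by (simp add: hilbert_space_on.N_def sdist_cinner fun_eq_iff)
qed

lemmas cinner_cauchy_schwarz = cinner.cauchy_schwarz[OF UNIV_I UNIV_I]

text \<open>
  This takes the place of the closed graph theorem. With \<open>e\<^sub>1 x\<close> and \<open>e\<^sub>2 x\<close> representing the
  functional \<open>\<langle>\<cdot>, x\<rangle>\<close> for the two scalar products, the vectors \<open>e\<^sub>1 x\<close> with \<open>\<parallel>e\<^sub>2 x\<parallel>\<^sub>2 \<le> 1\<close> are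
  weakly bounded, hence bounded; the vectors \<open>e\<^sub>2 x\<close> are dense.
\<close>

theorem hilbert_norm_domination:
  fixes V :: "'a::complex_hilbert set"
  assumes "hilbert_on V s1" "hilbert_on V s2"
    and c1: "\<And>u. u \<in> V \<Longrightarrow> norm u \<le> c1 * sdist s1 u 0"
    and c2: "\<And>u. u \<in> V \<Longrightarrow> norm u \<le> c2 * sdist s2 u 0"
  obtains C where "\<And>u. u \<in> V \<Longrightarrow> sdist s2 u 0 \<le> C * sdist s1 u 0"
proof -
  interpret S1: hilbert_space_on V s1 using assms by unfold_locales
  interpret S2: hilbert_space_on V s2 using assms by unfold_locales
  have R1: "\<exists>h\<in>V. \<forall>v\<in>V. s1 v h = cinner v x" for x
  proof -
    have "cmod (cinner u x) \<le> norm x * c1 * S1.N u" if "u \<in> V" for u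
      using mult_left_mono[OF c1[OF that], of "norm x"] cinner_cauchy_schwarz[of u x] order_trans
      by (fastforce simp: S1.N_def mult_ac)
    from S1.riesz_representation[OF S1.subspace order_refl _ _ this]
    show ?thesis by (metis cinner_add_left cinner_scaleC_left)
  qed
  have R2: "\<exists>h\<in>V. \<forall>v\<in>V. s2 v h = cinner v x" for x
  proof -
    have "cmod (cinner u x) \<le> norm x * c2 * S2.N u" if "u \<in> V" for u
      using mult_left_mono[OF c2[OF that], of "norm x"] cinner_cauchy_schwarz[of u x] order_trans
      by (fastforce simp: S2.N_def mult_ac)
    from S2.riesz_representation[OF S2.subspace order_refl _ _ this]
    show ?thesis by (metis cinner_add_left cinner_scaleC_left)
  qed
  \<comment> \<open>\<open>h\<close> and \<open>k\<close> represent the same functional, so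
    \<open>s1 v h = s2 v k\<close> on \<open>V\<close>, and the bound on \<open>k\<close> makes the
    vectors \<open>h\<close> weakly bounded.\<close>
  define F where "F = {h\<in>V. \<exists>x. \<exists>k\<in>V. S2.N k \<le> 1 \<and> (\<forall>v\<in>V. s1 v h = cinner v x) \<and>
    (\<forall>v\<in>V. s2 v k = cinner v x)}"
  have "\<exists>M. \<forall>h\<in>F. cmod (s1 v h) \<le> M" if v: "v \<in> V" for v
  proof (intro exI ballI)
    fix h assume "h \<in> F"
    then obtain k where "k \<in> V" "S2.N k \<le> 1" "s1 v h = s2 v k"
      using v unfolding F_def by auto
    then show "cmod (s1 v h) \<le> S2.N v"
      using S2.cauchy_schwarz[OF v, of k] mult_left_mono[of "S2.N k" 1 "S2.N v"] S2.N_nonneg[OF v]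
      by simp
  qed
  then obtain C' where C': "\<And>h. h \<in> F \<Longrightarrow> S1.N h \<le> C'"
    using S1.uniform_boundedness[of F thesis] by (simp add: F_def) blast
  define C where "C = max C' 0"
  have C: "S1.N h \<le> C" if "h \<in> F" for h using C'[OF that] by (simp add: C_def)
  define W where "W = {k\<in>V. \<exists>x. \<forall>v\<in>V. s2 v k = cinner v x}"
  have est: "cmod (s2 v k) \<le> C * S1.N v * S2.N k" if v: "v \<in> V" and k: "k \<in> W" for v k
  proof (cases "k = 0")
    case True
    then show ?thesis using v by simp
  next
    case False
    have kV: "k \<in> V" using k by (simp add: W_def)
    have Nk: "0 < S2.N k" using False kV S2.N_pos by blast
    obtain x where x: "\<forall>v\<in>V. s2 v k = cinner v x" using k by (auto simp: W_def)
    define c where "c = complex_of_real (1 / S2.N k)"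
    obtain h where h: "h \<in> V" "\<forall>v\<in>V. s1 v h = cinner v (c *\<^sub>C x)" using R1 by blast
    have "h \<in> F"
      unfolding F_def using h kV x Nk
      by (auto intro!: exI[of _ "c *\<^sub>C x"] bexI[of _ "c *\<^sub>C k"]
          simp: S2.s_simps cinner_scaleC_right S2.N_scale c_def norm_divide)
    then have "S1.N h \<le> C" by (rule C)
    then have "cmod (s1 v h) \<le> S1.N v * C"
      using S1.cauchy_schwarz[OF v h(1)] mult_left_mono[of "S1.N h" C "S1.N v"] S1.N_nonneg[OF v]
      by linarith
    moreover have "s1 v h = s2 v k / complex_of_real (S2.N k)"
      using h v x by (simp add: cinner_scaleC_right c_def)
    ultimately show ?thesis using Nk by (simp add: norm_divide field_simps)
  qed
  have subW: "complex_vector.subspace W"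
  proof (rule complex_vector.subspaceI)
    show "0 \<in> W" by (auto simp: W_def S2.V_zero intro!: exI[of _ 0])
    show "k + k' \<in> W" if kk: "k \<in> W" "k' \<in> W" for k k'
    proof -
      obtain x x' where "\<forall>v\<in>V. s2 v k = cinner v x" "\<forall>v\<in>V. s2 v k' = cinner v x'"
        using kk by (auto simp: W_def)
      then show ?thesis using kk
        by (auto simp: W_def S2.s_simps cinner_add_right intro!: exI[of _ "x + x'"])
    qed
    show "c *\<^sub>C k \<in> W" if kk: "k \<in> W" for c k
    proof -
      obtain x where "\<forall>v\<in>V. s2 v k = cinner v x" using kk by (auto simp: W_def)
      then show ?thesis using kk
        by (auto simp: W_def S2.s_simps cinner_scaleC_right intro!: exI[of _ "c *\<^sub>C x"])
    qed
  qed
  have WV: "W \<subseteq> V" by (auto simp: W_def)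
  have "S2.N u \<le> C * S1.N u" if u: "u \<in> V" for u
  proof -
    have bd: "cmod (s2 v u) \<le> S2.N u * S2.N v" if "v \<in> W" for v
      using S2.cauchy_schwarz[of v u] u that WV by (auto simp: mult.commute)
    \<comment> \<open>Density of \<open>W\<close>: the vector \<open>w - u\<close> is orthogonal to
      \<open>W\<close> for \<open>s2\<close>. The representative \<open>k\<close> of
      \<open>cinner v (w - u)\<close> lies in \<open>W\<close> itself, which forces
      \<open>w = u\<close>, so \<open>u\<close> is the limit of the \<open>y n\<close>.\<close>
    obtain w y where w: "w \<in> V" "\<And>n::nat. y n \<in> W" "(\<lambda>n. S2.N (y n - w)) \<longlonglongrightarrow> 0"
      "\<And>v. v \<in> W \<Longrightarrow> s2 v w = s2 v u"
    proof (rule S2.riesz_representation[OF subW WV, of "\<lambda>v. s2 v u" "S2.N u"])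
      show "s2 (v + v') u = s2 v u + s2 v' u" if "v \<in> W" "v' \<in> W" for v v'
        using that u WV S2.s_add_left by blast
      show "s2 (c *\<^sub>C v) u = cnj c * s2 v u" if "v \<in> W" for c v
        using that u WV S2.s_scale_left by blast
      show "cmod (s2 v u) \<le> S2.N u * S2.N v" if "v \<in> W" for v
        using that by (rule bd)
    qed (rule that)
    obtain k where k: "k \<in> V" "\<forall>v\<in>V. s2 v k = cinner v (w - u)" using R2 by blast
    then have "k \<in> W" by (auto simp: W_def)
    then have "s2 k (w - u) = 0" using w(4) k(1) w(1) u by (simp add: S2.s_simps)
    then have "s2 (w - u) k = 0" using S2.s_commute k(1) w(1) u S2.V_diff by (metis complex_cnj_zero)
    then have "cinner (w - u) (w - u) = 0" using k w(1) u S2.V_diff by simp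
    then have wu: "w = u" by (simp add: cinner_self)
    have yV: "y n \<in> V" for n using w WV by blast
    have lim: "(\<lambda>n. s2 u (y n)) \<longlonglongrightarrow> s2 u u"
      using S2.tendsto_s_right[OF u u yV] w(3) wu by simp
    have "cmod (s2 u (y n)) \<le> C * S1.N u * (S2.N (y n - u) + S2.N u)" for n
    proof -
      have "S2.N (y n) \<le> S2.N (y n - u) + S2.N u"
        using S2.N_triangle[of "y n - u" u] u yV S2.V_diff by simp
      moreover have "0 \<le> C * S1.N u" using S1.N_nonneg[OF u] by (simp add: C_def)
      ultimately show ?thesis using est[OF u w(2)[of n]] mult_left_mono order_trans by blast
    qed
    moreover have "(\<lambda>n. C * S1.N u * (S2.N (y n - u) + S2.N u)) \<longlonglongrightarrow> C * S1.N u * (0 + S2.N u)"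
      using w(3) wu by (intro tendsto_intros) simp
    ultimately have "cmod (s2 u u) \<le> C * S1.N u * (0 + S2.N u)"
      using LIMSEQ_le[OF tendsto_norm[OF lim]] by blast
    then have "S2.N u * S2.N u \<le> S2.N u * (C * S1.N u)"
      using S2.s_self[OF u] by (simp add: power2_eq_square mult_ac norm_mult)
    moreover have "0 \<le> C * S1.N u" using S1.N_nonneg[OF u] by (simp add: C_def)
    ultimately show ?thesis
      using S2.N_nonneg[OF u] by (cases "S2.N u = 0") auto
  qed
  then show thesis using that[of C] by (simp add: S1.N_def S2.N_def)
qed

lemma bounded_bilinear_cinner:
  "bounded_bilinear (cinner :: 'a::complex_hilbert \<Rightarrow> 'a \<Rightarrow> complex)"
proof
  show "cinner (r *\<^sub>R a) b = r *\<^sub>R cinner a b" "cinner a (r *\<^sub>R b) = r *\<^sub>R cinner a b"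
    for r and a b :: 'a
    by (simp_all add: scaleR_scaleC cinner_simps scaleR_conv_of_real)
  show "\<exists>K. \<forall>a b::'a. cmod (cinner a b) \<le> norm a * norm b * K"
    by (intro exI[of _ 1]) (simp add: cinner_cauchy_schwarz)
qed (simp_all add: cinner_simps)

lemmas tendsto_cinner [tendsto_intros] = bounded_bilinear.tendsto[OF bounded_bilinear_cinner]

lemma bounded_linear_scaleC: "bounded_linear (\<lambda>x::'a::complex_inner. c *\<^sub>C x)"
  by (rule bounded_linear_intro[where K = "cmod c"])
    (simp_all add: scaleC_add_right scaleR_scaleC scaleC_scaleC norm_scaleC mult.commute)

lemmas tendsto_scaleC [tendsto_intros] = bounded_linear.tendsto[OF bounded_linear_scaleC]

lemma scaleC_minus_one: "(-1) *\<^sub>C (x::'a::complex_vector) = - x"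
  by (simp add: complex_vector.scale_minus_left)

lemma norm_Re_cinner_self: "Re (cinner x x) = (norm x)\<^sup>2"
  by (simp add: cinner_self)

lemma Re_cinner_le: "Re (cinner x y) \<le> norm x * norm (y::'a::complex_hilbert)"
  using cinner_cauchy_schwarz[of x y] complex_Re_le_cmod order_trans by blast

section \<open>Projections and finite-dimensional subspaces\<close>

text \<open>The projection is the Riesz vector of the functional \<open>cinner v h\<close>
  restricted to \<open>V\<close>.\<close>

lemma orthogonal_projection:
  fixes h :: "'a::complex_hilbert"
  assumes V: "complex_vector.subspace V" "closed V"
  obtains p where "p \<in> V" "\<And>v. v \<in> V \<Longrightarrow> cinner v (h - p) = 0"
proof -
  interpret V: hilbert_space_on V cinner
    by unfold_locales (rule hilbert_on_cinner[OF V])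
  have "cmod (cinner u h) \<le> norm h * V.N u" for u
    using cinner_cauchy_schwarz[of u h] by (simp add: V.N_def sdist_cinner mult.commute)
  from V.riesz_representation[OF V(1) order_refl cinner_add_left cinner_scaleC_left this]
  obtain w where "w \<in> V" "\<And>v. v \<in> V \<Longrightarrow> cinner v w = cinner v h" by metis
  then show thesis using that[of w] by (simp add: cinner_diff_right)
qed

lemma norm_le_add_orthogonal:
  fixes u v :: "'a::complex_hilbert"
  assumes "cinner v u = 0"
  shows "norm u \<le> norm (u + v)" "norm v \<le> norm (u + v)"
proof -
  have "(norm (u + v))\<^sup>2 = (norm u)\<^sup>2 + (norm v)\<^sup>2"
    using cinner.N_square_add[of u v] assms by simp
  then show "norm u \<le> norm (u + v)" "norm v \<le> norm (u + v)"
    by (auto intro: power2_le_imp_le)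
qed

lemma strict_mono_comp: "strict_mono (r::nat \<Rightarrow> nat) \<Longrightarrow> strict_mono s \<Longrightarrow> strict_mono (r \<circ> s)"
  by (simp add: strict_mono_def)

lemma closed_if_subseq:
  fixes V :: "'a::real_normed_vector set"
  assumes "\<And>x. (\<And>n::nat. x n \<in> V) \<Longrightarrow> Bseq x \<Longrightarrow> \<exists>l\<in>V. \<exists>r. strict_mono r \<and> (x \<circ> r) \<longlonglongrightarrow> l"
  shows "closed V"
  unfolding closed_sequential_limits
proof (intro allI impI, elim conjE)
  fix y l assume y: "\<forall>n. y n \<in> V" "y \<longlonglongrightarrow> l"
  then have "Bseq y" using convergentI convergent_imp_Bseq by blast
  then obtain l' r where r: "l' \<in> V" "strict_mono r" "(y \<circ> r) \<longlonglongrightarrow> l'"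
    using assms[of y] y(1) by blast
  then have "l' = l" using LIMSEQ_subseq_LIMSEQ[OF y(2)] LIMSEQ_unique by blast
  then show "l \<in> V" using r by simp
qed

text \<open>Projecting the new generator onto the old span requires that span to be closed. This
  follows from the induction hypothesis, which is why the limit is asserted to lie in the span. By
  Pythagoras both components of a bounded sequence are bounded.\<close>

lemma bounded_seq_in_span_subseq:
  fixes B :: "'a::complex_hilbert set"
  assumes "finite B" "\<And>n. x n \<in> complex_vector.span B" "Bseq x"
  shows "\<exists>l\<in>complex_vector.span B. \<exists>r. strict_mono r \<and> (x \<circ> r) \<longlonglongrightarrow> l"
  using assms
proof (induction B arbitrary: x rule: finite_induct)
  case empty
  then have "(x \<circ> id) \<longlonglongrightarrow> 0" by (simp add: comp_def)
  moreover have "strict_mono (id :: nat \<Rightarrow> nat)" by (simp add: strict_mono_def)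
  ultimately show ?case by auto
next
  case (insert b B)
  define V where "V = complex_vector.span B"
  have V: "complex_vector.subspace V" by (simp add: V_def)
  have "closed V" unfolding V_def by (rule closed_if_subseq) (rule insert.IH)
  from orthogonal_projection[OF V this, of b]
  obtain p where p: "p \<in> V" "\<And>v. v \<in> V \<Longrightarrow> cinner v (b - p) = 0" by blast
  show ?case
  proof (cases "b = p")
    case True
    then have "complex_vector.span (insert b B) = V"
      using p(1) by (simp add: V_def complex_vector.span_redundant)
    then show ?thesis using insert.IH[of x] insert.prems by (simp add: V_def)
  next
    case False
    define e where "e = b - p"
    have e0: "0 < norm e" using False by (simp add: e_def)
    have "\<exists>k v. v \<in> V \<and> x n = v + k *\<^sub>C e" for n
    proof -
      obtain k where k: "x n - k *\<^sub>C b \<in> V"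
        using insert.prems(1)[of n] by (auto simp: V_def complex_vector.span_insert)
      have "(x n - k *\<^sub>C b) + k *\<^sub>C p \<in> V"
        using k p V complex_vector.subspace_add complex_vector.subspace_scale by blast
      moreover have "x n = ((x n - k *\<^sub>C b) + k *\<^sub>C p) + k *\<^sub>C e"
        by (simp add: e_def complex_vector.scale_right_diff_distrib)
      ultimately show ?thesis by blast
    qed
    then obtain k v where kv: "\<And>n. v n \<in> V" "\<And>n. x n = v n + k n *\<^sub>C e" by metis
    have orth: "cinner (k n *\<^sub>C e) (v n) = 0" for n
      using p(2)[OF kv(1)] cinner_commute[of "k n *\<^sub>C e" "v n"]
      by (simp add: e_def cinner_scaleC_right)
    obtain K where K: "\<And>n. norm (x n) \<le> K" using insert.prems(2) BseqE by blast
    have "norm (v n) \<le> K" for n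
      using norm_le_add_orthogonal(1)[OF orth] kv(2) K order_trans by metis
    then have "Bseq v" by (rule BseqI')
    then obtain l r where r: "l \<in> V" "strict_mono r" "(v \<circ> r) \<longlonglongrightarrow> l"
      using insert.IH[of v] kv(1) unfolding V_def by blast
    have "cmod (k n) \<le> K / norm e" for n
      using norm_le_add_orthogonal(2)[OF orth, of n] kv(2)[of n] K[of n] e0
      by (simp add: norm_scaleC field_simps)
    then have "bounded (range (k \<circ> r))" by (auto simp: bounded_iff)
    then obtain c q where q: "strict_mono q" "((k \<circ> r) \<circ> q) \<longlonglongrightarrow> c"
      using bounded_imp_convergent_subsequence by blast
    have "bounded_linear (\<lambda>c. c *\<^sub>C e)"
      by (rule bounded_linear_intro[where K = "norm e"])
        (simp_all add: scaleC_add_left scaleR_scaleC scaleC_scaleC norm_scaleC scaleR_conv_of_real)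
    then have "(\<lambda>n. k (r (q n)) *\<^sub>C e) \<longlonglongrightarrow> c *\<^sub>C e"
      using bounded_linear.tendsto q(2) by (fastforce simp: comp_def)
    moreover have "(\<lambda>n. v (r (q n))) \<longlonglongrightarrow> l"
      using LIMSEQ_subseq_LIMSEQ[OF r(3) q(1)] by (simp add: comp_def)
    ultimately have "(x \<circ> (r \<circ> q)) \<longlonglongrightarrow> l + c *\<^sub>C e"
      unfolding comp_def kv(2) by (rule tendsto_add[rotated])
    moreover have "l + c *\<^sub>C e \<in> complex_vector.span (insert b B)"
    proof -
      have "V \<subseteq> complex_vector.span (insert b B)"
        unfolding V_def by (rule complex_vector.span_mono) blast
      moreover have "b \<in> complex_vector.span (insert b B)"
        by (simp add: complex_vector.span_base)
      ultimately have "c *\<^sub>C (b - p) \<in> complex_vector.span (insert b B)"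
        using p(1) by (blast intro: complex_vector.span_scale complex_vector.span_diff)
      with \<open>V \<subseteq> _\<close> r(1) show ?thesis
        unfolding e_def by (blast intro: complex_vector.span_add)
    qed
    ultimately show ?thesis using r(2) q(1) strict_mono_comp by blast
  qed
qed

lemma closed_finite_span:
  fixes B :: "'a::complex_hilbert set"
  assumes "finite B"
  shows "closed (complex_vector.span B)"
  by (rule closed_if_subseq) (rule bounded_seq_in_span_subseq[OF assms])

text \<open>Otherwise Gram-Schmidt yields an orthonormal sequence in \<open>V\<close>, and its
  members have mutual distance at least 1. Each projection is onto a finite span, which is
  closed.\<close>

lemma finite_dimensional_if_subseq:
  fixes V :: "'a::complex_hilbert set"
  assumes V: "complex_vector.subspace V"
    and sub: "\<And>x. (\<And>n::nat. x n \<in> V) \<Longrightarrow> Bseq x \<Longrightarrow> \<exists>r. strict_mono r \<and> convergent (x \<circ> r)"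
  shows "\<exists>B. finite B \<and> V \<subseteq> complex_vector.span B"
proof (rule ccontr)
  assume inf: "\<not> (\<exists>B. finite B \<and> V \<subseteq> complex_vector.span B)"
  define P where "P f n e \<longleftrightarrow> e \<in> V \<and> norm e = 1 \<and> (\<forall>i<n. cinner (f i) e = 0)"
    for f :: "nat \<Rightarrow> 'a" and n e
  have "\<exists>f. \<forall>n. P f n (f n)"
  proof (rule dependent_wellorder_choice)
    show "P f n e = P g n e" if "\<And>i. i < n \<Longrightarrow> f i = g i" for e f g n
      using that by (simp add: P_def)
    show "\<exists>e. P f n e" if f: "\<And>i. i < n \<Longrightarrow> P f i (f i)" for n f
    proof -
      define S where "S = complex_vector.span (f ` {..<n})"
      have SV: "S \<subseteq> V"
        unfolding S_def using f V by (intro complex_vector.span_minimal) (auto simp: P_def)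
      obtain x where x: "x \<in> V" "x \<notin> S" using inf S_def by blast
      obtain p where p: "p \<in> S" "\<And>v. v \<in> S \<Longrightarrow> cinner v (x - p) = 0"
        using orthogonal_projection[of S x] closed_finite_span[of "f ` {..<n}"]
        by (auto simp: S_def)
      define c where "c = complex_of_real (1 / norm (x - p))"
      have "x \<noteq> p" using x p by blast
      then have "norm (c *\<^sub>C (x - p)) = 1" by (simp add: norm_scaleC c_def norm_divide)
      moreover have "c *\<^sub>C (x - p) \<in> V"
        using x p SV V complex_vector.subspace_scale complex_vector.subspace_diff by blast
      moreover have "cinner (f i) (c *\<^sub>C (x - p)) = 0" if "i < n" for i
        using p(2)[of "f i"] that by (simp add: S_def complex_vector.span_base cinner_scaleC_right)
      ultimately show ?thesis unfolding P_def by blast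
    qed
  qed
  then obtain f :: "nat \<Rightarrow> 'a" where f: "\<And>n. f n \<in> V" "\<And>n. norm (f n) = 1" "\<And>i n. i < n \<Longrightarrow> cinner (f i) (f n) = 0"
    unfolding P_def by blast
  have "Bseq f" using f(2) by (intro BseqI'[where K = 1]) simp
  then obtain r where r: "strict_mono r" "convergent (f \<circ> r)" using sub f(1) by blast
  then have "Cauchy (f \<circ> r)" using convergent_Cauchy by blast
  then obtain M where M: "\<And>m n. M \<le> m \<Longrightarrow> M \<le> n \<Longrightarrow> norm (f (r m) - f (r n)) < 1"
    using CauchyD[of "f \<circ> r" 1] by auto
  have "r M < r (Suc M)" using r(1) by (simp add: strict_mono_def)
  then have "cinner (f (r M)) (f (r (Suc M))) = 0" by (rule f(3))
  then have "cinner ((- 1) *\<^sub>C f (r M)) (f (r (Suc M))) = 0"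
    by (simp only: cinner_scaleC_left mult_zero_right)
  then have "norm (f (r (Suc M))) \<le> norm (f (r (Suc M)) + (- 1) *\<^sub>C f (r M))"
    by (rule norm_le_add_orthogonal)
  then show False using M[of "Suc M" M] f(2) by (simp add: scaleC_minus_one)
qed

lemma Cauchy_const: "Cauchy (\<lambda>_. c :: 'a::metric_space)"
  by (rule LIMSEQ_imp_Cauchy) (rule tendsto_const)

text \<open>Three sequences are the shape needed for the coercivity estimate, where two perturbation
  terms and the right-hand side occur; elsewhere constant sequences fill the free places.\<close>

lemma Cauchy_dominated:
  fixes w :: "nat \<Rightarrow> 'a::real_normed_vector" and x :: "nat \<Rightarrow> 'b::real_normed_vector"
    and y :: "nat \<Rightarrow> 'c::real_normed_vector" and z :: "nat \<Rightarrow> 'd::real_normed_vector"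
  assumes "Cauchy x" "Cauchy y" "Cauchy z"
    and w: "\<And>m n. norm (w m - w n) \<le>
      K * (norm (x m - x n) + norm (y m - y n) + norm (z m - z n))"
  shows "Cauchy w"
proof (rule CauchyI)
  fix e :: real assume e: "0 < e"
  define c where "c = e / (3 * (\<bar>K\<bar> + 1))"
  have c: "0 < c" using e by (simp add: c_def)
  obtain M1 where M1: "\<And>m n. M1 \<le> m \<Longrightarrow> M1 \<le> n \<Longrightarrow> norm (x m - x n) < c"
    using CauchyD[OF assms(1) c] by blast
  obtain M2 where M2: "\<And>m n. M2 \<le> m \<Longrightarrow> M2 \<le> n \<Longrightarrow> norm (y m - y n) < c"
    using CauchyD[OF assms(2) c] by blast
  obtain M3 where M3: "\<And>m n. M3 \<le> m \<Longrightarrow> M3 \<le> n \<Longrightarrow> norm (z m - z n) < c"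
    using CauchyD[OF assms(3) c] by blast
  have "norm (w m - w n) < e" if "max M1 (max M2 M3) \<le> m" "max M1 (max M2 M3) \<le> n" for m n
  proof -
    define S where "S = norm (x m - x n) + norm (y m - y n) + norm (z m - z n)"
    have S: "0 \<le> S" "S < 3 * c"
      using M1[of m n] M2[of m n] M3[of m n] that by (auto simp: S_def)
    have "norm (w m - w n) \<le> K * S" using w by (simp add: S_def)
    also have "\<dots> \<le> (\<bar>K\<bar> + 1) * S" using S by (intro mult_right_mono) auto
    also have "\<dots> < (\<bar>K\<bar> + 1) * (3 * c)" using S by (intro mult_strict_left_mono) auto
    also have "\<dots> = e"
    proof -
      have "\<bar>K\<bar> + 1 \<noteq> 0" by linarith
      then show ?thesis unfolding c_def by (metis mult.commute nonzero_eq_divide_eq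
            mult.left_commute times_divide_eq_right divide_eq_0_iff mult_eq_0_iff zero_neq_numeral)
    qed
    finally show ?thesis .
  qed
  then show "\<exists>M. \<forall>m\<ge>M. \<forall>n\<ge>M. norm (w m - w n) < e" by blast
qed

section \<open>Closed linear relations with compact bounded level sets\<close>

text \<open>
  For a closed operator \<open>T\<close> this means that \<open>T\<close> has finite-dimensional kernel and closed range.
\<close>

definition semi_fredholm :: "('a::complex_hilbert \<times> 'a) set \<Rightarrow> bool" where
  "semi_fredholm T \<longleftrightarrow> (\<forall>u f. (\<forall>n::nat. (u n, f n) \<in> T) \<and> Bseq u \<and> convergent f \<longrightarrow>
     (\<exists>r. strict_mono r \<and> convergent (u \<circ> r)))"

lemma semi_fredholmD:
  assumes "semi_fredholm T" "\<And>n::nat. (u n, f n) \<in> T" "Bseq u" "convergent f"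
  shows "\<exists>r. strict_mono r \<and> convergent (u \<circ> r)"
  using assms unfolding semi_fredholm_def by blast

text \<open>Working with the graph as a closed subspace of the product accommodates operators that
  are defined by a weak equation rather than by an explicit map.\<close>

locale closed_linear_relation =
  fixes T :: "('a::complex_hilbert \<times> 'a) set"
  assumes zero: "(0, 0) \<in> T"
    and add: "(u, f) \<in> T \<Longrightarrow> (v, g) \<in> T \<Longrightarrow> (u + v, f + g) \<in> T"
    and scale: "(u, f) \<in> T \<Longrightarrow> (c *\<^sub>C u, c *\<^sub>C f) \<in> T"
    and limit: "(\<And>n::nat. (x n, y n) \<in> T) \<Longrightarrow> x \<longlonglongrightarrow> u \<Longrightarrow> y \<longlonglongrightarrow> f \<Longrightarrow> (u, f) \<in> T"
begin

lemma diff: "(u, f) \<in> T \<Longrightarrow> (v, g) \<in> T \<Longrightarrow> (u - v, f - g) \<in> T"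
  using add[of u f "- v" "- g"] scale[of v g "- 1"] by (simp add: scaleC_minus_one)

definition ker :: "'a set" where "ker = {u. (u, 0) \<in> T}"

lemma subspace_ker: "complex_vector.subspace ker"
proof (rule complex_vector.subspaceI)
  show "x + y \<in> ker" if "x \<in> ker" "y \<in> ker" for x y using that add[of x 0 y 0] by (simp add: ker_def)
  show "c *\<^sub>C x \<in> ker" if "x \<in> ker" for c x using that scale[of x 0 c] by (simp add: ker_def)
qed (use zero in \<open>simp add: ker_def\<close>)

lemma closed_ker: "closed ker"
  unfolding closed_sequential_limits ker_def using limit[of _ "\<lambda>_. 0" _ 0] by auto

lemma subspace_Range: "complex_vector.subspace (Range T)"
proof (rule complex_vector.subspaceI)
  show "x + y \<in> Range T" if "x \<in> Range T" "y \<in> Range T" for x y using that add by blast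
  show "c *\<^sub>C x \<in> Range T" if "x \<in> Range T" for c x using that scale by blast
qed (use zero in blast)

text \<open>Solutions are determined up to the kernel; the one orthogonal to the kernel is the one
  that can be controlled by the right-hand side.\<close>

lemma orthogonal_solution:
  assumes "(u, f) \<in> T"
  obtains w k where "(w, f) \<in> T" "\<And>v. v \<in> ker \<Longrightarrow> cinner v w = 0" "k \<in> ker" "u = w + k"
proof -
  obtain p where p: "p \<in> ker" "\<And>v. v \<in> ker \<Longrightarrow> cinner v (u - p) = 0"
    using orthogonal_projection[OF subspace_ker closed_ker] by blast
  have "(u - p, f) \<in> T" using diff[OF assms, of p 0] p(1) by (simp add: ker_def)
  then show thesis using that[of "u - p" p] p by simp
qed

lemma semi_fredholm_ker:
  assumes "semi_fredholm T"
  shows "\<exists>B. finite B \<and> ker \<subseteq> complex_vector.span B"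
proof (rule finite_dimensional_if_subseq[OF subspace_ker])
  fix x :: "nat \<Rightarrow> 'a" assume "\<And>n. x n \<in> ker" "Bseq x"
  then show "\<exists>r. strict_mono r \<and> convergent (x \<circ> r)"
    by (intro semi_fredholmD[OF assms, of x "\<lambda>_. 0"]) (simp_all add: ker_def convergent_const)
qed

text \<open>It suffices that the solutions orthogonal to the kernel are bounded. If not, their
  normalisations would have a limit point of norm 1 lying in the kernel and orthogonal to
  it.\<close>

lemma semi_fredholm_closed_Range:
  assumes T: "semi_fredholm T"
  shows "closed (Range T)"
  unfolding closed_sequential_limits
proof (intro allI impI, elim conjE)
  fix f l assume f: "\<forall>n. f n \<in> Range T" "f \<longlonglongrightarrow> l"
  have "\<exists>u. (u, f n) \<in> T \<and> (\<forall>v\<in>ker. cinner v u = 0)" for n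
    using f(1) orthogonal_solution by (metis RangeE)
  then obtain u where u: "\<And>n. (u n, f n) \<in> T" "\<And>n v. v \<in> ker \<Longrightarrow> cinner v (u n) = 0" by metis
  have "Bseq u"
  proof (rule ccontr)
    assume nb: "\<not> Bseq u"
    then have "\<exists>n. real k < norm (u n)" for k
      by (metis BseqI' not_le)
    \<comment> \<open>The indices \<open>q k\<close> come in no particular order: after division by
      a norm exceeding \<open>k\<close>, boundedness of \<open>f\<close> makes the right-hand sides
      tend to 0.\<close>
    then obtain q where q: "\<And>k. real k < norm (u (q k))" by metis
    define c where "c k = complex_of_real (1 / norm (u (q k)))" for k
    define w where "w k = c k *\<^sub>C u (q k)" for k
    have qp: "0 < norm (u (q k))" for k using q[of k] by (smt (verit) of_nat_0_le_iff)
    have w1: "norm (w k) = 1" for k using qp[of k] by (simp add: w_def norm_scaleC c_def norm_divide)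
    have wT: "(w k, c k *\<^sub>C f (q k)) \<in> T" for k unfolding w_def by (rule scale[OF u(1)])
    obtain K where K: "\<And>n. norm (f n) \<le> K" "0 < K"
      using f(2) BseqE convergentI convergent_imp_Bseq by metis
    have g0: "(\<lambda>k. c k *\<^sub>C f (q k)) \<longlonglongrightarrow> 0"
    proof (rule Lim_null_comparison)
      have "norm (c k *\<^sub>C f (q k)) \<le> K / real k" if "0 < k" for k
      proof -
        have "norm (c k *\<^sub>C f (q k)) = norm (f (q k)) / norm (u (q k))"
          by (simp add: norm_scaleC c_def norm_divide)
        also have "\<dots> \<le> K / real k"
          using K q[of k] that by (intro frac_le) (auto intro: less_imp_le)
        finally show ?thesis .
      qed
      then show "\<forall>\<^sub>F k in sequentially. norm (c k *\<^sub>C f (q k)) \<le> K / real k"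
        by (auto intro: eventually_sequentiallyI[of 1])
      show "(\<lambda>k. K / real k) \<longlonglongrightarrow> 0" by (rule lim_const_over_n)
    qed
    have "Bseq w" using w1 by (intro BseqI'[where K = 1]) simp
    then obtain r where r: "strict_mono r" "convergent (w \<circ> r)"
      using semi_fredholmD[OF T wT _ convergentI[OF g0]] by blast
    then obtain W where W: "(w \<circ> r) \<longlonglongrightarrow> W" by (auto simp: convergent_def)
    have "(W, 0) \<in> T"
      using limit[of "w \<circ> r" "(\<lambda>k. c k *\<^sub>C f (q k)) \<circ> r" W 0] wT W LIMSEQ_subseq_LIMSEQ[OF g0 r(1)]
      by simp
    then have "cinner W (u n) = 0" for n using u(2) by (simp add: ker_def)
    then have "cinner W ((w \<circ> r) n) = 0" for n by (simp add: w_def cinner_scaleC_right)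
    then have "cinner W W = 0"
      using tendsto_cinner[OF tendsto_const W, of W] by (simp add: LIMSEQ_const_iff)
    then have "W = 0" by (simp add: cinner_self)
    moreover have "norm W = 1"
      using tendsto_norm[OF W] w1 by (simp add: LIMSEQ_const_iff)
    ultimately show False by simp
  qed
  then obtain r where r: "strict_mono r" "convergent (u \<circ> r)"
    using semi_fredholmD[OF T, of u f] f(2) u(1) convergentI by blast
  then obtain U where U: "(u \<circ> r) \<longlonglongrightarrow> U" by (auto simp: convergent_def)
  have "(U, l) \<in> T"
    using limit[of "u \<circ> r" "f \<circ> r"] u(1) U LIMSEQ_subseq_LIMSEQ[OF f(2) r(1)] by simp
  then show "l \<in> Range T" by blast
qed

text \<open>
  On the orthogonal complement of the kernel the vectors \<open>u\<close> with \<open>\<parallel>T u\<parallel> \<le> 1\<close> are weakly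
  bounded, since any vector is of the form \<open>T v + k\<close> with \<open>k\<close> orthogonal to the range.
\<close>

lemma semi_fredholmI:
  assumes sym: "\<And>u f v g. (u, f) \<in> T \<Longrightarrow> (v, g) \<in> T \<Longrightarrow> cinner f v = cinner u g"
    and adj: "\<And>k. (\<And>v g. (v, g) \<in> T \<Longrightarrow> cinner k g = 0) \<Longrightarrow> k \<in> ker"
    and B: "finite B" "ker \<subseteq> complex_vector.span B"
    and cl: "closed (Range T)"
  shows "semi_fredholm T"
  unfolding semi_fredholm_def
proof (intro allI impI, elim conjE)
  fix u f assume uf: "\<forall>n::nat. (u n, f n) \<in> T" and u: "Bseq u" and f: "convergent f"
  define F where "F = {w. (\<forall>v\<in>ker. cinner v w = 0) \<and> (\<exists>g. (w, g) \<in> T \<and> norm g \<le> 1)}"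
  have "\<exists>M. \<forall>w\<in>F. cmod (cinner h w) \<le> M" for h
  proof -
    obtain p where p: "p \<in> Range T" "\<And>g. g \<in> Range T \<Longrightarrow> cinner g (h - p) = 0"
      using orthogonal_projection[OF subspace_Range cl] by blast
    obtain v where v: "(v, p) \<in> T" using p(1) by blast
    have "cinner (h - p) g = 0" if "(v', g) \<in> T" for v' g
      using p(2)[of g] that cinner_commute[of "h - p" g] by auto
    then have k: "h - p \<in> ker" by (rule adj)
    have "cmod (cinner h w) \<le> norm v" if w: "w \<in> F" for w
    proof -
      obtain g where g: "(w, g) \<in> T" "norm g \<le> 1" using w unfolding F_def by blast
      have "cinner (h - p) w = 0" using w k by (simp add: F_def)
      then have "cinner h w = cinner p w" by (simp add: cinner_diff_left)
      also have "\<dots> = cinner v g" using sym[OF v g(1)] .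
      finally show ?thesis
        using cinner_cauchy_schwarz[of v g] mult_left_mono[OF g(2), of "norm v"] by simp
    qed
    then show ?thesis by blast
  qed
  then obtain C where C: "\<And>w. w \<in> F \<Longrightarrow> norm w \<le> C"
    using cinner.uniform_boundedness[of F] by blast
  have est: "norm w \<le> C * norm g" if w: "(w, g) \<in> T" "\<And>v. v \<in> ker \<Longrightarrow> cinner v w = 0" for w g
  proof (cases "g = 0")
    case True
    then have "cinner w w = 0" using w by (simp add: ker_def)
    then show ?thesis using True by (simp add: cinner_self)
  next
    case False
    define c where "c = complex_of_real (1 / norm g)"
    have "c *\<^sub>C w \<in> F"
      unfolding F_def using w scale[OF w(1), of c] False
      by (auto simp: cinner_scaleC_right norm_scaleC c_def norm_divide intro!: exI[of _ "c *\<^sub>C g"])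
    then have "norm (c *\<^sub>C w) \<le> C" by (rule C)
    then show ?thesis using False by (simp add: norm_scaleC c_def norm_divide field_simps)
  qed
  \<comment> \<open>The parts orthogonal to the kernel converge together with \<open>f\<close>; the
    kernel parts are bounded in a finite-dimensional space.\<close>
  have "\<exists>w k. (w, f n) \<in> T \<and> (\<forall>v\<in>ker. cinner v w = 0) \<and> k \<in> ker \<and> u n = w + k" for n
    using uf orthogonal_solution by metis
  then obtain w k where wk: "\<And>n. (w n, f n) \<in> T" "\<And>n v. v \<in> ker \<Longrightarrow> cinner v (w n) = 0"
    "\<And>n. k n \<in> ker" "\<And>n. u n = w n + k n" by metis
  have dw: "norm (w m - w n) \<le> C * norm (f m - f n)" for m n
    using est[OF diff[OF wk(1) wk(1)], of m n] wk(2) by (simp add: cinner_diff_right)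
  have "Cauchy w"
    using f[THEN convergent_Cauchy] Cauchy_const Cauchy_const
    by (rule Cauchy_dominated[where K = C]) (simp add: dw)
  then obtain W where W: "w \<longlonglongrightarrow> W" using Cauchy_convergent convergent_def by blast
  obtain K where K: "\<And>n. norm (u n) \<le> K" using u BseqE by blast
  have "cinner (k n) (w n) = 0" for n using wk by blast
  then have "norm (k n) \<le> K" for n
    using norm_le_add_orthogonal(2)[of "k n" "w n"] wk(4)[of n] K[of n] by simp
  then have "Bseq k" by (rule BseqI')
  then obtain l r where r: "strict_mono r" "(k \<circ> r) \<longlonglongrightarrow> l"
    using bounded_seq_in_span_subseq[OF B(1), of k] wk(3) B(2) by blast
  have "(\<lambda>n. w (r n) + k (r n)) \<longlonglongrightarrow> W + l"
    using LIMSEQ_subseq_LIMSEQ[OF W r(1)] r(2) by (intro tendsto_add) (simp_all add: comp_def)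
  then have "(u \<circ> r) \<longlonglongrightarrow> W + l" by (simp add: comp_def wk(4))
  then show "\<exists>r. strict_mono r \<and> convergent (u \<circ> r)" using r(1) convergentI by blast
qed

end

section \<open>Form operators\<close>

lemma bounded_ops_scaleC: "T \<in> bounded_ops \<Longrightarrow> blinfun_apply T (c *\<^sub>C u) = c *\<^sub>C T u"
  by (simp add: bounded_ops_def)

text \<open>Turns coercivity into a linear estimate, with \<open>D\<close> and \<open>W\<close> the
  norms of \<open>d e\<close> and \<open>e\<close>. The factor 2 is that of
  \<open>(D + W)\<^sup>2 \<le> 2 * (D\<^sup>2 + W\<^sup>2)\<close>.\<close>

lemma quadratic_bound:
  fixes D W P R c :: real
  assumes "0 \<le> D" "0 \<le> W" "0 \<le> P" "0 \<le> R" "0 < c" "c * (D\<^sup>2 + W\<^sup>2) \<le> D * P + W * R"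
  shows "D + W \<le> 2 / c * (P + R)"
proof (cases "D + W = 0")
  case True
  then show ?thesis using assms by simp
next
  case False
  have "c * (D + W)\<^sup>2 \<le> 2 * (c * (D\<^sup>2 + W\<^sup>2))"
    using assms(5) sum_squares_bound[of D W] by (simp add: power2_sum)
  also have "\<dots> \<le> 2 * ((D + W) * (P + R))"
  proof -
    have "D * P + W * R \<le> (D + W) * (P + R)"
      using mult_nonneg_nonneg[OF assms(1,4)] mult_nonneg_nonneg[OF assms(2,3)]
      by (simp add: algebra_simps)
    then show ?thesis using assms(6) by linarith
  qed
  finally have "(D + W) * (c * (D + W)) \<le> (D + W) * (2 * (P + R))"
    by (simp add: power2_eq_square mult_ac)
  moreover have "0 < D + W" using False assms by simp
  ultimately have "c * (D + W) \<le> 2 * (P + R)" by simp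
  then show ?thesis using assms(5) by (simp add: field_simps)
qed

text \<open>Used with identity coefficients and with \<open>lam\<close>, \<open>Lam\<close>, so that
  both operators are compared on the original Hilbert spaces, and with \<open>d = 0\<close> for
  statements about \<open>lam\<close> alone.\<close>

locale weighted_form =
  fixes G :: "'h::complex_hilbert set" and d :: "'h \<Rightarrow> 'k::complex_hilbert"
    and lam :: "'h \<Rightarrow>\<^sub>L 'h" and Lam :: "'k \<Rightarrow>\<^sub>L 'k" and \<kappa> :: real
  assumes d: "closed_densely_defined G d"
    and lam: "selfadjoint_bounded lam" and Lam: "selfadjoint_bounded Lam"
    and kappa: "0 < \<kappa>"
    and lam_ge: "\<kappa> * (norm u)\<^sup>2 \<le> Re (cinner u (lam u))"
    and Lam_ge: "\<kappa> * (norm w)\<^sup>2 \<le> Re (cinner w (Lam w))"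
begin

lemma subspace_G: "complex_vector.subspace G"
  using d by (simp add: closed_densely_defined_def)

lemmas G_add = complex_vector.subspace_add[OF subspace_G]
  and G_scale = complex_vector.subspace_scale[OF subspace_G]
  and G_diff = complex_vector.subspace_diff[OF subspace_G]
  and G_zero = complex_vector.subspace_0[OF subspace_G]

lemma d_add: "u \<in> G \<Longrightarrow> v \<in> G \<Longrightarrow> d (u + v) = d u + d v"
  and d_scale: "u \<in> G \<Longrightarrow> d (c *\<^sub>C u) = c *\<^sub>C d u"
  using d unfolding closed_densely_defined_def by blast+

lemma d_diff: "u \<in> G \<Longrightarrow> v \<in> G \<Longrightarrow> d (u - v) = d u - d v"
  by (metis G_diff add_diff_cancel diff_add_cancel d_add)

lemma d_zero [simp]: "d 0 = 0"
  using d_diff[OF G_zero G_zero] by simp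

lemma d_limit:
  assumes "\<And>n::nat. x n \<in> G" "x \<longlonglongrightarrow> u" "(\<lambda>n. d (x n)) \<longlonglongrightarrow> w"
  shows "u \<in> G" "d u = w"
proof -
  have "closed (op_graph G d)" using d by (simp add: closed_densely_defined_def)
  moreover have "(x n, d (x n)) \<in> op_graph G d" for n using assms(1) by (simp add: op_graph_def)
  moreover have "(\<lambda>n. (x n, d (x n))) \<longlonglongrightarrow> (u, w)" using assms by (intro tendsto_Pair)
  ultimately have "(u, w) \<in> op_graph G d" by (rule closed_sequentially)
  then show "u \<in> G" "d u = w" by (auto simp: op_graph_def)
qed

lemma lam_scale: "lam (c *\<^sub>C u) = c *\<^sub>C lam u" and Lam_scale: "Lam (c *\<^sub>C w) = c *\<^sub>C Lam w"
  using lam Lam bounded_ops_scaleC by (auto simp: selfadjoint_bounded_def)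

lemma lam_symmetric: "cinner (lam u) v = cinner u (lam v)"
  and Lam_symmetric: "cinner (Lam w) w' = cinner w (Lam w')"
  using lam Lam by (auto simp: selfadjoint_bounded_def)

lemmas form_simps = cinner_simps d_add d_diff d_scale blinfun.add_right blinfun.diff_right
  lam_scale Lam_scale G_add G_diff G_scale G_zero

lemma lam_commute: "cnj (cinner u (lam v)) = cinner v (lam u)"
  by (metis cinner_commute lam_symmetric)

lemma Lam_commute: "cnj (cinner u (Lam v)) = cinner v (Lam u)"
  by (metis cinner_commute Lam_symmetric)

text \<open>The summand with \<open>lam\<close> amounts to the spectral parameter \<open>- 1\<close>
  and makes the form coercive for the graph norm of \<open>d\<close>.\<close>

definition form :: "'h \<Rightarrow> 'h \<Rightarrow> complex" where
  "form u v = cinner (d u) (Lam (d v)) + cinner u (lam v)"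

lemma form_ge: "\<kappa> * ((norm (d u))\<^sup>2 + (norm u)\<^sup>2) \<le> Re (form u u)"
  using Lam_ge[of "d u"] lam_ge[of u] by (simp add: form_def distrib_left)

lemma norm_le_form:
  "sqrt \<kappa> * norm (d u) \<le> sqrt (Re (form u u))" "sqrt \<kappa> * norm u \<le> sqrt (Re (form u u))"
proof -
  have "\<kappa> * (norm (d u))\<^sup>2 \<le> Re (form u u)" "\<kappa> * (norm u)\<^sup>2 \<le> Re (form u u)"
    using form_ge[of u] kappa by (simp_all add: distrib_left) (smt (verit) mult_nonneg_nonneg zero_le_power2)+
  then have "sqrt (\<kappa> * (norm (d u))\<^sup>2) \<le> sqrt (Re (form u u))"
    "sqrt (\<kappa> * (norm u)\<^sup>2) \<le> sqrt (Re (form u u))" by simp_all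
  then show "sqrt \<kappa> * norm (d u) \<le> sqrt (Re (form u u))" "sqrt \<kappa> * norm u \<le> sqrt (Re (form u u))"
    by (simp_all add: real_sqrt_mult)
qed

text \<open>Coercivity makes a Cauchy sequence for the form Cauchy in the graph norm, so
  completeness reduces to closedness of \<open>d\<close>; boundedness of the coefficients gives
  convergence in the form norm.\<close>

lemma hilbert_on_form: "hilbert_on G form"
  unfolding hilbert_on_def scalar_product_on_def
proof (intro conjI ballI allI impI)
  show "form u v = cnj (form v u)" if "u \<in> G" "v \<in> G" for u v
    by (simp add: form_def Lam_commute lam_commute)
  show "0 < Re (form u u)" if "u \<noteq> 0" for u
  proof -
    have "0 < \<kappa> * ((norm (d u))\<^sup>2 + (norm u)\<^sup>2)"
      using that kappa by (intro mult_pos_pos) (simp_all add: add_nonneg_pos)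
    then show ?thesis using form_ge[of u] by linarith
  qed
  fix f assume f: "(\<forall>n::nat. f n \<in> G) \<and>
    (\<forall>e>0. \<exists>N. \<forall>m\<ge>N. \<forall>n\<ge>N. sdist form (f m) (f n) < e)"
  have k: "0 < sqrt \<kappa>" using kappa by simp
  have "\<exists>N. \<forall>m\<ge>N. \<forall>n\<ge>N. norm (f m - f n) < e \<and> norm (d (f m) - d (f n)) < e" if "0 < e" for e
  proof -
    have "0 < sqrt \<kappa> * e" using k that by simp
    then obtain M where M: "\<And>m n. M \<le> m \<Longrightarrow> M \<le> n \<Longrightarrow> sdist form (f m) (f n) < sqrt \<kappa> * e"
      using f by blast
    have "norm (f m - f n) < e \<and> norm (d (f m) - d (f n)) < e" if "M \<le> m" "M \<le> n" for m n
    proof -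
      have "sqrt \<kappa> * norm (d (f m - f n)) < sqrt \<kappa> * e" "sqrt \<kappa> * norm (f m - f n) < sqrt \<kappa> * e"
        using norm_le_form[of "f m - f n"] M[OF that] unfolding sdist_def by linarith+
      then show ?thesis using k f by (simp add: d_diff)
    qed
    then show ?thesis by blast
  qed
  then have "Cauchy f" "Cauchy (\<lambda>n. d (f n))" unfolding Cauchy_def dist_norm by meson+
  then obtain u w where u: "f \<longlonglongrightarrow> u" and w: "(\<lambda>n. d (f n)) \<longlonglongrightarrow> w"
    using Cauchy_convergent convergent_def by metis
  have uG: "u \<in> G" and du: "d u = w" using d_limit[of f] f u w by auto
  have "(\<lambda>n. cinner (d (f n) - w) (Lam (d (f n) - w)) + cinner (f n - u) (lam (f n - u)))
      \<longlonglongrightarrow> cinner (w - w) (Lam (w - w)) + cinner (u - u) (lam (u - u))"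
    by (intro tendsto_intros u w)
  then have "(\<lambda>n. form (f n - u) (f n - u)) \<longlonglongrightarrow> 0"
    using f uG by (simp add: form_def d_diff du)
  then have "(\<lambda>n. sqrt (Re (form (f n - u) (f n - u)))) \<longlonglongrightarrow> sqrt (Re 0)"
    by (intro tendsto_intros)
  then show "\<exists>u\<in>G. (\<lambda>n. sdist form (f n) u) \<longlonglongrightarrow> 0"
    using uG by (auto simp: sdist_def)
qed (use subspace_G in \<open>simp_all add: form_def form_simps algebra_simps\<close>)

text \<open>The weak form of \<open>d\<^sup>* Lam d u - z lam u = g\<close>, stated without
  constructing the adjoint. The factor \<open>lam\<close> next to \<open>z\<close> stems from the
  changed scalar product.\<close>

definition op :: "complex \<Rightarrow> ('h \<times> 'h) set" where
  "op z = {(u, g). u \<in> G \<and>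
     (\<forall>v\<in>G. cinner (d v) (Lam (d u)) - z * cinner v (lam u) = cinner v g)}"

lemma opD:
  assumes "(u, g) \<in> op z"
  shows "u \<in> G" "\<And>v. v \<in> G \<Longrightarrow> cinner (d v) (Lam (d u)) = z * cinner v (lam u) + cinner v g"
  using assms by (auto simp: op_def algebra_simps)

lemma op_add: "(u, f) \<in> op z \<Longrightarrow> (v, g) \<in> op z \<Longrightarrow> (u + v, f + g) \<in> op z"
  by (auto simp: op_def form_simps algebra_simps)

lemma op_scale: "(u, f) \<in> op z \<Longrightarrow> (c *\<^sub>C u, c *\<^sub>C f) \<in> op z"
  by (auto simp: op_def form_simps algebra_simps)

lemma op_diff: "(u, f) \<in> op z \<Longrightarrow> (v, g) \<in> op z \<Longrightarrow> (u - v, f - g) \<in> op z"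
  using op_add[of u f z "- v" "- g"] op_scale[of v g z "- 1"] by (simp add: scaleC_minus_one)

text \<open>Obtained by testing the equation with \<open>u\<close> itself. It makes
  \<open>op z\<close> closed, and it turns bounded solutions with bounded data into sequences
  bounded in the graph norm of \<open>d\<close>.\<close>

lemma norm_d_le:
  assumes "(u, g) \<in> op z"
  shows "norm (d u) \<le> sqrt ((cmod z * norm lam + 1) / \<kappa>) * (norm u + norm g)"
proof -
  have "cinner (d u) (Lam (d u)) = z * cinner u (lam u) + cinner u g"
    using opD[OF assms] by blast
  then have "\<kappa> * (norm (d u))\<^sup>2 \<le> cmod (z * cinner u (lam u) + cinner u g)"
    using Lam_ge[of "d u"] complex_Re_le_cmod order_trans by metis
  also have "\<dots> \<le> cmod z * (norm u * norm (lam u)) + norm u * norm g"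
    by (intro order_trans[OF norm_triangle_ineq] add_mono)
      (auto simp: norm_mult intro!: mult_left_mono cinner_cauchy_schwarz)
  also have "\<dots> \<le> cmod z * (norm u * (norm lam * norm u)) + norm u * norm g"
    by (intro add_right_mono mult_left_mono norm_blinfun) auto
  also have "\<dots> = (cmod z * norm lam) * (norm u)\<^sup>2 + norm u * norm g"
    by (simp add: power2_eq_square)
  also have "\<dots> \<le> (cmod z * norm lam) * (norm u + norm g)\<^sup>2 + (norm u + norm g)\<^sup>2"
    by (intro add_mono mult_left_mono power_mono)
      (auto simp: power2_eq_square intro!: mult_mono)
  finally have "(norm (d u))\<^sup>2 \<le> (cmod z * norm lam + 1) / \<kappa> * (norm u + norm g)\<^sup>2"
    using kappa by (simp add: field_simps)
  then have "sqrt ((norm (d u))\<^sup>2) \<le> sqrt ((cmod z * norm lam + 1) / \<kappa> * (norm u + norm g)\<^sup>2)"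
    by (rule real_sqrt_le_mono)
  then show ?thesis
    unfolding real_sqrt_mult[of "(cmod z * norm lam + 1) / \<kappa>"] by simp
qed

lemma Bseq_d:
  assumes "\<And>n. (u n, g n) \<in> op z" "Bseq u" "Bseq g"
  shows "Bseq (\<lambda>n. d (u n))"
proof -
  obtain A where A: "\<And>n. norm (u n) \<le> A" using assms(2) BseqE by blast
  obtain B where B: "\<And>n. norm (g n) \<le> B" using assms(3) BseqE by blast
  have "norm (d (u n)) \<le> sqrt ((cmod z * norm lam + 1) / \<kappa>) * (A + B)" for n
    using kappa by (intro order_trans[OF norm_d_le[OF assms(1)]] mult_left_mono add_mono A B) auto
  then show ?thesis by (rule BseqI')
qed

lemma closed_linear_relation_op: "closed_linear_relation (op z)"
proof
  show "(0, 0) \<in> op z" by (simp add: op_def G_zero)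
  fix x y :: "nat \<Rightarrow> 'h" and u f
  assume xy: "\<And>n. (x n, y n) \<in> op z" and x: "x \<longlonglongrightarrow> u" and y: "y \<longlonglongrightarrow> f"
  have xG: "x n \<in> G" for n using opD(1)[OF xy] .
  have "Cauchy (\<lambda>n. d (x n))"
    using LIMSEQ_imp_Cauchy[OF x] LIMSEQ_imp_Cauchy[OF y] Cauchy_const
    by (rule Cauchy_dominated[where K = "sqrt ((cmod z * norm lam + 1) / \<kappa>)"])
      (use norm_d_le[OF op_diff[OF xy xy]] xG in \<open>simp add: d_diff\<close>)
  then obtain w where w: "(\<lambda>n. d (x n)) \<longlonglongrightarrow> w"
    using Cauchy_convergent convergent_def by blast
  have uG: "u \<in> G" and du: "d u = w" using d_limit[OF xG x w] by auto
  have "cinner (d v) (Lam (d u)) - z * cinner v (lam u) = cinner v f" if v: "v \<in> G" for v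
  proof -
    have "(\<lambda>n. cinner (d v) (Lam (d (x n))) - z * cinner v (lam (x n))) \<longlonglongrightarrow>
        cinner (d v) (Lam (d u)) - z * cinner v (lam u)"
      unfolding du by (intro tendsto_intros x w)
    moreover have "cinner (d v) (Lam (d (x n))) - z * cinner v (lam (x n)) = cinner v (y n)" for n
      using opD(2)[OF xy v, of n] by simp
    moreover have "(\<lambda>n. cinner v (y n)) \<longlonglongrightarrow> cinner v f" by (intro tendsto_intros y)
    ultimately show ?thesis using LIMSEQ_unique by (metis (no_types, lifting) ext)
  qed
  then show "(u, f) \<in> op z" using uG by (simp add: op_def)
qed (fact op_add op_scale)+

lemma op_minus_one_iff: "(u, h) \<in> op (- 1) \<longleftrightarrow> u \<in> G \<and> (\<forall>v\<in>G. form v u = cinner v h)"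
  by (auto simp: op_def form_def)

lemma op_shift: "(u, g) \<in> op z \<longleftrightarrow> (u, g + (z - z') *\<^sub>C lam u) \<in> op z'"
  by (auto simp: op_def cinner_simps algebra_simps)

text \<open>At \<open>z = - 1\<close> the weak equation is the Riesz equation of the coercive
  product \<open>form\<close>.\<close>

lemma op_minus_one_surj: obtains u where "(u, h) \<in> op (- 1)"
proof -
  interpret F: hilbert_space_on G form by unfold_locales (rule hilbert_on_form)
  have "cmod (cinner u h) \<le> norm h / sqrt \<kappa> * F.N u" for u
  proof -
    have "sqrt \<kappa> * cmod (cinner u h) \<le> norm h * (sqrt \<kappa> * norm u)"
      using mult_left_mono[OF cinner_cauchy_schwarz[of u h], of "sqrt \<kappa>"] kappa by (simp add: mult_ac)
    also have "\<dots> \<le> norm h * F.N u"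
      using norm_le_form(2)[of u] by (simp add: F.N_eq_sqrt mult_left_mono)
    finally show ?thesis using kappa by (simp add: field_simps)
  qed
  from F.riesz_representation[OF subspace_G order_refl cinner_add_left cinner_scaleC_left this]
  obtain w where "w \<in> G" "\<And>v. v \<in> G \<Longrightarrow> form v w = cinner v h" by metis
  then show thesis using that by (auto simp: op_minus_one_iff)
qed

lemma op_minus_one_norm:
  assumes "(v, h) \<in> op (- 1)"
  shows "\<kappa> * norm v \<le> norm h"
proof -
  have "form v v = cinner v h" using assms by (simp add: op_minus_one_iff)
  then have "\<kappa> * (norm v)\<^sup>2 \<le> norm v * norm h"
    using form_ge[of v] Re_cinner_le[of v h] kappa
    by (smt (verit) distrib_left mult_nonneg_nonneg zero_le_power2)
  then have "norm v * (\<kappa> * norm v) \<le> norm v * norm h" by (simp add: power2_eq_square mult_ac)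
  then show ?thesis by (cases "v = 0") auto
qed

text \<open>A regularity statement: \<open>k\<close> is not assumed to lie in \<open>G\<close>. The
  solution \<open>k'\<close> of the equation that \<open>k\<close> ought to satisfy is compared with
  \<open>k\<close> by testing against the solution \<open>v\<close> of \<open>op (- 1)\<close> for
  an arbitrary \<open>h\<close>; symmetry of the form gives \<open>cinner k h = cinner k' h\<close>,
  hence \<open>k = k'\<close>.\<close>

lemma op_adjoint:
  assumes k: "\<And>v g. (v, g) \<in> op z \<Longrightarrow> cinner k g = 0"
  shows "(k, 0) \<in> op (cnj z)"
proof -
  obtain k' where k': "(k', (cnj z + 1) *\<^sub>C lam k) \<in> op (- 1)"
    using op_minus_one_surj by blast
  have "cinner (k - k') h = 0" for h
  proof -
    obtain v where v: "(v, h) \<in> op (- 1)" using op_minus_one_surj by blast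
    have "(v, h + (- 1 - z) *\<^sub>C lam v) \<in> op z" using v op_shift by blast
    then have "cinner k h = (1 + z) * cinner k (lam v)"
      using k by (fastforce simp: cinner_simps algebra_simps)
    moreover have "cinner k' h = form k' v"
      using v k' by (simp add: op_minus_one_iff)
    moreover have "\<dots> = cnj (form v k')" by (simp add: form_def Lam_commute lam_commute)
    moreover have "form v k' = (cnj z + 1) * cinner v (lam k)"
      using v k' by (simp add: op_minus_one_iff cinner_scaleC_right)
    ultimately show ?thesis by (simp add: cinner_diff_left lam_commute algebra_simps)
  qed
  from this[of "k - k'"] have "k' = k" by (simp add: cinner_self)
  with k' op_shift[of k 0 "cnj z" "- 1"] show ?thesis by simp
qed

lemma op_symmetric:
  assumes "(u, f) \<in> op z" "(v, g) \<in> op z" "Im z = 0"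
  shows "cinner f v = cinner u g"
proof -
  have cz: "cnj z = z" using assms(3) by (simp add: complex_eq_iff)
  have "cnj (cinner v f) = cnj (cinner (d v) (Lam (d u)) - z * cinner v (lam u))"
    using opD(2)[OF assms(1) opD(1)[OF assms(2)]] by simp
  also have "\<dots> = cinner u g"
    using opD(2)[OF assms(2) opD(1)[OF assms(1)]] by (simp add: Lam_commute lam_commute cz)
  finally have "cnj (cinner v f) = cinner u g" .
  then show ?thesis by (simp add: cinner_commute[of f v])
qed

text \<open>The imaginary part of the equation tested with \<open>u\<close> reads
  \<open>Im z * Re (cinner u (lam u)) = - Im (cinner u g)\<close>, so \<open>u\<close> is bounded by
  \<open>g\<close> and the whole sequence converges.\<close>

lemma semi_fredholm_nonreal:
  assumes z: "Im z \<noteq> 0"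
  shows "semi_fredholm (op z)"
proof -
  have est: "norm u \<le> 1 / (\<kappa> * \<bar>Im z\<bar>) * norm g" if ug: "(u, g) \<in> op z" for u g
  proof -
    have real: "Im (cinner u (lam u)) = 0" "Im (cinner (d u) (Lam (d u))) = 0"
      using lam_commute[of u u] Lam_commute[of "d u" "d u"] by (simp_all add: complex_eq_iff)
    have "cinner (d u) (Lam (d u)) = z * cinner u (lam u) + cinner u g"
      using opD[OF ug] by blast
    then have "Im z * Re (cinner u (lam u)) = - Im (cinner u g)"
      using real by (simp add: complex_eq_iff)
    then have "\<bar>Im z\<bar> * \<bar>Re (cinner u (lam u))\<bar> = \<bar>Im (cinner u g)\<bar>"
      by (metis abs_minus abs_mult)
    also have "\<dots> \<le> norm u * norm g"
      using abs_Im_le_cmod cinner_cauchy_schwarz order_trans by blast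
    finally have "\<bar>Im z\<bar> * (\<kappa> * (norm u)\<^sup>2) \<le> norm u * norm g"
      using mult_left_mono[OF lam_ge[of u], of "\<bar>Im z\<bar>"] abs_ge_self[of "Re (cinner u (lam u))"]
        mult_left_mono[of "Re (cinner u (lam u))" "\<bar>Re (cinner u (lam u))\<bar>" "\<bar>Im z\<bar>"]
      by simp
    then have "norm u * (\<kappa> * \<bar>Im z\<bar> * norm u) \<le> norm u * norm g"
      by (simp add: power2_eq_square mult_ac)
    then have "\<kappa> * \<bar>Im z\<bar> * norm u \<le> norm g" by (cases "u = 0") auto
    then show ?thesis using z kappa by (simp add: field_simps)
  qed
  show ?thesis
    unfolding semi_fredholm_def
  proof (intro allI impI, elim conjE)
    fix u f assume uf: "\<forall>n::nat. (u n, f n) \<in> op z" and f: "convergent f"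
    have "Cauchy u"
      using f[THEN convergent_Cauchy] Cauchy_const Cauchy_const
      by (rule Cauchy_dominated[where K = "1 / (\<kappa> * \<bar>Im z\<bar>)"]) (use est op_diff uf in simp)
    then have "convergent (u \<circ> id)" by (simp add: Cauchy_convergent)
    moreover have "strict_mono (id :: nat \<Rightarrow> nat)" by (simp add: strict_mono_def)
    ultimately show "\<exists>r. strict_mono r \<and> convergent (u \<circ> r)" by blast
  qed
qed

end

text \<open>With \<open>d = 0\<close> on the whole space, \<open>form\<close> is the weighted scalar
  product and \<open>op (- 1)\<close> is the graph of \<open>lam\<close>: completeness of the former
  and surjectivity of the latter are special cases of the results above.\<close>

lemma weighted_form_trivial:
  assumes "weighted_form G d lam Lam \<kappa>"
  shows "weighted_form UNIV (\<lambda>_. 0) lam Lam \<kappa>"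
proof -
  interpret weighted_form G d lam Lam \<kappa> by fact
  have "op_graph UNIV (\<lambda>_::'a. 0::'b) = UNIV \<times> {0}" by (auto simp: op_graph_def)
  then have "closed_densely_defined UNIV (\<lambda>_::'a. 0::'b)"
    by (simp add: closed_densely_defined_def closed_Times)
  then show ?thesis using lam Lam kappa lam_ge Lam_ge by unfold_locales
qed

section \<open>The weighted scalar product and the Fredholm property\<close>

context weighted_form
begin

lemma hilbert_on_weighted: "hilbert_on UNIV (weighted lam)"
proof -
  note trivial = weighted_form_trivial[OF weighted_form_axioms]
  have "weighted_form.form (\<lambda>_. 0) lam Lam = weighted lam"
    unfolding weighted_form.form_def[OF trivial] weighted_def fun_eq_iff by simp
  then show ?thesis using weighted_form.hilbert_on_form[OF trivial] by simp
qed

lemma lam_lower: "\<kappa> * norm u \<le> norm (lam u)"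
proof -
  have "\<kappa> * (norm u)\<^sup>2 \<le> norm u * norm (lam u)"
    using lam_ge[of u] Re_cinner_le[of u "lam u"] by linarith
  then have "norm u * (\<kappa> * norm u) \<le> norm u * norm (lam u)"
    by (simp add: power2_eq_square mult_ac)
  then show ?thesis by (cases "u = 0") auto
qed

lemma inj_lam: "inj lam"
proof (rule injI)
  fix x y assume "lam x = lam y"
  then have "\<kappa> * norm (x - y) \<le> 0" using lam_lower[of "x - y"] by (simp add: blinfun.diff_right)
  then show "x = y" using kappa by (simp add: mult_le_0_iff)
qed

lemma surj_lam: "surj lam"
proof -
  note trivial = weighted_form_trivial[OF weighted_form_axioms]
  have "\<exists>u. h = lam u" for h
  proof -
    obtain u where "(u, h) \<in> weighted_form.op UNIV (\<lambda>_. 0) lam Lam (- 1)"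
      using weighted_form.op_minus_one_surj[OF trivial] by blast
    then have "cinner v (lam u) = cinner v h" for v
      unfolding weighted_form.op_def[OF trivial] by simp
    then have "cinner (lam u - h) (lam u - h) = 0" by (simp add: cinner_diff_right)
    then show ?thesis by (auto simp: cinner_self)
  qed
  then show ?thesis by (auto simp: surj_def)
qed

lemma closedin_weighted:
  "closedin (Metric_space.mtopology UNIV (sdist (weighted lam))) S \<longleftrightarrow> closed S"
proof -
  interpret W: hilbert_space_on UNIV "weighted lam"
    by unfold_locales (rule hilbert_on_weighted)
  interpret M: Metric_space UNIV "sdist (weighted lam)"
  proof
    show "0 \<le> sdist (weighted lam) x y" for x y by (simp add: W.sdist_eq_N W.N_nonneg)
    show "sdist (weighted lam) x y = sdist (weighted lam) y x" for x y
      by (simp add: W.sdist_eq_N W.N_minus_commute)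
    show "(sdist (weighted lam) x y = 0) = (x = y)" for x y
      using W.N_pos[of "x - y"] by (cases "x = y") (auto simp: W.sdist_eq_N)
    show "sdist (weighted lam) x z \<le> sdist (weighted lam) x y + sdist (weighted lam) y z" for x y z
      using W.N_triangle[of "x - y" "y - z"] by (simp add: W.sdist_eq_N)
  qed
  \<comment> \<open>The two norms are equivalent, with constants \<open>sqrt \<kappa>\<close> and
    \<open>L\<close>; the summand 1 makes \<open>L\<close> positive, so that radii can be divided by
    it.\<close>
  define L where "L = sqrt (norm lam) + 1"
  have L: "0 < L" by (simp add: L_def add_nonneg_pos)
  have k: "0 < sqrt \<kappa>" using kappa by simp
  have lower: "sqrt \<kappa> * dist x y \<le> sdist (weighted lam) x y" for x y
    using real_sqrt_le_mono[OF lam_ge[of "x - y"]]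
    by (simp add: sdist_def weighted_def real_sqrt_mult dist_norm)
  have upper: "sdist (weighted lam) x y \<le> L * dist x y" for x y
  proof -
    have "Re (cinner (x - y) (lam (x - y))) \<le> norm (x - y) * (norm lam * norm (x - y))"
      using Re_cinner_le[of "x - y" "lam (x - y)"] mult_left_mono[OF norm_blinfun[of lam "x - y"]]
        order_trans by (metis norm_ge_zero)
    also have "\<dots> = norm lam * (norm (x - y))\<^sup>2" by (simp add: power2_eq_square)
    finally have "sdist (weighted lam) x y \<le> sqrt (norm lam * (norm (x - y))\<^sup>2)"
      unfolding sdist_def weighted_def by (rule real_sqrt_le_mono)
    also have "\<dots> \<le> L * dist x y"
      by (simp add: real_sqrt_mult dist_norm L_def distrib_right)
    finally show ?thesis .
  qed
  have "openin M.mtopology U \<longleftrightarrow> open U" for U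
  proof -
    have "(\<exists>r>0. M.mball x r \<subseteq> U) \<longleftrightarrow> (\<exists>r>0. ball x r \<subseteq> U)" for x
    proof safe
      fix r :: real assume r: "0 < r" "M.mball x r \<subseteq> U"
      have "ball x (r / L) \<subseteq> M.mball x r"
      proof
        fix y assume "y \<in> ball x (r / L)"
        then have "L * dist x y < r" using L by (simp add: field_simps)
        then show "y \<in> M.mball x r" using upper[of x y] by simp
      qed
      then show "\<exists>r>0. ball x r \<subseteq> U" using r L by (intro exI[of _ "r / L"]) auto
    next
      fix r :: real assume r: "0 < r" "ball x r \<subseteq> U"
      have "M.mball x (sqrt \<kappa> * r) \<subseteq> ball x r"
      proof
        fix y assume "y \<in> M.mball x (sqrt \<kappa> * r)"
        then have "sqrt \<kappa> * dist x y < sqrt \<kappa> * r" using lower[of x y] by simp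
        then show "y \<in> ball x r" using k by simp
      qed
      then show "\<exists>r>0. M.mball x r \<subseteq> U" using r k by (intro exI[of _ "sqrt \<kappa> * r"]) auto
    qed
    then show ?thesis unfolding M.openin_mtopology open_contains_ball by blast
  qed
  then show ?thesis by (simp add: closedin_def closed_def Compl_eq_Diff_UNIV)
qed

text \<open>The kernels agree and the ranges correspond under the homeomorphism \<open>lam\<close>.
  A complement of the range is found in the kernel of \<open>op (cnj z)\<close>, which is
  finite-dimensional: for real \<open>z\<close> this is the same operator, and for other
  \<open>z\<close> it has the compactness property anyway.\<close>

lemma fredholm_iff_semi_fredholm:
  "fredholm (weighted lam) ((\<lambda>(u, f). (u, f - z *\<^sub>C u)) `
     form_operator (weighted lam) G (\<lambda>v u. weighted Lam (d v) (d u))) \<longleftrightarrow> semi_fredholm (op z)"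
  (is "fredholm _ ?A \<longleftrightarrow> _")
proof -
  interpret T: closed_linear_relation "op z" by (rule closed_linear_relation_op)
  \<comment> \<open>A weighted pairing with \<open>g\<close> is an ordinary pairing with
    \<open>lam g\<close>.\<close>
  have A: "(u, g) \<in> ?A \<longleftrightarrow> (u, lam g) \<in> op z" for u g
  proof -
    have "(u, g) \<in> ?A \<longleftrightarrow> (u, g + z *\<^sub>C u) \<in>
        form_operator (weighted lam) G (\<lambda>v u. weighted Lam (d v) (d u))"
      by (force simp: image_iff)
    also have "\<dots> \<longleftrightarrow> (u, lam g) \<in> op z"
      by (auto simp: form_operator_def op_def weighted_def form_simps algebra_simps)
    finally show ?thesis .
  qed
  have kerA: "{u. (u, 0) \<in> ?A} = T.ker" unfolding A by (simp add: T.ker_def)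
  have ranA: "Range ?A = lam -` Range (op z)" by (simp only: set_eq_iff Range_iff vimage_eq A simp_thms)
  have ran_op: "Range (op z) = lam ` Range ?A" by (simp only: ranA surj_image_vimage_eq[OF surj_lam])
  show ?thesis
  proof
    assume fr: "fredholm (weighted lam) ?A"
    show "semi_fredholm (op z)"
    proof (cases "Im z = 0")
      case False
      then show ?thesis by (rule semi_fredholm_nonreal)
    next
      case True
      then have cz: "cnj z = z" by (simp add: complex_eq_iff)
      have "closed (lam ` Range ?A)"
        unfolding closed_sequential_limits
      proof (intro allI impI, elim conjE)
        fix y l assume y: "\<forall>n. y n \<in> lam ` Range ?A" "y \<longlonglongrightarrow> l"
        then obtain x where x: "\<And>n. x n \<in> Range ?A" "\<And>n. y n = lam (x n)" by (meson imageE)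
        have "norm (x m - x n) \<le> 1 / \<kappa> * norm (y m - y n)" for m n
          using lam_lower[of "x m - x n"] kappa by (simp add: x(2) blinfun.diff_right field_simps)
        then have "Cauchy x"
          by (intro Cauchy_dominated[OF LIMSEQ_imp_Cauchy[OF y(2)] Cauchy_const Cauchy_const,
                where K = "1 / \<kappa>"]) simp
        then obtain X where X: "x \<longlonglongrightarrow> X" using Cauchy_convergent convergent_def by blast
        have "closed (Range ?A)" using fr closedin_weighted unfolding fredholm_def by blast
        then have "X \<in> Range ?A" using x(1) X closed_sequentially by blast
        moreover have "y \<longlonglongrightarrow> lam X" unfolding x(2)[abs_def] by (intro tendsto_intros X)
        then have "l = lam X" using y(2) LIMSEQ_unique by blast
        ultimately show "l \<in> lam ` Range ?A" by blast
      qed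
      moreover obtain B where "finite B" "T.ker \<subseteq> complex_vector.span B"
        using fr unfolding fredholm_def kerA by blast
      ultimately show ?thesis
        using op_symmetric[OF _ _ True] op_adjoint[of z, unfolded cz] unfolding ran_op[symmetric]
        by (intro T.semi_fredholmI) (auto simp: T.ker_def)
    qed
  next
    assume sf: "semi_fredholm (op z)"
    have "semi_fredholm (op (cnj z))"
    proof (cases "Im z = 0")
      case True
      then have "cnj z = z" by (simp add: complex_eq_iff)
      then show ?thesis using sf by simp
    qed (simp add: semi_fredholm_nonreal)
    interpret T': closed_linear_relation "op (cnj z)" by (rule closed_linear_relation_op)
    obtain B' where B': "finite B'" "T'.ker \<subseteq> complex_vector.span B'"
      using T'.semi_fredholm_ker[OF \<open>semi_fredholm (op (cnj z))\<close>] by blast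
    \<comment> \<open>\<open>B'\<close> spans a space containing the orthogonal complement of the
      range of \<open>op z\<close>; pulled back by \<open>lam\<close> it yields a complement for the
      range of the original operator.\<close>
    define B where "B = lam -` B'"
    have cl: "closed (Range (op z))" by (rule T.semi_fredholm_closed_Range[OF sf])
    have "closed (Range ?A)"
      unfolding ranA using cl
      by (rule closed_vimage) (rule linear_continuous_on[OF blinfun.bounded_linear_right])
    moreover have "finite B" unfolding B_def using B'(1) inj_lam by (rule finite_vimageI)
    moreover have "h \<in> complex_vector.span (Range ?A \<union> B)" for h
    proof -
      have sub: "complex_vector.subspace (lam ` complex_vector.span B)"
      proof (rule complex_vector.subspaceI)
        show "0 \<in> lam ` complex_vector.span B"
          using complex_vector.span_zero by (metis blinfun.zero_right image_eqI)
        show "x + y \<in> lam ` complex_vector.span B"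
          if "x \<in> lam ` complex_vector.span B" "y \<in> lam ` complex_vector.span B" for x y
          using that
          by (auto simp: blinfun.add_right[symmetric] intro!: imageI complex_vector.span_add)
        show "c *\<^sub>C x \<in> lam ` complex_vector.span B" if "x \<in> lam ` complex_vector.span B" for c x
          using that by (auto simp: lam_scale[symmetric] intro!: imageI complex_vector.span_scale)
      qed
      have "B' \<subseteq> lam ` complex_vector.span B"
      proof
        fix b assume "b \<in> B'"
        moreover obtain x where "b = lam x" using surj_lam by (rule surjE)
        ultimately show "b \<in> lam ` complex_vector.span B"
          by (auto simp: B_def complex_vector.span_base)
      qed
      then have B'': "complex_vector.span B' \<subseteq> lam ` complex_vector.span B"
        using sub by (rule complex_vector.span_minimal)
      obtain p where p: "p \<in> Range (op z)" "\<And>g. g \<in> Range (op z) \<Longrightarrow> cinner g (lam h - p) = 0"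
        using orthogonal_projection[OF T.subspace_Range cl] by blast
      have "(lam h - p, 0) \<in> op (cnj z)"
        using p(2) cinner_commute[of "lam h - p"] by (intro op_adjoint) (metis Range.intros complex_cnj_zero)
      then obtain b where b: "b \<in> complex_vector.span B" "lam h - p = lam b"
        using B'(2) B'' by (auto simp: T'.ker_def)
      then have "h - b \<in> Range ?A"
        using p(1) unfolding ranA by (simp add: blinfun.diff_right) (metis add_diff_cancel_left' diff_add_cancel)
      then have "h - b \<in> complex_vector.span (Range ?A \<union> B)"
        by (simp add: complex_vector.span_base)
      moreover have "b \<in> complex_vector.span (Range ?A \<union> B)"
        using b(1) complex_vector.span_mono[of B "Range ?A \<union> B"] by blast
      ultimately have "(h - b) + b \<in> complex_vector.span (Range ?A \<union> B)"
        by (rule complex_vector.span_add)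
      then show ?thesis by simp
    qed
    ultimately show "fredholm (weighted lam) ?A"
      unfolding fredholm_def closedin_weighted kerA using T.semi_fredholm_ker[OF sf] by blast
  qed
qed

end

text \<open>
  If \<open>T\<^sub>1 u = g\<close> then \<open>v = (T\<^sub>2 + (z + 1) lam2)\<inverse> (z + 1) lam2 u\<close> is an approximate solution
  for \<open>T\<^sub>2\<close>: by coercivity, \<open>v - u\<close> is controlled by \<open>g\<close> and the two perturbation terms. The perturbation of
  \<open>Lam\<close> may be evaluated either at \<open>u\<close> or at \<open>v\<close>.
\<close>

theorem semi_fredholm_transfer:
  assumes F1: "weighted_form G d lam1 Lam1 \<kappa>1" and F2: "weighted_form G d lam2 Lam2 \<kappa>2"
    and sf: "semi_fredholm (weighted_form.op G d lam2 Lam2 z)"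
    and comp: "\<And>u g v. (\<And>n::nat. (u n, g n) \<in> weighted_form.op G d lam1 Lam1 z) \<Longrightarrow>
      Bseq u \<Longrightarrow> Bseq g \<Longrightarrow> Bseq v \<Longrightarrow>
      (\<And>n. (v n, (z + 1) *\<^sub>C lam2 (u n)) \<in> weighted_form.op G d lam2 Lam2 (- 1)) \<Longrightarrow>
      \<exists>r y. strict_mono r \<and> (y = u \<or> y = v) \<and> Cauchy (\<lambda>n. lam2 (u (r n)) - lam1 (u (r n))) \<and>
        Cauchy (\<lambda>n. Lam2 (d (y (r n))) - Lam1 (d (y (r n))))"
  shows "semi_fredholm (weighted_form.op G d lam1 Lam1 z)"
  unfolding semi_fredholm_def
proof (intro allI impI, elim conjE)
  interpret F1: weighted_form G d lam1 Lam1 \<kappa>1 by fact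
  interpret F2: weighted_form G d lam2 Lam2 \<kappa>2 by fact
  fix u g
  assume ug: "\<forall>n::nat. (u n, g n) \<in> F1.op z" and u: "Bseq u" and g: "convergent g"
  have "\<exists>v. (v, (z + 1) *\<^sub>C lam2 (u n)) \<in> F2.op (- 1)" for n
    using F2.op_minus_one_surj by blast
  then obtain v where v: "\<And>n. (v n, (z + 1) *\<^sub>C lam2 (u n)) \<in> F2.op (- 1)" by metis
  obtain K where K: "\<And>n. norm (u n) \<le> K" using u BseqE by blast
  have "norm (v n) \<le> cmod (z + 1) * (norm lam2 * K) / \<kappa>2" for n
  proof -
    have "\<kappa>2 * norm (v n) \<le> cmod (z + 1) * norm (lam2 (u n))"
      using F2.op_minus_one_norm[OF v] by (simp add: norm_scaleC)
    also have "\<dots> \<le> cmod (z + 1) * (norm lam2 * K)"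
      using norm_blinfun[of lam2 "u n"] mult_left_mono[OF K[of n], of "norm lam2"]
      by (intro mult_left_mono) auto
    finally show ?thesis using F2.kappa by (simp add: field_simps)
  qed
  then have Bv: "Bseq v" by (rule BseqI')
  from comp[OF ug[rule_format] u convergent_imp_Bseq[OF g] Bv v]
  obtain r y where r: "strict_mono r" and y: "y = u \<or> y = v"
    and Cq: "Cauchy (\<lambda>n. lam2 (u (r n)) - lam1 (u (r n)))"
    and Cp: "Cauchy (\<lambda>n. Lam2 (d (y (r n))) - Lam1 (d (y (r n))))"
    by blast
  define q where "q n = lam2 (u (r n)) - lam1 (u (r n))" for n
  define p where "p n = Lam2 (d (y (r n))) - Lam1 (d (y (r n)))" for n
  define w where "w n = v (r n) - u (r n)" for n
  define \<kappa> where "\<kappa> = min \<kappa>1 \<kappa>2"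
  have \<kappa>: "0 < \<kappa>" using F1.kappa F2.kappa by (simp add: \<kappa>_def)
  have uG: "u n \<in> G" and vG: "v n \<in> G" for n using F1.opD(1)[of "u n"] ug F2.opD(1)[OF v] by blast+
  then have wG: "w n \<in> G" for n by (simp add: w_def F1.G_diff)
  \<comment> \<open>Evaluating the perturbation at \<open>u\<close> leaves \<open>Lam2\<close> in
    front of \<open>d (v - u)\<close>, evaluating it at \<open>v\<close> leaves \<open>Lam1\<close>;
    the minimum \<open>\<kappa>\<close> serves both cases.\<close>
  define L where "L = (if y = u then Lam2 else Lam1)"
  have L: "\<kappa> * (norm x)\<^sup>2 \<le> Re (cinner x (L x))" for x
    using F1.Lam_ge[of x] F2.Lam_ge[of x] mult_right_mono[of \<kappa> \<kappa>1 "(norm x)\<^sup>2"]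
      mult_right_mono[of \<kappa> \<kappa>2 "(norm x)\<^sup>2"]
    by (auto simp: L_def \<kappa>_def)
  have lam: "\<kappa> * (norm x)\<^sup>2 \<le> Re (cinner x (lam2 x))" for x
    using F2.lam_ge[of x] mult_right_mono[of \<kappa> \<kappa>2 "(norm x)\<^sup>2"] by (auto simp: \<kappa>_def)
  \<comment> \<open>The difference of the two weak equations. The coefficient of \<open>q\<close> is
    \<open>z\<close> because
    \<open>(z + 1) lam2 u - lam2 u - z lam1 u = z (lam2 - lam1) u\<close>.\<close>
  have eq: "cinner (d x) (L (d (w n))) + cinner x (lam2 (w n)) =
      - cinner (d x) (p n) + z * cinner x (q n) - cinner x (g (r n))" if x: "x \<in> G" for x n
  proof -
    have 1: "cinner (d x) (Lam2 (d (v (r n)))) + cinner x (lam2 (v (r n))) =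
        (z + 1) * cinner x (lam2 (u (r n)))"
      using F2.opD(2)[OF v x, of "r n"] by (simp add: cinner_scaleC_right)
    have 2: "cinner (d x) (Lam1 (d (u (r n)))) = z * cinner x (lam1 (u (r n))) + cinner x (g (r n))"
      using F1.opD(2)[OF ug[rule_format] x] by blast
    have "cinner (d x) (L (d (w n))) = cinner (d x) (Lam2 (d (v (r n)))) -
        cinner (d x) (Lam1 (d (u (r n)))) - cinner (d x) (p n)"
      using y by (auto simp: L_def w_def p_def uG vG F1.form_simps)
    with 1 2 show ?thesis
      by (simp add: w_def q_def F1.form_simps algebra_simps)
  qed
  have dw: "norm (w m - w n) \<le> 2 / \<kappa> * (1 + cmod z) *
      (norm (p m - p n) + norm (q m - q n) + norm (g (r m) - g (r n)))" for m n
  proof -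
    define e where "e = w m - w n"
    have eG: "e \<in> G" by (simp add: e_def wG F1.G_diff)
    have "cinner (d e) (L (d e)) + cinner e (lam2 e) =
        (cinner (d e) (L (d (w m))) + cinner e (lam2 (w m))) -
        (cinner (d e) (L (d (w n))) + cinner e (lam2 (w n)))"
      using wG by (subst (2 4) e_def) (simp add: F1.form_simps algebra_simps)
    also have "\<dots> = - cinner (d e) (p m - p n) +
        z * cinner e (q m - q n) - cinner e (g (r m) - g (r n))"
      unfolding eq[OF eG] by (simp add: cinner_simps algebra_simps)
    finally have "Re (cinner (d e) (L (d e))) + Re (cinner e (lam2 e)) =
        Re (- cinner (d e) (p m - p n) + z * cinner e (q m - q n) - cinner e (g (r m) - g (r n)))"
      by (metis plus_complex.sel(1))
    also have "\<dots> \<le> cmod (cinner (d e) (p m - p n)) + cmod z * cmod (cinner e (q m - q n)) +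
        cmod (cinner e (g (r m) - g (r n)))"
      by (intro order_trans[OF complex_Re_le_cmod] order_trans[OF norm_triangle_ineq4] add_mono
          order_trans[OF norm_triangle_ineq]) (auto simp: norm_mult)
    also have "\<dots> \<le> norm (d e) * norm (p m - p n) + cmod z * (norm e * norm (q m - q n)) +
        norm e * norm (g (r m) - g (r n))"
      by (intro add_mono mult_left_mono cinner_cauchy_schwarz) auto
    finally have "\<kappa> * ((norm (d e))\<^sup>2 + (norm e)\<^sup>2) \<le> norm (d e) * norm (p m - p n) +
        norm e * (cmod z * norm (q m - q n) + norm (g (r m) - g (r n)))"
      using L[of "d e"] lam[of e] by (simp add: distrib_left mult_ac)
    then have 1: "norm (d e) + norm e \<le> 2 / \<kappa> *
        (norm (p m - p n) + (cmod z * norm (q m - q n) + norm (g (r m) - g (r n))))"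
      using \<kappa> by (intro quadratic_bound) auto
    have "norm e \<le> norm (d e) + norm e" by simp
    also note 1
    also have "2 / \<kappa> * (norm (p m - p n) + (cmod z * norm (q m - q n) + norm (g (r m) - g (r n))))
      \<le> 2 / \<kappa> * ((1 + cmod z) *
        (norm (p m - p n) + norm (q m - q n) + norm (g (r m) - g (r n))))"
      using \<kappa> by (intro mult_left_mono) (auto simp: algebra_simps intro!: add_increasing2)
    finally show ?thesis unfolding e_def by (simp only: mult.assoc)
  qed
  have Cg: "Cauchy (\<lambda>n. g (r n))"
    using convergent_subseq_convergent[OF g r] convergent_Cauchy by (simp add: comp_def)
  have "Cauchy p" "Cauchy q" using Cp Cq by (simp_all only: p_def[abs_def] q_def[abs_def])
  from Cauchy_dominated[OF this Cg dw] have "Cauchy w" .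
  then obtain W where W: "w \<longlonglongrightarrow> W" using Cauchy_convergent convergent_def by blast
  \<comment> \<open>Moving from parameter \<open>- 1\<close> to \<open>z\<close> leaves a right-hand
    side that involves only \<open>w\<close>, hence converges; this is what makes \<open>sf\<close>
    applicable to \<open>v\<close>, and \<open>u = v - w\<close> follows.\<close>
  have "(v (r n), - (z + 1) *\<^sub>C lam2 (w n)) \<in> F2.op z" for n
  proof -
    have "- (z + 1) *\<^sub>C lam2 (w n) = (- 1 - z) *\<^sub>C (lam2 (v (r n)) - lam2 (u (r n)))"
      by (simp add: w_def blinfun.diff_right)
    also have "\<dots> = - ((- 1 - z) *\<^sub>C lam2 (u (r n))) + (- 1 - z) *\<^sub>C lam2 (v (r n))"
      by (simp add: complex_vector.scale_right_diff_distrib)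
    also have "- ((- 1 - z) *\<^sub>C lam2 (u (r n))) = (- (- 1 - z)) *\<^sub>C lam2 (u (r n))"
      by (rule complex_vector.scale_minus_left[symmetric])
    also have "- (- 1 - z) = z + 1" by simp
    finally have eq: "- (z + 1) *\<^sub>C lam2 (w n) =
      (z + 1) *\<^sub>C lam2 (u (r n)) + (- 1 - z) *\<^sub>C lam2 (v (r n))" .
    show ?thesis unfolding eq using v F2.op_shift by blast
  qed
  moreover have "convergent (\<lambda>n. - (z + 1) *\<^sub>C lam2 (w n))"
    by (rule convergentI[where L = "- (z + 1) *\<^sub>C lam2 W"]) (intro tendsto_intros W)
  moreover have "Bseq (\<lambda>n. v (r n))" using Bv by (rule Bseq_subseq)
  ultimately obtain r' where r': "strict_mono r'" "convergent ((\<lambda>n. v (r n)) \<circ> r')"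
    using semi_fredholmD[OF sf, of "\<lambda>n. v (r n)" "\<lambda>n. - (z + 1) *\<^sub>C lam2 (w n)"] by blast
  then obtain V where V: "((\<lambda>n. v (r n)) \<circ> r') \<longlonglongrightarrow> V" by (auto simp: convergent_def)
  have "(\<lambda>n. ((\<lambda>n. v (r n)) \<circ> r') n - (w \<circ> r') n) \<longlonglongrightarrow> V - W"
    using V LIMSEQ_subseq_LIMSEQ[OF W r'(1)] by (rule tendsto_diff)
  then have "(u \<circ> (r \<circ> r')) \<longlonglongrightarrow> V - W" by (simp add: w_def comp_def)
  then show "\<exists>r. strict_mono r \<and> convergent (u \<circ> r)"
    using strict_mono_comp[OF r r'(1)] convergentI by blast
qed

section \<open>Hilbert modules\<close>

lemma C0_I:
  assumes "continuous_on UNIV \<phi>"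
    and "\<And>e. 0 < e \<Longrightarrow> \<exists>K. compact K \<and> (\<forall>x. x \<notin> K \<longrightarrow> cmod (\<phi> x) < e)"
  shows "\<phi> \<in> C0"
  using assms by (simp add: C0_def)

lemma C0_continuous: "\<phi> \<in> C0 \<Longrightarrow> continuous_on UNIV \<phi>"
  by (simp add: C0_def)

lemma C0_small:
  assumes "\<phi> \<in> C0" "0 < e"
  obtains K where "compact K" "\<And>x. x \<notin> K \<Longrightarrow> cmod (\<phi> x) < e"
  using assms unfolding C0_def by blast

lemma C0_add:
  assumes "\<phi> \<in> C0" "\<psi> \<in> C0"
  shows "(\<lambda>x. \<phi> x + \<psi> x) \<in> C0"
proof (rule C0_I)
  show "continuous_on UNIV (\<lambda>x. \<phi> x + \<psi> x)"
    using assms by (intro continuous_intros C0_continuous)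
  fix e :: real assume e: "0 < e"
  obtain K where K: "compact K" "\<And>x. x \<notin> K \<Longrightarrow> cmod (\<phi> x) < e / 2"
    using C0_small[OF assms(1) half_gt_zero[OF e]] by blast
  obtain L where L: "compact L" "\<And>x. x \<notin> L \<Longrightarrow> cmod (\<psi> x) < e / 2"
    using C0_small[OF assms(2) half_gt_zero[OF e]] by blast
  have "cmod (\<phi> x + \<psi> x) < e" if "x \<notin> K \<union> L" for x
    using K(2)[of x] L(2)[of x] that norm_triangle_ineq[of "\<phi> x" "\<psi> x"] by simp
  then show "\<exists>K. compact K \<and> (\<forall>x. x \<notin> K \<longrightarrow> cmod (\<phi> x + \<psi> x) < e)"
    using K L compact_Un by blast
qed

lemma C0_mult:
  assumes "\<phi> \<in> C0" "\<psi> \<in> C0"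
  shows "(\<lambda>x. \<phi> x * \<psi> x) \<in> C0"
proof (rule C0_I)
  show "continuous_on UNIV (\<lambda>x. \<phi> x * \<psi> x)"
    using assms by (intro continuous_intros C0_continuous)
  fix e :: real assume e: "0 < e"
  then have s: "0 < sqrt e" by simp
  obtain K where K: "compact K" "\<And>x. x \<notin> K \<Longrightarrow> cmod (\<phi> x) < sqrt e"
    using C0_small[OF assms(1) s] by blast
  obtain L where L: "compact L" "\<And>x. x \<notin> L \<Longrightarrow> cmod (\<psi> x) < sqrt e"
    using C0_small[OF assms(2) s] by blast
  have "cmod (\<phi> x * \<psi> x) < e" if "x \<notin> K \<union> L" for x
    using mult_strict_mono'[OF K(2)[of x] L(2)[of x]] that e by (simp add: norm_mult)
  then show "\<exists>K. compact K \<and> (\<forall>x. x \<notin> K \<longrightarrow> cmod (\<phi> x * \<psi> x) < e)"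
    using K L compact_Un by blast
qed

lemma C0_cmult:
  assumes "\<phi> \<in> C0"
  shows "(\<lambda>x. c * \<phi> x) \<in> C0"
proof (rule C0_I)
  show "continuous_on UNIV (\<lambda>x. c * \<phi> x)"
    using assms by (intro continuous_intros C0_continuous)
  fix e :: real assume e: "0 < e"
  have c: "0 < cmod c + 1" by (simp add: add_nonneg_pos)
  obtain K where K: "compact K" "\<And>x. x \<notin> K \<Longrightarrow> cmod (\<phi> x) < e / (cmod c + 1)"
    using C0_small[OF assms divide_pos_pos[OF e c]] by blast
  have "cmod (c * \<phi> x) < e" if "x \<notin> K" for x
  proof -
    have "cmod (c * \<phi> x) \<le> (cmod c + 1) * cmod (\<phi> x)"
      by (simp add: norm_mult distrib_right)
    also have "\<dots> < e" using K(2)[OF that] c by (simp add: field_simps)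
    finally show ?thesis .
  qed
  then show "\<exists>K. compact K \<and> (\<forall>x. x \<notin> K \<longrightarrow> cmod (c * \<phi> x) < e)" using K by blast
qed

lemma C0_cnj:
  assumes "\<phi> \<in> C0"
  shows "(\<lambda>x. cnj (\<phi> x)) \<in> C0"
  using assms by (simp add: C0_def continuous_on_cnj)

lemma C0_bounded:
  assumes "\<phi> \<in> C0"
  obtains M where "0 \<le> M" "\<And>x. cmod (\<phi> x) \<le> M"
proof -
  obtain K where K: "compact K" "\<And>x. x \<notin> K \<Longrightarrow> cmod (\<phi> x) < 1"
    using C0_small[OF assms zero_less_one] by blast
  have "compact (\<phi> ` K)"
    using K(1) C0_continuous[OF assms] by (meson compact_continuous_image continuous_on_subset subset_UNIV)
  then obtain B where B: "\<And>x. x \<in> K \<Longrightarrow> cmod (\<phi> x) \<le> B"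
    using compact_imp_bounded bounded_iff by (metis imageI)
  have "cmod (\<phi> x) \<le> max B 1" for x
    using B[of x] K(2)[of x] by (cases "x \<in> K") auto
  then show thesis using that[of "max B 1"] by auto
qed

lemma abs_sqrt_diff_le:
  assumes "0 \<le> a" "0 \<le> b"
  shows "\<bar>sqrt a - sqrt b\<bar> \<le> sqrt \<bar>a - b\<bar>"
proof (rule real_le_rsqrt)
  have "\<bar>sqrt a - sqrt b\<bar>\<^sup>2 \<le> \<bar>sqrt a - sqrt b\<bar> * (sqrt a + sqrt b)"
    using assms unfolding power2_eq_square by (intro mult_left_mono) (auto simp: abs_le_iff)
  also have "\<dots> = \<bar>(sqrt a - sqrt b) * (sqrt a + sqrt b)\<bar>"
    using assms by (simp add: abs_mult)
  also have "\<dots> = \<bar>a - b\<bar>" using assms by (simp add: algebra_simps)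
  finally show "\<bar>sqrt a - sqrt b\<bar>\<^sup>2 \<le> \<bar>a - b\<bar>" .
qed

section \<open>Positivity of the morphism and the canonical extension\<close>

locale module_morphism =
  fixes Q :: "('x::metric_space \<Rightarrow> complex) \<Rightarrow> ('h::complex_hilbert \<Rightarrow>\<^sub>L 'h)"
  assumes module: "hilbert_module Q"
begin

lemma Q_add: "\<phi> \<in> C0 \<Longrightarrow> \<psi> \<in> C0 \<Longrightarrow> Q (\<lambda>x. \<phi> x + \<psi> x) u = Q \<phi> u + Q \<psi> u"
  and Q_cmult: "\<phi> \<in> C0 \<Longrightarrow> Q (\<lambda>x. c * \<phi> x) u = c *\<^sub>C Q \<phi> u"
  and Q_mult: "\<phi> \<in> C0 \<Longrightarrow> \<psi> \<in> C0 \<Longrightarrow> Q (\<lambda>x. \<phi> x * \<psi> x) u = Q \<phi> (Q \<psi> u)"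
  and Q_bounded: "\<phi> \<in> C0 \<Longrightarrow> Q \<phi> \<in> bounded_ops"
  and Q_cnj: "\<phi> \<in> C0 \<Longrightarrow> cinner (Q (\<lambda>x. cnj (\<phi> x)) u) v = cinner u (Q \<phi> v)"
  using module unfolding hilbert_module_def
  by (simp_all add: blinfun.add_left scaleC_blinfun.rep_eq)

lemma Q_diff:
  assumes "\<phi> \<in> C0" "\<psi> \<in> C0"
  shows "Q (\<lambda>x. \<phi> x - \<psi> x) u = Q \<phi> u - Q \<psi> u"
  using Q_add[OF assms(1) C0_cmult[OF assms(2)], of "- 1" u] Q_cmult[OF assms(2), of "- 1" u]
  by (simp add: scaleC_minus_one)

text \<open>
  The function \<open>\<theta> = sqrt (\<epsilon> + g) - sqrt \<epsilon>\<close> vanishes at infinity, although \<open>sqrt (\<epsilon> + g)\<close> does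
  not, and \<open>(sqrt \<epsilon> + \<theta>(Q))\<^sup>2 = \<epsilon> + g(Q)\<close>.
\<close>

lemma Q_lower_bound:
  assumes g: "(\<lambda>x. complex_of_real (g x)) \<in> C0" and e: "0 \<le> \<epsilon>" and ge: "\<And>x. - \<epsilon> \<le> g x"
  shows "- \<epsilon> * (norm u)\<^sup>2 \<le> Re (cinner u (Q (\<lambda>x. complex_of_real (g x)) u))"
proof -
  define \<theta> where "\<theta> x = sqrt (\<epsilon> + g x) - sqrt \<epsilon>" for x
  define t where "t x = complex_of_real (\<theta> x)" for x
  have "continuous_on UNIV g"
    using continuous_on_Re[OF C0_continuous[OF g]] by simp
  have t: "t \<in> C0"
  proof (rule C0_I)
    show "continuous_on UNIV t"
      unfolding t_def \<theta>_def by (intro continuous_intros \<open>continuous_on UNIV g\<close>)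
    fix e :: real assume "0 < e"
    then have "0 < e\<^sup>2" by simp
    from C0_small[OF g this]
    obtain K where K: "compact K" "\<And>x. x \<notin> K \<Longrightarrow> cmod (complex_of_real (g x)) < e\<^sup>2"
      by blast
    have "cmod (t x) < e" if "x \<notin> K" for x
    proof -
      have "0 \<le> \<epsilon> + g x" using ge[of x] by linarith
      then have "\<bar>sqrt (\<epsilon> + g x) - sqrt \<epsilon>\<bar> \<le> sqrt \<bar>g x\<bar>"
        using abs_sqrt_diff_le[of "\<epsilon> + g x" \<epsilon>] e by simp
      also have "\<dots> < sqrt (e\<^sup>2)" using K(2)[OF that] by (intro real_sqrt_less_mono) simp
      finally show ?thesis using \<open>0 < e\<close> unfolding t_def \<theta>_def norm_of_real by simp
    qed
    then show "\<exists>K. compact K \<and> (\<forall>x. x \<notin> K \<longrightarrow> cmod (t x) < e)" using K by blast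
  qed
  define c where "c = complex_of_real (sqrt \<epsilon>)"
  have "complex_of_real (g x) = t x * t x + 2 * c * t x" for x
  proof -
    have "(sqrt (\<epsilon> + g x))\<^sup>2 = \<epsilon> + g x" "(sqrt \<epsilon>)\<^sup>2 = \<epsilon>" using e ge[of x] by simp_all
    then have eq: "g x = \<theta> x * \<theta> x + 2 * sqrt \<epsilon> * \<theta> x"
      by (simp add: \<theta>_def algebra_simps power2_eq_square)
    show ?thesis
      unfolding t_def c_def eq by (simp only: of_real_add of_real_mult of_real_numeral)
  qed
  then have "(\<lambda>x. complex_of_real (g x)) = (\<lambda>x. t x * t x + 2 * c * t x)" by (rule ext)
  then have Qg: "Q (\<lambda>x. complex_of_real (g x)) u = Q t (Q t u) + (2 * c) *\<^sub>C Q t u"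
    by (simp add: Q_add C0_mult C0_cmult t Q_mult Q_cmult)
  have ct: "(\<lambda>x. cnj (t x)) = t" by (simp add: t_def fun_eq_iff)
  have tt: "cinner u (Q t (Q t u)) = cinner (Q t u) (Q t u)"
    using Q_cnj[OF t, of u "Q t u"] ct by simp
  have "(norm (Q t u + c *\<^sub>C u))\<^sup>2 = (norm (Q t u))\<^sup>2 + \<epsilon> * (norm u)\<^sup>2 + 2 * sqrt \<epsilon> * Re (cinner u (Q t u))"
    using cinner.N_square_add[of "Q t u" "c *\<^sub>C u"] e
    by (simp add: norm_scaleC c_def power_mult_distrib cinner_scaleC_left mult.assoc)
  moreover have "0 \<le> (norm (Q t u + c *\<^sub>C u))\<^sup>2" by simp
  moreover have "Re (cinner u (Q (\<lambda>x. complex_of_real (g x)) u)) =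
      (norm (Q t u))\<^sup>2 + 2 * sqrt \<epsilon> * Re (cinner u (Q t u))"
    unfolding Qg by (simp add: cinner_simps tt cinner_self c_def mult.assoc)
  ultimately show ?thesis by linarith
qed

text \<open>Positivity applied to \<epsilon> + g - |\<phi>|^2. The constant \<epsilon> stays outside
  the morphism as a multiple of the identity, so that only functions vanishing at infinity are
  inserted.\<close>

lemma norm_Q_le:
  assumes phi: "\<phi> \<in> C0" and g: "(\<lambda>x. complex_of_real (g x)) \<in> C0" and e: "0 \<le> \<epsilon>"
    and le: "\<And>x. (cmod (\<phi> x))\<^sup>2 \<le> \<epsilon> + g x"
  shows "(norm (Q \<phi> u))\<^sup>2 \<le> \<epsilon> * (norm u)\<^sup>2 + Re (cinner u (Q (\<lambda>x. complex_of_real (g x)) u))"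
proof -
  define q where "q x = cnj (\<phi> x) * \<phi> x" for x
  have q: "q \<in> C0" unfolding q_def by (intro C0_mult C0_cnj phi)
  have q_eq: "q x = complex_of_real ((cmod (\<phi> x))\<^sup>2)" for x
    unfolding q_def by (metis complex_norm_square mult.commute)
  have diff: "(\<lambda>x. complex_of_real (g x - (cmod (\<phi> x))\<^sup>2)) = (\<lambda>x. complex_of_real (g x) - q x)"
    by (simp add: q_eq fun_eq_iff)
  have "(\<lambda>x. complex_of_real (g x) - q x) \<in> C0"
    using C0_add[OF g C0_cmult[OF q, of "- 1"]] by simp
  then have "- \<epsilon> * (norm u)\<^sup>2 \<le> Re (cinner u (Q (\<lambda>x. complex_of_real (g x) - q x) u))"
    using Q_lower_bound[of "\<lambda>x. g x - (cmod (\<phi> x))\<^sup>2" \<epsilon> u] e le unfolding diff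
    by (smt (verit))
  moreover have "cinner u (Q q u) = complex_of_real ((norm (Q \<phi> u))\<^sup>2)"
  proof -
    have "cinner u (Q q u) = cinner u (Q (\<lambda>x. cnj (\<phi> x)) (Q \<phi> u))"
      unfolding q_def by (simp add: Q_mult C0_cnj phi)
    also have "\<dots> = cinner (Q \<phi> u) (Q \<phi> u)"
      using Q_cnj[OF C0_cnj[OF phi], of u "Q \<phi> u"] by simp
    finally show ?thesis by (simp add: cinner_self)
  qed
  ultimately show ?thesis by (simp add: Q_diff[OF g q] cinner_diff_right)
qed

text \<open>The cutoffs used below vanish at infinity, so the extension in the first order condition
  can be replaced by \<open>Q\<close> itself. Uniqueness rests on the density of the vectors
  \<open>Q \<psi> u\<close>.\<close>

lemma extend_C0:
  assumes phi: "\<phi> \<in> C0"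
  shows "extend Q \<phi> = Q \<phi>"
  unfolding extend_def
proof (rule the_equality)
  show "Q \<phi> \<in> bounded_ops \<and> (\<forall>\<psi>\<in>C0. Q \<phi> o\<^sub>L Q \<psi> = Q (\<lambda>x. \<phi> x * \<psi> x))"
    using module phi unfolding hilbert_module_def by auto
  fix T assume T: "T \<in> bounded_ops \<and> (\<forall>\<psi>\<in>C0. T o\<^sub>L Q \<psi> = Q (\<lambda>x. \<phi> x * \<psi> x))"
  define S where "S = {x. T x = Q \<phi> x}"
  have "complex_vector.subspace S"
  proof (rule complex_vector.subspaceI)
    show "c *\<^sub>C x \<in> S" if "x \<in> S" for c x
      using that T Q_bounded[OF phi] by (simp add: S_def bounded_ops_scaleC)
  qed (simp_all add: S_def blinfun.add_right)
  moreover have "{Q \<psi> u |\<psi> u. \<psi> \<in> C0} \<subseteq> S"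
  proof safe
    fix \<psi> u assume psi: "\<psi> \<in> (C0 :: ('x \<Rightarrow> complex) set)"
    then have "T (Q \<psi> u) = Q (\<lambda>x. \<phi> x * \<psi> x) u" using T by (metis blinfun_apply_blinfun_compose)
    then show "Q \<psi> u \<in> S" by (simp add: S_def Q_mult phi psi)
  qed
  ultimately have "complex_vector.span {Q \<psi> u |\<psi> u. \<psi> \<in> C0} \<subseteq> S"
    by (intro complex_vector.span_minimal)
  moreover have "closed S"
    unfolding S_def by (intro closed_Collect_eq continuous_intros)
  ultimately have "closure (complex_vector.span {Q \<psi> u |\<psi> u. \<psi> \<in> C0}) \<subseteq> S"
    by (rule closure_minimal)
  then have "S = UNIV" using module unfolding hilbert_module_def by auto
  then show "T = Q \<phi>" by (auto simp: S_def intro: blinfun_eqI)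
qed

text \<open>For bounded \<open>w\<close> the operators mapping \<open>w\<close> to a Cauchy sequence
  form a norm-closed subspace, and it contains all products of a bounded operator after a
  multiplier.\<close>

lemma B0_Cauchy:
  assumes S: "S \<in> B0 Q" and w: "Bseq w" and cau: "\<And>\<phi>. \<phi> \<in> C0 \<Longrightarrow> Cauchy (\<lambda>n. Q \<phi> (w n))"
  shows "Cauchy (\<lambda>n. S (w n))"
proof (rule CauchyI)
  define P where "P = {S :: 'h \<Rightarrow>\<^sub>L 'h. Cauchy (\<lambda>n. S (w n))}"
  have "complex_vector.subspace P"
  proof (rule complex_vector.subspaceI)
    show "0 \<in> P" by (simp add: P_def Cauchy_const)
    show "A + B \<in> P" if "A \<in> P" "B \<in> P" for A B
      using that by (simp add: P_def blinfun.add_left Cauchy_convergent_iff convergent_add)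
    show "c *\<^sub>C A \<in> P" if "A \<in> P" for c A
      using that bounded_linear.Cauchy[OF bounded_linear_scaleC]
      by (simp add: P_def scaleC_blinfun.rep_eq)
  qed
  moreover have "{T o\<^sub>L M |M T. M \<in> multiplier_algebra Q \<and> T \<in> bounded_ops} \<subseteq> P"
  proof safe
    fix T M assume "M \<in> multiplier_algebra Q"
    then obtain \<phi> where "\<phi> \<in> C0" "M = Q \<phi>" by (auto simp: multiplier_algebra_def)
    then show "T o\<^sub>L M \<in> P"
      using bounded_linear.Cauchy[OF blinfun.bounded_linear_right[of T] cau]
      by (simp add: P_def)
  qed
  ultimately have span: "complex_vector.span {T o\<^sub>L M |M T. M \<in> multiplier_algebra Q \<and> T \<in> bounded_ops} \<subseteq> P"
    by (rule complex_vector.span_minimal[rotated])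
  obtain K where K: "0 < K" "\<And>n. norm (w n) \<le> K" using w BseqE by blast
  fix e :: real assume e: "0 < e"
  have "S \<in> closure (complex_vector.span {T o\<^sub>L M |M T. M \<in> multiplier_algebra Q \<and> T \<in> bounded_ops})"
    using S by (simp add: B0_def)
  moreover have "0 < e / (3 * K)" using e K by simp
  ultimately obtain A where A: "A \<in> P" "norm (A - S) < e / (3 * K)"
    using span unfolding closure_approachable dist_norm by blast
  have close: "norm (S (w n) - A (w n)) \<le> e / 3" for n
  proof -
    have "norm ((A - S) (w n)) \<le> e / (3 * K) * K"
      using norm_blinfun[of "A - S" "w n"] A(2) K mult_mono[of "norm (A - S)" "e / (3 * K)" "norm (w n)" K] e
      by simp
    then show ?thesis using K by (simp add: blinfun.diff_left norm_minus_commute)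
  qed
  have "0 < e / 3" using e by simp
  then obtain M where M: "\<And>m n. M \<le> m \<Longrightarrow> M \<le> n \<Longrightarrow> norm (A (w m) - A (w n)) < e / 3"
    using A(1) CauchyD[of "\<lambda>n. A (w n)"] unfolding P_def by blast
  have "norm (S (w m) - S (w n)) < e" if "M \<le> m" "M \<le> n" for m n
  proof -
    have eq: "S (w m) - S (w n) = (S (w m) - A (w m)) + (A (w m) - A (w n)) - (S (w n) - A (w n))"
      by simp
    have "norm (S (w m) - S (w n)) \<le>
        norm (S (w m) - A (w m)) + norm (A (w m) - A (w n)) + norm (S (w n) - A (w n))"
      using norm_triangle_ineq4[of "(S (w m) - A (w m)) + (A (w m) - A (w n))" "S (w n) - A (w n)"]
        norm_triangle_ineq[of "S (w m) - A (w m)" "A (w m) - A (w n)"]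
      by (subst eq) linarith
    then show ?thesis using close[of m] close[of n] M[OF that] by linarith
  qed
  then show "\<exists>M. \<forall>m\<ge>M. \<forall>n\<ge>M. norm (S (w m) - S (w n)) < e" by blast
qed

end

section \<open>Slowly varying functions and first order operators\<close>

text \<open>The cutoff has Lipschitz constant at most 1/R and is comparable with the one for R = 1:
  for R \<ge> 1 it lies between \<open>slow x0 1\<close> and \<open>R * slow x0 1\<close>. Being
  strictly positive, it dominates on every bounded set a positive constant.\<close>

definition slow :: "'x::metric_space \<Rightarrow> real \<Rightarrow> 'x \<Rightarrow> real" where
  "slow x0 R x = R / (R + dist x x0)"

lemma slow_pos: "0 < R \<Longrightarrow> 0 < slow x0 R x"
  by (simp add: slow_def add_pos_nonneg)

lemma slow_le_1: "0 < R \<Longrightarrow> slow x0 R x \<le> 1"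
  by (simp add: slow_def add_pos_nonneg divide_le_eq_1)

lemma slow_lipschitz:
  assumes "0 < R"
  shows "\<bar>slow x0 R x - slow x0 R y\<bar> \<le> 1 / R * dist x y"
proof -
  have p: "0 < R + dist x x0" "0 < R + dist y x0" using assms by (simp_all add: add_pos_nonneg)
  have "slow x0 R x - slow x0 R y = R * (dist y x0 - dist x x0) / ((R + dist x x0) * (R + dist y x0))"
    using p by (simp add: slow_def diff_frac_eq algebra_simps)
  then have "\<bar>slow x0 R x - slow x0 R y\<bar> =
      R * \<bar>dist y x0 - dist x x0\<bar> / ((R + dist x x0) * (R + dist y x0))"
    using p assms by (simp add: abs_mult)
  also have "\<dots> \<le> R * dist x y / (R * R)"
  proof (rule frac_le)
    have "\<bar>dist y x0 - dist x x0\<bar> \<le> dist x y"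
      using dist_triangle[of y x0 x] dist_triangle[of x x0 y] by (simp add: dist_commute abs_le_iff)
    then show "R * \<bar>dist y x0 - dist x x0\<bar> \<le> R * dist x y" using assms by simp
    show "R * R \<le> (R + dist x x0) * (R + dist y x0)" using assms by (intro mult_mono) auto
  qed (use assms in auto)
  also have "\<dots> = 1 / R * dist x y" using assms by simp
  finally show ?thesis .
qed

lemma slow_C0:
  assumes "\<forall>(x::'x::metric_space) r. compact (cball x r)" "0 < R"
  shows "(\<lambda>x::'x. complex_of_real (slow x0 R x)) \<in> C0"
proof (rule C0_I)
  have "R + dist x x0 \<noteq> 0" for x using assms(2) by (smt (verit) zero_le_dist)
  then show "continuous_on UNIV (\<lambda>x. complex_of_real (slow x0 R x))"
    unfolding slow_def by (intro continuous_intros) auto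
  fix e :: real assume e: "0 < e"
  have "cmod (complex_of_real (slow x0 R x)) < e" if "x \<notin> cball x0 (R / e)" for x
  proof -
    have "R / e < dist x x0" using that by (simp add: dist_commute)
    then have "R < e * dist x x0" using e by (simp add: field_simps)
    also have "\<dots> \<le> e * (R + dist x x0)" using e assms(2) by simp
    finally have "slow x0 R x < e"
      using assms(2) by (simp add: slow_def divide_less_eq add_pos_nonneg)
    then show ?thesis using slow_pos[OF assms(2), of x0 x] by simp
  qed
  then show "\<exists>K. compact K \<and> (\<forall>x. x \<notin> K \<longrightarrow> cmod (complex_of_real (slow x0 R x)) < e)"
    using assms(1) by blast
qed

lemma lip_slow:
  fixes x0 :: "'x::metric_space"
  assumes "0 < R" "\<not> compact (UNIV :: 'x set)"
  shows "0 \<le> lip (\<lambda>x. complex_of_real (slow x0 R x))" "lip (\<lambda>x. complex_of_real (slow x0 R x)) \<le> 1 / R"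
proof -
  define q where "q = (\<lambda>(x, y). cmod (complex_of_real (slow x0 R x) - complex_of_real (slow x0 R y)) / dist x y)"
  have lip: "lip (\<lambda>x. complex_of_real (slow x0 R x)) = (SUP p\<in>{(x, y). x \<noteq> y}. q p)"
    unfolding lip_def q_def by (simp add: case_prod_unfold)
  \<comment> \<open>\<open>lip\<close> is a supremum over pairs of distinct points; non-compactness
    supplies such a pair, so the supremum is over a nonempty set.\<close>
  have "\<exists>x::'x. x \<noteq> x0"
  proof (rule ccontr)
    assume "\<not> ?thesis"
    then have "(UNIV :: 'x set) = {x0}" by auto
    then show False using assms(2) by (metis compact_sing)
  qed
  then obtain x1 :: 'x where x1: "x1 \<noteq> x0" by blast
  have le: "q p \<le> 1 / R" if "p \<in> {(x, y). x \<noteq> y}" for p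
    using that slow_lipschitz[OF assms(1), of x0 "fst p" "snd p"]
    by (auto simp: q_def divide_le_eq of_real_diff[symmetric] simp del: of_real_diff)
  show "lip (\<lambda>x. complex_of_real (slow x0 R x)) \<le> 1 / R"
    unfolding lip using x1 le by (intro cSUP_least) auto
  have "0 \<le> q (x1, x0)" by (simp add: q_def)
  then show "0 \<le> lip (\<lambda>x. complex_of_real (slow x0 R x))"
    unfolding lip using x1 le by (intro cSUP_upper2[of q _ "(x1, x0)"]) (auto intro!: bdd_aboveI2)
qed

text \<open>
  The slowly varying functions enter through
  \<open>\<langle>d y, \<chi>\<^sub>R(Q) d y\<rangle> = \<langle>d\<^sup>* d y, \<chi>\<^sub>R(Q) y\<rangle> + O(1 / R)\<close>. As \<open>\<chi>\<^sub>R \<ge> \<chi>\<^sub>1\<close> for \<open>R \<ge> 1\<close>, the error is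
  removed by letting \<open>R\<close> tend to infinity.
\<close>

theorem first_order_Cauchy:
  fixes QH :: "('x::metric_space \<Rightarrow> complex) \<Rightarrow> ('h::complex_hilbert \<Rightarrow>\<^sub>L 'h)"
    and QK :: "('x \<Rightarrow> complex) \<Rightarrow> ('k::complex_hilbert \<Rightarrow>\<^sub>L 'k)"
  assumes noncompact: "\<not> compact (UNIV :: 'x set)" and balls: "\<forall>(x::'x) r. compact (cball x r)"
    and H: "hilbert_module QH" and K: "hilbert_module QK"
    and d: "first_order_operator QH QK G d"
    and y: "\<And>n::nat. y n \<in> G" and f: "\<And>n v. v \<in> G \<Longrightarrow> cinner (f n) v = cinner (d (y n)) (d v)"
    and By: "Bseq y" and Bf: "Bseq f" and Bd: "Bseq (\<lambda>n. d (y n))"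
    and cau: "Cauchy (\<lambda>n. QH (\<lambda>x. complex_of_real (slow x0 1 x)) (y n))"
    and phi: "\<phi> \<in> C0"
  shows "Cauchy (\<lambda>n. QK \<phi> (d (y n)))"
proof -
  interpret H: module_morphism QH by unfold_locales fact
  interpret K: module_morphism QK by unfold_locales fact
  define X where "X R = (\<lambda>x. complex_of_real (slow x0 R x))" for R
  have X: "X R \<in> C0" if "0 < R" for R unfolding X_def using slow_C0[OF balls that] .
  have cdd: "closed_densely_defined G d" using d by (simp add: first_order_operator_def)
  then have G: "complex_vector.subspace G"
    and d_add: "\<And>u v. u \<in> G \<Longrightarrow> v \<in> G \<Longrightarrow> d (u + v) = d u + d v"
    unfolding closed_densely_defined_def by blast+
  have G_diff: "u - v \<in> G" if "u \<in> G" "v \<in> G" for u v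
    using complex_vector.subspace_diff[OF G that] .
  have d_diff: "d (u - v) = d u - d v" if "u \<in> G" "v \<in> G" for u v
    using d_add[OF G_diff[OF that] that(2)] by simp
  from d obtain C :: real where C: "\<forall>\<phi>. bounded (range \<phi>) \<and> (\<exists>L. L-lipschitz_on UNIV \<phi>) \<longrightarrow>
        (\<forall>(u, w)\<in>op_adjoint (op_graph G d). \<forall>v\<in>G.
           cmod (cinner w (extend QH \<phi> v) - cinner u (extend QK \<phi> (d v)))
             \<le> C * lip \<phi> * norm u * norm v)"
    unfolding first_order_operator_def by blast
  have comm: "cmod (cinner w (QH (X R) v) - cinner u (QK (X R) (d v))) \<le> \<bar>C\<bar> / R * (norm u * norm v)"
    if R: "0 < R" and uw: "(u, w) \<in> op_adjoint (op_graph G d)" and v: "v \<in> G" for R u w v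
  proof -
    have "bounded (range (X R))"
      using slow_le_1[OF R, of x0] slow_pos[OF R, of x0] unfolding bounded_iff
      by (intro exI[of _ 1]) (auto simp: X_def abs_of_pos)
    moreover have "(1 / R)-lipschitz_on UNIV (X R)"
      using slow_lipschitz[OF R] R
      by (intro lipschitz_onI) (auto simp: X_def dist_norm of_real_diff[symmetric] simp del: of_real_diff)
    ultimately have "cmod (cinner w (extend QH (X R) v) - cinner u (extend QK (X R) (d v)))
        \<le> C * lip (X R) * norm u * norm v"
      using C uw v by blast
    also have "\<dots> \<le> \<bar>C\<bar> * (1 / R) * norm u * norm v"
      using lip_slow[OF R noncompact, of x0] unfolding X_def
      by (intro mult_right_mono mult_mono) auto
    finally show ?thesis
      by (simp add: H.extend_C0 K.extend_C0 X R mult.assoc)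
  qed
  obtain Cy where Cy: "0 < Cy" "\<And>n. norm (y n) \<le> Cy" using By BseqE by blast
  obtain Cf where Cf: "0 < Cf" "\<And>n. norm (f n) \<le> Cf" using Bf BseqE by blast
  obtain Cd where Cd: "0 < Cd" "\<And>n. norm (d (y n)) \<le> Cd" using Bd BseqE by blast
  define e where "e m n = y m - y n" for m n
  have eG: "e m n \<in> G" for m n by (simp add: e_def y G_diff)
  have de: "d (e m n) = d (y m) - d (y n)" for m n by (simp add: e_def y d_diff)
  have ne: "norm (e m n) \<le> 2 * Cy" for m n
    using norm_triangle_ineq4[of "y m" "y n"] Cy(2)[of m] Cy(2)[of n] by (simp add: e_def)
  have nf: "norm (f m - f n) \<le> 2 * Cf" for m n
    using norm_triangle_ineq4[of "f m" "f n"] Cf(2)[of m] Cf(2)[of n] by simp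
  have nd: "norm (d (e m n)) \<le> 2 * Cd" for m n
    using norm_triangle_ineq4[of "d (y m)" "d (y n)"] Cd(2)[of m] Cd(2)[of n] by (simp add: de)
  \<comment> \<open>\<open>d (e m n)\<close> lies in the domain of the adjoint, with image
    \<open>f m - f n\<close>; this makes it an admissible left argument in the first order
    condition.\<close>
  have adj: "(d (e m n), f m - f n) \<in> op_adjoint (op_graph G d)" for m n
    by (auto simp: op_adjoint_def op_graph_def cinner_diff_left f de)
  define E where "E m n = Re (cinner (d (e m n)) (QK (X 1) (d (e m n))))" for m n
  \<comment> \<open>The first term is the commutator error, small for large \<open>R\<close>
    uniformly in \<open>m\<close> and \<open>n\<close>; the second tends to 0 in \<open>m\<close>,
    \<open>n\<close> for each fixed \<open>R\<close>.\<close>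
  have E_le: "E m n \<le> \<bar>C\<bar> / R * (2 * Cd * (2 * Cy)) + 2 * Cf * (R * norm (QH (X 1) (e m n)))"
    if R: "1 \<le> R" for R m n
  proof -
    have R0: "0 < R" using R by simp
    have X1R: "slow x0 1 x \<le> slow x0 R x" "slow x0 R x \<le> R * slow x0 1 x" for x
    proof -
      have t: "0 < 1 + dist x x0" "0 < R + dist x x0" using R by (simp_all add: add_pos_nonneg)
      have "1 * dist x x0 \<le> R * dist x x0" using R by (rule mult_right_mono) simp
      then show "slow x0 1 x \<le> slow x0 R x" using t by (simp add: slow_def field_simps)
      have "R / (R + dist x x0) \<le> R / (1 + dist x x0)" using R t by (intro divide_left_mono) auto
      then show "slow x0 R x \<le> R * slow x0 1 x" by (simp add: slow_def)
    qed
    have "E m n \<le> Re (cinner (d (e m n)) (QK (X R) (d (e m n))))"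
    proof -
      have g: "(\<lambda>x. complex_of_real (slow x0 R x - slow x0 1 x)) = (\<lambda>x. X R x - X 1 x)"
        by (simp add: X_def fun_eq_iff)
      have "(\<lambda>x. X R x - X 1 x) \<in> C0"
        using C0_add[OF X[OF R0] C0_cmult[OF X[of 1], of "- 1"]] by simp
      then have "0 \<le> Re (cinner (d (e m n)) (QK (\<lambda>x. X R x - X 1 x) (d (e m n))))"
        using K.Q_lower_bound[of "\<lambda>x. slow x0 R x - slow x0 1 x" 0] X1R(1) unfolding g by simp
      then show ?thesis
        using K.Q_diff[OF X[OF R0] X[of 1]] by (simp add: E_def cinner_diff_right)
    qed
    also have "\<dots> \<le> cmod (cinner (f m - f n) (QH (X R) (e m n)) -
        cinner (d (e m n)) (QK (X R) (d (e m n)))) + cmod (cinner (f m - f n) (QH (X R) (e m n)))"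
      by (smt (verit) complex_Re_le_cmod norm_minus_commute norm_triangle_ineq2)
    also have "\<dots> \<le> \<bar>C\<bar> / R * (norm (d (e m n)) * norm (e m n)) +
        norm (f m - f n) * norm (QH (X R) (e m n))"
      using comm[OF R0 adj eG] cinner_cauchy_schwarz by (intro add_mono)
    also have "\<dots> \<le> \<bar>C\<bar> / R * (2 * Cd * (2 * Cy)) + 2 * Cf * (R * norm (QH (X 1) (e m n)))"
    proof (intro add_mono mult_left_mono mult_mono nd ne nf)
      \<comment> \<open>The pointwise bound \<open>slow x0 R x \<le> R * slow x0 1 x\<close> is
        carried over to norms by \<open>norm_Q_le\<close>, with the square of its right-hand side as
        majorant.\<close>
      have sq: "(\<lambda>x. complex_of_real (R\<^sup>2 * (slow x0 1 x)\<^sup>2)) = (\<lambda>x. complex_of_real (R\<^sup>2) * (X 1 x * X 1 x))"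
        by (simp add: X_def fun_eq_iff power2_eq_square)
      have X11: "(\<lambda>x. X 1 x * X 1 x) \<in> C0" using C0_mult X[of 1] by simp
      have "(norm (QH (X R) (e m n)))\<^sup>2 \<le> 0 * (norm (e m n))\<^sup>2 +
          Re (cinner (e m n) (QH (\<lambda>x. complex_of_real (R\<^sup>2 * (slow x0 1 x)\<^sup>2)) (e m n)))"
      proof (rule H.norm_Q_le[OF X[OF R0]])
        show "(\<lambda>x. complex_of_real (R\<^sup>2 * (slow x0 1 x)\<^sup>2)) \<in> C0"
          unfolding sq by (rule C0_cmult[OF X11])
        show "(cmod (X R x))\<^sup>2 \<le> 0 + R\<^sup>2 * (slow x0 1 x)\<^sup>2" for x
          using power_mono[OF X1R(2)[of x], of 2] slow_pos[OF R0, of x0 x]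
          by (simp add: X_def power_mult_distrib)
      qed simp
      also have "\<dots> = R\<^sup>2 * Re (cinner (e m n) (QH (X 1) (QH (X 1) (e m n))))"
        unfolding sq by (simp add: H.Q_cmult[OF X11] H.Q_mult X cinner_scaleC_right)
      also have "cinner (e m n) (QH (X 1) (QH (X 1) (e m n))) =
          cinner (QH (X 1) (e m n)) (QH (X 1) (e m n))"
      proof -
        have "(\<lambda>x. cnj (X 1 x)) = X 1" by (simp add: X_def)
        then show ?thesis using H.Q_cnj[of "X 1" "e m n" "QH (X 1) (e m n)"] X[of 1] by simp
      qed
      finally have "(norm (QH (X R) (e m n)))\<^sup>2 \<le> (R * norm (QH (X 1) (e m n)))\<^sup>2"
        by (simp add: cinner_self power_mult_distrib)
      then show "norm (QH (X R) (e m n)) \<le> R * norm (QH (X 1) (e m n))"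
        by (rule power2_le_imp_le) (use R0 in simp)
    qed (use R0 Cd(1) Cf(1) in auto)
    finally show ?thesis .
  qed
  have E_small: "\<exists>M. \<forall>m\<ge>M. \<forall>n\<ge>M. E m n < t" if t: "0 < t" for t
  proof -
    define A where "A = \<bar>C\<bar> * (2 * Cd * (2 * Cy))"
    have A: "0 \<le> A" using Cd(1) Cy(1) by (simp add: A_def)
    \<comment> \<open>\<open>A / R\<close> is the commutator error; this value puts it below
      \<open>t / 2\<close> and keeps \<open>1 \<le> R\<close>. The indices are taken large only
      afterwards, since the remaining term carries a factor \<open>R\<close>.\<close>
    define R where "R = 2 * A / t + 1"
    have R: "1 \<le> R" using A t by (simp add: R_def)
    have "A / R < t / 2"
    proof -
      have "2 * A < t * R" using t by (simp add: R_def distrib_left)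
      then show ?thesis using R by (simp add: field_simps)
    qed
    moreover have "0 < t / (4 * Cf * R)" using t R Cf(1) by simp
    then obtain M where M: "\<And>m n. M \<le> m \<Longrightarrow> M \<le> n \<Longrightarrow>
        norm (QH (X 1) (y m) - QH (X 1) (y n)) < t / (4 * Cf * R)"
      using CauchyD[OF cau] unfolding X_def by blast
    have "2 * Cf * (R * norm (QH (X 1) (e m n))) < t / 2" if "M \<le> m" "M \<le> n" for m n
      using M[OF that] R Cf(1) t by (simp add: e_def blinfun.diff_right field_simps)
    ultimately have "E m n < t" if "M \<le> m" "M \<le> n" for m n
      using E_le[OF R, of m n] that by (fastforce simp: A_def)
    then show ?thesis by blast
  qed
  obtain B where B: "0 \<le> B" "\<And>x. cmod (\<phi> x) \<le> B" using C0_bounded[OF phi] by blast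
  show ?thesis
  proof (rule CauchyI)
    fix t :: real assume t: "0 < t"
    \<comment> \<open>With \<open>norm (d (e m n)) \<le> 2 * Cd\<close>, the contribution of
      \<epsilon> to the squared norm is at most \<open>t\<^sup>2 / 2\<close>.\<close>
    define \<epsilon> where "\<epsilon> = t\<^sup>2 / (2 * (2 * Cd)\<^sup>2)"
    have eps: "0 < \<epsilon>" using t Cd(1) by (simp add: \<epsilon>_def)
    then have "0 < sqrt \<epsilon>" by simp
    from C0_small[OF phi this]
    obtain S where S: "compact S" "\<And>x. x \<notin> S \<Longrightarrow> cmod (\<phi> x) < sqrt \<epsilon>"
      by blast
    obtain \<rho> where rho: "\<And>x. x \<in> S \<Longrightarrow> dist x0 x \<le> \<rho>"
      using compact_imp_bounded[OF S(1)] bounded_any_center by blast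
    \<comment> \<open>On \<open>S\<close> one has
      \<open>1 \<le> (1 + \<bar>\<rho>\<bar>) * slow x0 1 x\<close>. The absolute value covers an
      empty \<open>S\<close>, where \<rho> may be negative.\<close>
    define c where "c = B\<^sup>2 * (1 + \<bar>\<rho>\<bar>)"
    have c: "0 \<le> c" by (simp add: c_def)
    have le: "(cmod (\<phi> x))\<^sup>2 \<le> \<epsilon> + c * slow x0 1 x" for x
    proof (cases "x \<in> S")
      case False
      then have "(cmod (\<phi> x))\<^sup>2 \<le> (sqrt \<epsilon>)\<^sup>2" using S(2)[of x] by (intro power_mono) auto
      then show ?thesis using eps c slow_pos[of 1 x0 x] by (simp add: add_increasing2)
    next
      case True
      have "1 \<le> (1 + \<bar>\<rho>\<bar>) * slow x0 1 x"
        using rho[OF True] by (simp add: slow_def add_pos_nonneg dist_commute)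
      then have "B\<^sup>2 * 1 \<le> B\<^sup>2 * ((1 + \<bar>\<rho>\<bar>) * slow x0 1 x)" by (rule mult_left_mono) simp
      moreover have "(cmod (\<phi> x))\<^sup>2 \<le> B\<^sup>2" using B by (intro power_mono) auto
      ultimately show ?thesis using eps by (simp add: c_def mult.assoc)
    qed
    have cX: "(\<lambda>x. complex_of_real (c * slow x0 1 x)) = (\<lambda>x. complex_of_real c * X 1 x)"
      by (simp add: X_def)
    have est: "(norm (QK \<phi> (d (e m n))))\<^sup>2 \<le> t\<^sup>2 / 2 + c * E m n" for m n
    proof -
      have "(norm (QK \<phi> (d (e m n))))\<^sup>2 \<le> \<epsilon> * (norm (d (e m n)))\<^sup>2 +
          Re (cinner (d (e m n)) (QK (\<lambda>x. complex_of_real (c * slow x0 1 x)) (d (e m n))))"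
        by (rule K.norm_Q_le[OF phi _ less_imp_le[OF eps] le]) (simp only: cX C0_cmult X zero_less_one)
      also have "\<dots> = \<epsilon> * (norm (d (e m n)))\<^sup>2 + c * E m n"
        unfolding cX by (simp add: K.Q_cmult X cinner_scaleC_right E_def)
      also have "\<dots> \<le> \<epsilon> * (2 * Cd)\<^sup>2 + c * E m n"
        using nd eps by (intro add_right_mono mult_left_mono power_mono) auto
      also have "\<epsilon> * (2 * Cd)\<^sup>2 = t\<^sup>2 / 2" using Cd(1) by (simp add: \<epsilon>_def)
      finally show ?thesis .
    qed
    have "0 < t\<^sup>2 / (2 * (c + 1))" using t c by simp
    then obtain M where M: "\<And>m n. M \<le> m \<Longrightarrow> M \<le> n \<Longrightarrow> E m n < t\<^sup>2 / (2 * (c + 1))"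
      using E_small by blast
    have "norm (QK \<phi> (d (y m)) - QK \<phi> (d (y n))) < t" if "M \<le> m" "M \<le> n" for m n
    proof -
      have "c * E m n \<le> c * (t\<^sup>2 / (2 * (c + 1)))" using M[OF that] c by (intro mult_left_mono) auto
      also have "\<dots> < t\<^sup>2 / 2" using t c by (simp add: field_simps)
      finally have "(norm (QK \<phi> (d (e m n))))\<^sup>2 < t\<^sup>2" using est[of m n] by linarith
      then have "norm (QK \<phi> (d (e m n))) < t" using t by (simp add: power2_less_imp_less)
      then show ?thesis by (simp add: de blinfun.diff_right)
    qed
    then show "\<exists>M. \<forall>m\<ge>M. \<forall>n\<ge>M. norm (QK \<phi> (d (y m)) - QK \<phi> (d (y n))) < t" by blast
  qed
qed

section \<open>Stability of the essential spectrum\<close>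

text \<open>\<open>op_inf T\<close> is infinite on the zero space, so a real constant strictly
  between 0 and it is taken; normalising \<open>u\<close> extends the bound from unit
  vectors.\<close>

lemma op_inf_lower_bound:
  assumes T: "selfadjoint_bounded T" and pos: "0 < op_inf T"
  obtains \<kappa> where "0 < \<kappa>" "\<And>u. \<kappa> * (norm u)\<^sup>2 \<le> Re (cinner u (T u))"
proof -
  obtain \<kappa> where k: "0 < ereal \<kappa>" "ereal \<kappa> < op_inf T" using ereal_dense2[OF pos] by blast
  have unit: "\<kappa> \<le> Re (cinner u (T u))" if "norm u = 1" for u
  proof -
    have "op_inf T \<le> ereal (Re (cinner u (T u)))"
      unfolding op_inf_def using that by (intro INF_lower) simp
    then show ?thesis using k(2) by (metis ereal_less_eq(3) less_imp_le order_trans)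
  qed
  have "\<kappa> * (norm u)\<^sup>2 \<le> Re (cinner u (T u))" for u
  proof (cases "u = 0")
    case False
    define c where "c = complex_of_real (1 / norm u)"
    have "norm (c *\<^sub>C u) = 1" using False by (simp add: norm_scaleC c_def norm_divide)
    moreover have "T (c *\<^sub>C u) = c *\<^sub>C T u"
      using T by (simp add: selfadjoint_bounded_def bounded_ops_scaleC)
    then have "cinner (c *\<^sub>C u) (T (c *\<^sub>C u)) = cnj c * (c * cinner u (T u))"
      by (simp only: cinner_scaleC_left cinner_scaleC_right mult.left_commute)
    ultimately have "\<kappa> \<le> Re (cnj c * (c * cinner u (T u)))"
      using unit[of "c *\<^sub>C u"] by (simp only:)
    also have "cnj c * (c * cinner u (T u)) = complex_of_real (1 / (norm u)\<^sup>2) * cinner u (T u)"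
      by (simp add: c_def power2_eq_square)
    finally show ?thesis using False by (simp add: field_simps)
  qed (simp add: cinner_simps)
  then show thesis using that k(1) by simp
qed

lemma compact_restriction_Cauchy:
  assumes T: "compact_restriction G s T" and G: "hilbert_on G s"
    and u: "\<And>n::nat. u n \<in> G" "\<And>n. sdist s (u n) 0 \<le> K"
  shows "\<exists>r. strict_mono r \<and> Cauchy (\<lambda>n. T (u (r n)))"
proof -
  interpret hilbert_space_on G s by unfold_locales fact
  \<comment> \<open>Scales the sequence into the unit ball; \<open>\<bar>K\<bar> + 1\<close> is
    positive whatever the sign of \<open>K\<close>.\<close>
  define c where "c = complex_of_real (1 / (\<bar>K\<bar> + 1))"
  have K: "0 < \<bar>K\<bar> + 1" by linarith
  define S where "S = closure (T ` {u \<in> G. sdist s u 0 \<le> 1})"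
  define x where "x n = T (c *\<^sub>C u n)" for n
  have "x n \<in> S" for n
  proof -
    have "N (u n) \<le> \<bar>K\<bar> + 1" using u(2)[of n] by (simp add: N_def)
    then have "cmod c * N (u n) \<le> 1" using K by (simp add: c_def norm_divide divide_le_eq)
    then have "N (c *\<^sub>C u n) \<le> 1" by (simp only: N_scale[OF u(1)])
    then have "c *\<^sub>C u n \<in> {u \<in> G. sdist s u 0 \<le> 1}"
      using V_scale[OF u(1)] unfolding N_def by blast
    then show ?thesis unfolding S_def x_def by (intro subsetD[OF closure_subset] imageI)
  qed
  moreover have "compact S"
    using T unfolding S_def compact_restriction_def by (rule conjunct2)
  then have "seq_compact S" by (rule compact_imp_seq_compact)
  ultimately obtain l r where r: "strict_mono r" "(x \<circ> r) \<longlonglongrightarrow> l"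
    unfolding seq_compact_def by metis
  have "Cauchy (\<lambda>n. inverse c *\<^sub>C T (c *\<^sub>C u (r n)))"
    using LIMSEQ_imp_Cauchy[OF r(2)] bounded_linear.Cauchy[OF bounded_linear_scaleC]
    by (simp add: comp_def x_def)
  moreover have "inverse c *\<^sub>C T (c *\<^sub>C x) = T x" for x
  proof -
    have "1 / (\<bar>K\<bar> + 1) \<noteq> 0" using K by simp
    then have "c \<noteq> 0" by (simp only: c_def of_real_eq_0_iff not_False_eq_True)
    then show ?thesis using T
      by (simp add: compact_restriction_def bounded_ops_scaleC scaleC_scaleC scaleC_one)
  qed
  ultimately show ?thesis using r(1) by auto
qed

lemma Cauchy_swap: "Cauchy (\<lambda>n. a n - b n) \<Longrightarrow> Cauchy (\<lambda>n. b n - a n :: 'a::real_normed_vector)"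
  by (rule Cauchy_dominated[OF _ Cauchy_const Cauchy_const, where K = 1])
    (auto simp: norm_minus_commute algebra_simps)

lemma weighted_id: "weighted id_blinfun = cinner"
  by (simp add: weighted_def fun_eq_iff)

theorem theorem8p3:
  fixes QH :: "('x::metric_space \<Rightarrow> complex) \<Rightarrow> ('h::complex_hilbert \<Rightarrow>\<^sub>L 'h)"
    and QK :: "('x \<Rightarrow> complex) \<Rightarrow> ('k::complex_hilbert \<Rightarrow>\<^sub>L 'k)"
    and G :: "'h set" and sG :: "'h \<Rightarrow> 'h \<Rightarrow> complex"
    and d :: "'h \<Rightarrow> 'k"
    and lam :: "'h \<Rightarrow>\<^sub>L 'h" and Lam :: "'k \<Rightarrow>\<^sub>L 'k"
  assumes X_locally_compact: "locally compact (UNIV :: 'x set)"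
    and X_not_compact: "\<not> compact (UNIV :: 'x set)"
    and X_balls: "\<forall>(x::'x) r. compact (cball x r)"
    and GH: "compact_friedrichs_module G sG QH"
    and K: "hilbert_module QK"
    and d: "first_order_operator QH QK G d"
    and lam: "selfadjoint_bounded lam" "0 < op_inf lam"
      "compact_restriction G sG (lam - id_blinfun)"
    and Lam: "selfadjoint_bounded Lam" "0 < op_inf Lam"
      "Lam - id_blinfun \<in> B0 QK"
  shows "essential_spectrum cinner (form_operator cinner G (\<lambda>v u. cinner (d v) (d u))) =
         essential_spectrum (weighted lam)
           (form_operator (weighted lam) G (\<lambda>v u. weighted Lam (d v) (d u)))"
proof -
  have H: "hilbert_module QH" and sG: "hilbert_on G sG"
    using GH by (simp_all add: compact_friedrichs_module_def friedrichs_module_def)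
  have cdd: "closed_densely_defined G d" using d by (simp add: first_order_operator_def)
  obtain k1 where k1: "0 < k1" "\<And>u. k1 * (norm u)\<^sup>2 \<le> Re (cinner u (lam u))"
    using op_inf_lower_bound[OF lam(1,2)] by blast
  obtain k2 where k2: "0 < k2" "\<And>u. k2 * (norm u)\<^sup>2 \<le> Re (cinner u (Lam u))"
    using op_inf_lower_bound[OF Lam(1,2)] by blast
  have WL: "weighted_form G d lam Lam (min k1 k2)"
  proof
    show "min k1 k2 * (norm u)\<^sup>2 \<le> Re (cinner u (lam u))" for u
      using k1(2)[of u] mult_right_mono[of "min k1 k2" k1 "(norm u)\<^sup>2"] by auto
    show "min k1 k2 * (norm u)\<^sup>2 \<le> Re (cinner u (Lam u))" for u
      using k2(2)[of u] mult_right_mono[of "min k1 k2" k2 "(norm u)\<^sup>2"] by auto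
  qed (use cdd lam Lam k1 k2 in auto)
  have WI: "weighted_form G d id_blinfun id_blinfun 1"
    by unfold_locales
      (simp_all add: cdd selfadjoint_bounded_def bounded_ops_def norm_Re_cinner_self)
  interpret L: weighted_form G d lam Lam "min k1 k2" by (rule WL)
  interpret I: weighted_form G d id_blinfun id_blinfun 1 by (rule WI)
  obtain c where c: "\<And>u. u \<in> G \<Longrightarrow> norm u \<le> c * sdist sG u 0"
    using GH by (auto simp: compact_friedrichs_module_def friedrichs_module_def)
  \<comment> \<open>\<open>I.form\<close> is the graph scalar product of \<open>d\<close>.
    Compactness is assumed for the norm of \<open>sG\<close>, while the sequences are bounded in the
    graph norm, so the former has to be dominated by the latter.\<close>
  have nI: "norm u \<le> 1 * sdist I.form u 0" for u
    using I.norm_le_form(2)[of u] by (simp add: sdist_def)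
  then obtain C where C: "\<And>u. u \<in> G \<Longrightarrow> sdist sG u 0 \<le> C * sdist I.form u 0"
    using hilbert_norm_domination[OF I.hilbert_on_form sG nI c] by blast
  have compact_subseq: "\<exists>r. strict_mono r \<and> Cauchy (\<lambda>n. T (u (r n)))"
    if T: "compact_restriction G sG T" and u: "\<And>n::nat. u n \<in> G" "Bseq u" "Bseq (\<lambda>n. d (u n))"
    for T :: "'h \<Rightarrow>\<^sub>L 'h" and u
  proof -
    obtain A where A: "\<And>n. norm (u n) \<le> A" using u(2) BseqE by blast
    obtain B where B: "\<And>n. norm (d (u n)) \<le> B" using u(3) BseqE by blast
    have "sdist sG (u n) 0 \<le> \<bar>C\<bar> * (B + A)" for n
    proof -
      have "sdist I.form (u n) 0 = sqrt ((norm (d (u n)))\<^sup>2 + (norm (u n))\<^sup>2)"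
        by (simp add: sdist_def I.form_def norm_Re_cinner_self)
      also have "\<dots> \<le> norm (d (u n)) + norm (u n)" by (rule sqrt_sum_squares_le_sum) auto
      finally have "sdist I.form (u n) 0 \<le> B + A" using A[of n] B[of n] by linarith
      moreover have "0 \<le> sdist I.form (u n) 0"
        using order_trans[OF norm_ge_zero nI[of "u n"]] by simp
      ultimately show ?thesis
        using C[OF u(1)[of n]] mult_mono[OF abs_ge_self[of C] \<open>sdist I.form (u n) 0 \<le> B + A\<close>]
        by linarith
    qed
    then show ?thesis by (rule compact_restriction_Cauchy[OF T sG u(1)])
  qed
  fix x0 :: 'x
  define \<eta> where "\<eta> = (\<lambda>x. complex_of_real (slow x0 1 x))"
  have "\<eta> \<in> C0" unfolding \<eta>_def by (rule slow_C0[OF X_balls]) simp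
  then have eta: "compact_restriction G sG (QH \<eta>)"
    using GH by (simp add: compact_friedrichs_module_def)
  \<comment> \<open>\<open>y\<close> solves an unperturbed equation, which yields bounded vectors
    \<open>f n\<close> representing the adjoint of \<open>d\<close> applied to
    \<open>d (y n)\<close>. For \<open>u\<close> only boundedness in the graph norm is required, so
    the two sequences may differ.\<close>
  have key: "\<exists>r. strict_mono r \<and> Cauchy (\<lambda>n. lam (u (r n)) - u (r n)) \<and>
      Cauchy (\<lambda>n. Lam (d (y (r n))) - d (y (r n)))"
    if yh: "\<And>n::nat. (y n, h n) \<in> I.op z" and By: "Bseq y" and Bh: "Bseq h"
      and u: "\<And>n. u n \<in> G" "Bseq u" "Bseq (\<lambda>n. d (u n))" for y h z u
  proof -
    have yG: "y n \<in> G" for n using I.opD(1)[OF yh] .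
    have Bd: "Bseq (\<lambda>n. d (y n))" by (rule I.Bseq_d[OF yh By Bh])
    define f where "f n = z *\<^sub>C y n + h n" for n
    have f: "cinner (f n) v = cinner (d (y n)) (d v)" if "v \<in> G" for n v
    proof -
      have "cinner (d v) (d (y n)) = cinner v (f n)"
        using I.opD(2)[OF yh that, of n] by (simp add: f_def cinner_simps)
      then show ?thesis by (metis cinner_commute)
    qed
    have Bf: "Bseq f"
    proof -
      obtain A where A: "\<And>n. norm (y n) \<le> A" using By BseqE by blast
      obtain B where B: "\<And>n. norm (h n) \<le> B" using Bh BseqE by blast
      have "norm (f n) \<le> cmod z * A + B" for n
        using norm_triangle_ineq[of "z *\<^sub>C y n" "h n"] A[of n] B[of n]
          mult_left_mono[OF A[of n], of "cmod z"] by (simp add: f_def norm_scaleC)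
      then show ?thesis by (rule BseqI')
    qed
    \<comment> \<open>The first extraction makes the cut-off \<open>y\<close> Cauchy, as the first
      order argument requires; the second, inside it, deals with \<open>lam - 1\<close> on
      \<open>u\<close>.\<close>
    obtain r1 where r1: "strict_mono r1" "Cauchy (\<lambda>n. QH \<eta> (y (r1 n)))"
      using compact_subseq[OF eta yG By Bd] by blast
    obtain r2 where r2: "strict_mono r2" "Cauchy (\<lambda>n. (lam - id_blinfun) (u (r1 (r2 n))))"
      using compact_subseq[OF lam(3), of "\<lambda>n. u (r1 n)"] u Bseq_subseq[of u r1]
        Bseq_subseq[of "\<lambda>n. d (u n)" r1] by auto
    define r where "r = r1 \<circ> r2"
    have r: "strict_mono r" unfolding r_def by (rule strict_mono_comp[OF r1(1) r2(1)])
    have "Cauchy (\<lambda>n. QH \<eta> (y (r n)))"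
      using Cauchy_subseq_Cauchy[OF r1(2) r2(1)] by (simp add: comp_def r_def)
    then have "Cauchy (\<lambda>n. QK \<phi> (d (y (r n))))" if "\<phi> \<in> C0" for \<phi>
      unfolding \<eta>_def using that By Bf Bd
      by (intro first_order_Cauchy[OF X_not_compact X_balls H K d, of "\<lambda>n. y (r n)" "\<lambda>n. f (r n)" x0])
        (simp_all add: yG f Bseq_subseq Bseq_subseq[OF Bd, of r])
    moreover have "Bseq (\<lambda>n. d (y (r n)))" using Bd by (rule Bseq_subseq)
    ultimately have "Cauchy (\<lambda>n. (Lam - id_blinfun) (d (y (r n))))"
      by (intro module_morphism.B0_Cauchy[OF _ Lam(3)]) (simp_all add: module_morphism_def K)
    then show ?thesis using r r2(2) by (auto simp: blinfun.diff_left r_def)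
  qed
  have "semi_fredholm (I.op z) \<longleftrightarrow> semi_fredholm (L.op z)" for z
  proof
    assume "semi_fredholm (I.op z)"
    then show "semi_fredholm (L.op z)"
    \<comment> \<open>Here \<open>u\<close> belongs to the perturbed operator, so \<open>key\<close>
      is applied to the auxiliary solution \<open>v\<close>, with parameter
      \<open>- 1\<close>.\<close>
    proof (rule semi_fredholm_transfer[OF WL WI])
      fix u g v
      assume ug: "\<And>n::nat. (u n, g n) \<in> L.op z" and u: "Bseq u" and g: "Bseq g" and v: "Bseq v"
        and vu: "\<And>n. (v n, (z + 1) *\<^sub>C id_blinfun (u n)) \<in> I.op (- 1)"
      obtain A where A: "\<And>n. norm (u n) \<le> A" using u BseqE by blast
      have "Bseq (\<lambda>n. (z + 1) *\<^sub>C id_blinfun (u n))"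
        using A by (intro BseqI'[where K = "cmod (z + 1) * A"]) (simp add: norm_scaleC mult_left_mono)
      from key[OF vu v this L.opD(1)[OF ug] u L.Bseq_d[OF ug u g]] obtain r
        where "strict_mono r" "Cauchy (\<lambda>n. lam (u (r n)) - u (r n))"
          "Cauchy (\<lambda>n. Lam (d (v (r n))) - d (v (r n)))" by blast
      then show "\<exists>r y. strict_mono r \<and> (y = u \<or> y = v) \<and>
          Cauchy (\<lambda>n. id_blinfun (u (r n)) - lam (u (r n))) \<and>
          Cauchy (\<lambda>n. id_blinfun (d (y (r n))) - Lam (d (y (r n))))"
        by (intro exI[of _ r] exI[of _ v]) (simp add: Cauchy_swap)
    qed
  next
    assume "semi_fredholm (L.op z)"
    then show "semi_fredholm (I.op z)"
    \<comment> \<open>Here \<open>u\<close> itself solves the unperturbed equation and plays both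
      parts in \<open>key\<close>.\<close>
    proof (rule semi_fredholm_transfer[OF WI WL])
      fix u g v
      assume ug: "\<And>n::nat. (u n, g n) \<in> I.op z" and u: "Bseq u" and g: "Bseq g"
      from key[OF ug u g I.opD(1)[OF ug] u I.Bseq_d[OF ug u g]]
      show "\<exists>r y. strict_mono r \<and> (y = u \<or> y = v) \<and>
          Cauchy (\<lambda>n. lam (u (r n)) - id_blinfun (u (r n))) \<and>
          Cauchy (\<lambda>n. Lam (d (y (r n))) - id_blinfun (d (y (r n))))"
        by auto
    qed
  qed
  then show ?thesis
    using I.fredholm_iff_semi_fredholm L.fredholm_iff_semi_fredholm
    unfolding essential_spectrum_def weighted_id by simp
qed

end
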